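(* Let $n\ge 2$ be an even integer, let $u$ be a real number with $0<u<\log\left((3+\sqrt5)/2\right)$, and put $\xi=2\pi i+u$. Then, as $N\to\infty$, $$J^{(n)}_{N}\left(4_1;\exp\left(\tfrac{\xi}{N+n-2}\right)\right)\ \sim\ \left((1-e^{u-\varphi(u)})(1-e^{\varphi(u)})\right)^{n-2}\,\frac{1}{(n-2)!}\,\frac{1}{(e^{u}-1)^{n-2}}\,\frac{\sqrt{-\pi}}{2\sinh(u/2)}\,T(u)^{1/2}\left(\frac{N+n-2}{\xi}\right)^{\frac12+(n-2)}\exp\left(\frac{N+n-2}{\xi}\,S(u)\right),$$ where $$S(u)=\operatorname{Li}_2\left(e^{u-\varphi(u)}\right)-\operatorname{Li}_2\left(e^{u+\varphi(u)}\right)-u\,\varphi(u),\qquad T(u)=\frac{2}{\sqrt{(e^{u}+e^{-u}+1)(e^{u}+e^{-u}-3)}},$$ and $\varphi(u)=\operatorname{arccosh}\left(\cosh(u)-\tfrac12\right)$, with the branch for which $\varphi(u)=-i\arccos\left(\cosh(u)-\tfrac12\right)$. Here $A_N\sim B_N$ means $A_N/B_N\to1$ as $N\to\infty$.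
   Context: $J^{(n)}_N(4_1;q)$ is the $SU(n)$ invariant (colored HOMFLY polynomial associated with the symmetric representation) of the figure-eight knot $4_1$, given for integers $N\ge1$, $n\ge2$ by $$J_{N}^{(n)}(4_1;q)=\frac{1}{[n-2]!}\sum_{k=0}^{N-1}\frac{[n-2+k]!}{[k]!}\,q^{-k\left(N+\frac{n-2}{2}\right)}\prod_{l=1}^{k}\left(1-q^{N-l}\right)\left(1-q^{N+l+n-2}\right),$$ with the convention $[m]=q^{m/2}-q^{-m/2}$, $[m]!=[m][m-1]\cdots[1]$, $[0]!=1$. For $q=\exp(\xi/(N+n-2))$, a power $q^{a}$ means $\exp(a\xi/(N+n-2))$. $\operatorname{Li}_2(z)=-\int_0^z\frac{\log(1-x)}{x}\,dx$ is the dilogarithm, analytic on $\mathbb{C}\setminus[1,\infty)$ (principal branch). Note that $\cosh(u)-\frac12\in(\frac12,1)$, so $\varphi(u)$ is purely imaginary with $\operatorname{Im}\varphi(u)\in(-\pi/3,0)$. All square roots and half-integer powers are principal; in particular $\sqrt{-\pi}=i\sqrt{\pi}$, and the square root of the negative real number $(e^{u}+e^{-u}+1)(e^{u}+e^{-u}-3)$ is $i$ times a positive real number. *)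

theory Defs
  imports "HOL-Complex_Analysis.Complex_Analysis" "HOL-Library.Landau_Symbols"
begin

(* The invariant contains half-integer powers of q, so it is a function of a chosen logarithm h
   of q rather than of q = exp h itself; qpow h a stands for q^a. *)

definition qpow :: "complex \<Rightarrow> real \<Rightarrow> complex" where
  "qpow h a = exp (of_real a * h)"

definition qint :: "complex \<Rightarrow> nat \<Rightarrow> complex" where
  "qint h m = qpow h (real m / 2) - qpow h (- (real m / 2))"

definition qfact :: "complex \<Rightarrow> nat \<Rightarrow> complex" where
  "qfact h m = (\<Prod>i=1..m. qint h i)"

(* The SU(n) invariant of the figure-eight knot for n \<ge> 2, N \<ge> 1, at q = exp h. *)

definition J_fig8 :: "nat \<Rightarrow> nat \<Rightarrow> complex \<Rightarrow> complex" where
  "J_fig8 n N h =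
     1 / qfact h (n - 2) *
     (\<Sum>k=0..N-1. qfact h (n - 2 + k) / qfact h k
        * qpow h (- real k * (real N + (real n - 2) / 2))
        * (\<Prod>l=1..k. (1 - qpow h (real N - real l)) * (1 - qpow h (real N + real l + real n - 2))))"

(* Principal branch: for z outside [1, \<infinity>) the segment from 0 to z avoids the branch cut of
   Ln (1 - x). The value of the integrand at x = 0 is immaterial. *)

definition Li2 :: "complex \<Rightarrow> complex" where
  "Li2 z = - contour_integral (linepath 0 z) (\<lambda>x. Ln (1 - x) / x)"

definition phi :: "real \<Rightarrow> complex" where
  "phi u = - \<i> * of_real (arccos (cosh u - 1 / 2))"

(* phi is a branch of arccosh (cosh u - 1/2) on the range of u in question. *)

lemma cosh_phi:
  assumes "\<bar>cosh u - 1 / 2\<bar> \<le> 1"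
  shows "cosh (phi u) = of_real (cosh u - 1 / 2)"
proof -
  have "cosh (phi u) = cos (of_real (arccos (cosh u - 1 / 2)))"
    by (simp add: phi_def cosh_def cos_exp_eq scaleR_conv_of_real add.commute)
  also have "\<dots> = of_real (cos (arccos (cosh u - 1 / 2)))"
    by (rule cos_of_real)
  finally show ?thesis
    using assms by (simp add: cos_arccos_abs)
qed

definition S :: "real \<Rightarrow> complex" where
  "S u = Li2 (exp (of_real u - phi u)) - Li2 (exp (of_real u + phi u)) - of_real u * phi u"

(* For 0 < u < ln ((3 + sqrt 5) / 2) the radicand is negative, and csqrt gives \<i> times a
   positive real. *)

definition T :: "real \<Rightarrow> complex" where
  "T u = 2 / csqrt (of_real ((exp u + exp (- u) + 1) * (exp u + exp (- u) - 3)))"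

end

theory Submission
  imports Defs "HOL-Probability.Distributions" "HOL-Real_Asymp.Real_Asymp"
begin

text \<open>
  Put \<open>M = N + n - 2\<close>, \<open>h = \<xi> / M\<close> and \<open>p = e\<^sup>-\<^sup>h\<close>. Up to a prefactor and a harmless factor \<open>rho\<close>, the
  \<open>k\<close>-th summand of the invariant is \<open>g(k h)\<close> with
  \<open>g(k h) = f(h) \<cdots> f(k h)\<close> and \<open>f(z) = 2 cosh u - 2 cosh z\<close>. A ratio of infinite q-Pochhammer symbols in
  \<open>p\<close> extends \<open>g\<close> holomorphically to \<open>Re z > - u\<close>, so that \<open>g(z + h) = f(z + h) g(z)\<close> and
  \<open>g \<approx> exp (V / h)\<close> for a combination \<open>V\<close> of dilogarithms with \<open>exp V' = f\<close>. By the residue theorem the sum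
  equals \<open>1 / h\<close> times the integral of \<open>rho g / (E - 1)\<close>, \<open>E(z) = exp (2 \<pi> i z / h)\<close>, around the points
  \<open>k h\<close>. On the imaginary axis, to their left, \<open>E\<close> is exponentially small and \<open>f\<close> is positive, so the integral
  there is a Laplace integral with its peak where \<open>f = 1\<close>, at \<open>z = (2 \<pi> - \<theta>) i\<close> with
  \<open>cos \<theta> = cosh u - 1/2\<close>. On the rest of the contour \<open>1 / E\<close>, or the monotonicity of \<open>Re (V / \<xi>)\<close>, makes the
  integrand exponentially smaller. The value of \<open>V\<close> at the peak is \<open>S(u)\<close> by the inversion formula of the
  dilogarithm.
\<close>

section \<open>The dilogarithm\<close>

text \<open>The saddle has real part 0, so it lies off the segment from 0 to \<open>\<xi>\<close>
  that carries the points k h. Reaching it means exploiting cancellation between summands, and the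
  kernel 1 / (E - 1) makes that visible. Two obstacles shape the contour. First, \<open>V\<close>
  has logarithmic branch points at +-u + 2 pi i k, and one of them is \<open>\<xi>\<close>, the
  right end of the sum. The contour therefore stops at a grid index k1 near (1 - eps) M. The
  summands beyond it are bounded directly: f vanishes at \<open>\<xi>\<close>, so the products no
  longer grow there. Second, the uniform expansion of g holds only for |Re z| < u, while the slanted
  side must lie far enough to the right for 1 / E to win, and so it leaves this strip. There g is
  controlled by iterating its functional equation. The choice of M gives M h = \<open>\<xi>\<close>,
  hence q^M = e^u. Every factor of the invariant then has the form 1 - e^(j h) or 1 - e^(u +- j h),
  and \<open>rho\<close> absorbs the index shift by n - 2.\<close>

definition cut_plane :: "complex set" where
  "cut_plane = {z. Im z = 0 \<longrightarrow> Re z < 1}"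

lemma one_minus_cut_plane: "z \<in> cut_plane \<longleftrightarrow> 1 - z \<notin> \<real>\<^sub>\<le>\<^sub>0"
  by (auto simp: cut_plane_def complex_nonpos_Reals_iff)

lemma open_cut_plane: "open cut_plane"
proof -
  have "cut_plane = (\<lambda>z. 1 - z) -` (- \<real>\<^sub>\<le>\<^sub>0)"
    by (auto simp: one_minus_cut_plane)
  moreover have "open ((\<lambda>z. 1 - z) -` (- (\<real>\<^sub>\<le>\<^sub>0 :: complex set)))"
    by (intro continuous_open_vimage) (auto intro!: continuous_intros)
  ultimately show ?thesis by simp
qed

lemma norm_less_1_cut_plane: "norm z < 1 \<Longrightarrow> z \<in> cut_plane"
  using abs_Re_le_cmod[of z] by (auto simp: cut_plane_def)

lemma closed_segment_0_cut_plane: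
  assumes "z \<in> cut_plane"
  shows "closed_segment 0 z \<subseteq> cut_plane"
proof
  fix x assume "x \<in> closed_segment 0 z"
  then obtain t where t: "0 \<le> t" "t \<le> 1" "x = of_real t * z"
    by (auto simp: in_segment scaleR_conv_of_real)
  show "x \<in> cut_plane"
    using assms t mult_left_le_one_le[of "Re z" t] 
    by (cases "Re z \<ge> 0")
       (auto simp: cut_plane_def intro: le_less_trans[OF mult_nonneg_nonpos, of t "Re z" 1]
          intro: le_less_trans)
qed

lemma starlike_cut_plane: "starlike cut_plane"
  unfolding starlike_def using closed_segment_0_cut_plane
  by (intro bexI[of _ 0]) (auto simp: cut_plane_def)

text \<open>The removable singularity at 0 is filled with the limit -1. Continuity there is what
  allows 0 as an exceptional point in the theorem on primitives.\<close>

definition Li2_integrand :: "complex \<Rightarrow> complex" where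
  "Li2_integrand x = (if x = 0 then -1 else Ln (1 - x) / x)"

lemma tendsto_Li2_integrand: "((\<lambda>x::complex. Ln (1 - x) / x) \<longlongrightarrow> -1) (at 0)"
proof -
  have "((\<lambda>x::complex. Ln (1 - x)) has_field_derivative (-1)) (at 0)"
    by (auto intro!: derivative_eq_intros simp: complex_nonpos_Reals_iff)
  then show ?thesis
    by (simp add: has_field_derivative_iff)
qed

lemma continuous_on_Li2_integrand: "continuous_on cut_plane Li2_integrand"
proof (rule continuous_at_imp_continuous_on, rule ballI)
  fix x assume x: "x \<in> cut_plane"
  show "isCont Li2_integrand x"
  proof (cases "x = 0")
    case True
    have "(Li2_integrand \<longlongrightarrow> -1) (at 0)"
      using tendsto_Li2_integrand
      by (rule Lim_transform_eventually) (auto simp: Li2_integrand_def eventually_at_filter)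
    then show ?thesis
      using True by (simp add: isCont_def Li2_integrand_def)
  next
    case False
    have "isCont (\<lambda>x. Ln (1 - x) / x) x"
      using x False by (auto intro!: continuous_intros simp: one_minus_cut_plane)
    moreover have "\<forall>\<^sub>F y in nhds x. Li2_integrand y = Ln (1 - y) / y"
      using t1_space_nhds[OF False] by eventually_elim (auto simp: Li2_integrand_def)
    ultimately show ?thesis
      using isCont_cong by fast
  qed
qed

text \<open>\<open>Li2\<close> integrates along one particular segment, whereas differentiability
  needs a primitive on the whole cut plane. One exists because the cut plane is starlike about 0.
  Changing the integrand at the single point 0 does not affect the contour integral.\<close>

lemma Li2_primitive:
  "\<exists>G. (\<forall>x\<in>cut_plane. (G has_field_derivative Li2_integrand x) (at x)) \<and>
       (\<forall>z\<in>cut_plane. Li2 z = G 0 - G z)"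
proof -
  have "Li2_integrand field_differentiable at x" if "x \<in> cut_plane - {0}" for x
  proof -
    have "(\<lambda>x. Ln (1 - x) / x) field_differentiable at x"
      by (rule analytic_on_imp_differentiable_at[of _ "{x}"])
         (use that in \<open>auto intro!: analytic_intros simp: one_minus_cut_plane\<close>)
    then obtain D where "((\<lambda>x. Ln (1 - x) / x) has_field_derivative D) (at x)"
      unfolding field_differentiable_def by blast
    then have "(Li2_integrand has_field_derivative D) (at x)"
      by (rule has_field_derivative_transform_within_open[of _ _ _ "- {0}"])
         (use that in \<open>auto simp: Li2_integrand_def\<close>)
    then show ?thesis
      unfolding field_differentiable_def by blast
  qed
  then obtain G where G: "\<And>x. x \<in> cut_plane \<Longrightarrow> (G has_field_derivative Li2_integrand x) (at x)"
    using holomorphic_starlike_primitive[OF continuous_on_Li2_integrand starlike_cut_plane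
        open_cut_plane, of "{0}"] by auto
  have "Li2 z = G 0 - G z" if z: "z \<in> cut_plane" for z
  proof (cases "z = 0")
    case False
    have "(Li2_integrand has_contour_integral (G z - G 0)) (linepath 0 z)"
      using contour_integral_primitive[of cut_plane G Li2_integrand "linepath 0 z"]
        closed_segment_0_cut_plane[OF z] G
      by (auto intro: has_field_derivative_at_within)
    then have "contour_integral (linepath 0 z) Li2_integrand = G z - G 0"
      by (rule contour_integral_unique)
    moreover have "contour_integral (linepath 0 z) Li2_integrand =
        contour_integral (linepath 0 z) (\<lambda>x. Ln (1 - x) / x)"
      by (rule contour_integral_spike_finite_simple_path[of "{0}"])
         (use False in \<open>auto simp: Li2_integrand_def intro: simple_path_linepath\<close>)
    ultimately show ?thesis
      by (simp add: Li2_def)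
  qed (simp add: Li2_def)
  then show ?thesis using G by blast
qed

lemma has_field_derivative_Li2:
  assumes "z \<in> cut_plane"
  shows "(Li2 has_field_derivative - Li2_integrand z) (at z)"
proof -
  obtain G where G: "\<And>x. x \<in> cut_plane \<Longrightarrow> (G has_field_derivative Li2_integrand x) (at x)"
      and eq: "\<And>z. z \<in> cut_plane \<Longrightarrow> Li2 z = G 0 - G z"
    using Li2_primitive by auto
  have "((\<lambda>x. G 0 - G x) has_field_derivative - Li2_integrand z) (at z)"
    using G[OF assms] by (auto intro!: derivative_eq_intros)
  then show ?thesis
    by (rule has_field_derivative_transform_within_open[OF _ open_cut_plane assms]) (simp add: eq)
qed

lemma Li2_0 [simp]: "Li2 0 = 0"
  by (simp add: Li2_def)

lemma has_field_derivative_Li2_exp: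
  assumes "exp w \<in> cut_plane"
  shows "((\<lambda>w. Li2 (exp w)) has_field_derivative - Ln (1 - exp w)) (at w)"
proof -
  have "((\<lambda>w. Li2 (exp w)) has_field_derivative - Li2_integrand (exp w) * exp w) (at w)"
    using DERIV_chain2[OF has_field_derivative_Li2[OF assms] DERIV_exp] .
  then show ?thesis
    by (simp add: Li2_integrand_def)
qed

section \<open>Power series in the unit disc\<close>

lemma Ln_sums:
  fixes x :: complex
  assumes "norm x < 1"
  shows "(\<lambda>n. x ^ Suc n / of_nat (Suc n)) sums (- Ln (1 - x))"
proof -
  have "(\<lambda>n. - ((- (- x)) ^ n) / of_nat n) sums Ln (1 + - x)"
    using assms by (intro Ln_series') auto
  then have "(\<lambda>n. x ^ n / of_nat n) sums (- Ln (1 - x))"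
    using sums_minus by fastforce
  then show ?thesis
    by (subst sums_Suc_iff) auto
qed

text \<open>Both sides vanish at 0 and have equal derivatives on the unit disc, by termwise
  differentiation and the series of the logarithm.\<close>

lemma Li2_sums:
  assumes x: "norm x < 1"
  shows "(\<lambda>n. x ^ Suc n / of_nat (Suc n) ^ 2) sums Li2 x"
proof -
  define c :: "nat \<Rightarrow> complex" where "c n = (if n = 0 then 0 else 1 / of_nat n ^ 2)" for n
  define F where "F y = (\<Sum>n. c n * y ^ n)" for y
  have sm: "summable (\<lambda>n. c n * y ^ n)" if "norm y < 1" for y :: complex
  proof (rule summable_comparison_test')
    show "summable (\<lambda>n. norm y ^ n)"
      using that by (simp add: summable_geometric)
    show "norm (c n * y ^ n) \<le> norm y ^ n" if "n \<ge> 0" for n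
    proof (cases "n = 0")
      case False
      then have "(1::real) \<le> real n ^ 2" by simp
      then show ?thesis
        using False by (simp add: c_def norm_mult norm_divide norm_power divide_le_eq
            mult_le_cancel_left1)
    qed (simp add: c_def)
  qed
  have der: "(F has_field_derivative - Li2_integrand y) (at y)" if y: "norm y < 1" for y
  proof -
    have 1: "(F has_field_derivative (\<Sum>n. diffs c n * y ^ n)) (at y)"
      unfolding F_def by (rule termdiffs_strong'[of 1]) (use y sm in auto)
    have "(\<lambda>n. diffs c n * y ^ n) sums (- Li2_integrand y)"
    proof (cases "y = 0")
      case True
      then show ?thesis
        using powser_sums_zero[of "diffs c"]
        by (simp add: Li2_integrand_def diffs_def c_def)
    next
      case False
      have "(\<lambda>n. y ^ Suc n / of_nat (Suc n) / y) sums (- Ln (1 - y) / y)"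
        using Ln_sums[OF y] by (rule sums_divide)
      moreover have "y ^ Suc n / of_nat (Suc n) / y = diffs c n * y ^ n" for n
        using False by (simp add: diffs_def c_def power2_eq_square del: of_nat_Suc)
      ultimately show ?thesis
        using False by (simp add: Li2_integrand_def)
    qed
    then show ?thesis
      using 1 by (simp add: sums_iff)
  qed
  have "Li2 x - F x = Li2 0 - F 0"
  proof (rule has_derivative_zero_unique[of "ball 0 1" "\<lambda>x. Li2 x - F x" x 0, THEN trans])
    fix y :: complex assume "y \<in> ball 0 1"
    then have y: "norm y < 1" by simp
    have "((\<lambda>x. Li2 x - F x) has_field_derivative 0) (at y)"
      using DERIV_diff[OF has_field_derivative_Li2[OF norm_less_1_cut_plane[OF y]] der[OF y]]
      by simp
    then show "((\<lambda>x. Li2 x - F x) has_derivative (\<lambda>h. 0)) (at y within ball 0 1)"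
      by (simp add: has_field_derivative_def has_derivative_at_withinI lambda_zero)
  qed (use x in auto)
  moreover have "F 0 = 0"
    using powser_zero[of c] by (simp add: F_def c_def)
  ultimately have "Li2 x = F x" by simp
  moreover have "(\<lambda>n. c n * x ^ n) sums F x"
    unfolding F_def using sm[OF x] by (rule summable_sums)
  ultimately have "(\<lambda>n. c n * x ^ n) sums Li2 x" by simp
  then have "(\<lambda>n. c (Suc n) * x ^ Suc n) sums Li2 x"
    by (subst sums_Suc_iff) (auto simp: c_def)
  then show ?thesis
    by (simp add: c_def del: of_nat_Suc power_Suc)
qed

section \<open>The logarithm of the q-Pochhammer symbol\<close>

text \<open>With p = e^-h this is minus the logarithm of the infinite product (x; p) of all 1 - x
  p^j, j >= 0: expand each logarithm and sum the geometric series over j. Exponents start at 1,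
  hence \<open>Suc n\<close>.\<close>

definition qlog :: "complex \<Rightarrow> complex \<Rightarrow> complex" where
  "qlog h x = (\<Sum>n. x ^ Suc n / (of_nat (Suc n) * (1 - exp (- (of_nat (Suc n) * h)))))"

lemma norm_exp_neg_less_1: "Re w > 0 \<Longrightarrow> norm (exp (- w)) < 1"
  by simp

lemma norm_one_minus_exp_neg:
  "norm (1 - exp (- w)) \<ge> 1 - exp (- Re w)"
  using norm_triangle_ineq2[of 1 "exp (-w)"] by simp

lemma norm_inverse_one_minus_exp:
  assumes "Re h > 0"
  shows "norm (inverse (1 - exp (- (of_nat (Suc n) * h)))) \<le> inverse (1 - exp (- Re h))"
proof -
  have "Re h * 1 \<le> Re h * real (Suc n)"
    using assms by (intro mult_left_mono) auto
  then have "exp (- (real (Suc n) * Re h)) \<le> exp (- Re h)"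
    by (simp add: mult.commute)
  then have "1 - exp (- Re h) \<le> 1 - exp (- (real (Suc n) * Re h))"
    by simp
  also have "\<dots> \<le> norm (1 - exp (- (of_nat (Suc n) * h)))"
    using norm_one_minus_exp_neg[of "of_nat (Suc n) * h"] by simp
  finally have "1 - exp (- Re h) \<le> norm (1 - exp (- (of_nat (Suc n) * h)))" .
  moreover have "1 - exp (- Re h) > 0" using assms by simp
  ultimately show ?thesis
    unfolding norm_inverse by (intro le_imp_inverse_le)
qed

lemma norm_qlog_coeff:
  assumes "Re h > 0"
  shows "norm (inverse (of_nat (Suc n) * (1 - exp (- (of_nat (Suc n) * h))))) \<le> inverse (1 - exp (- Re h))"
proof -
  have "norm (inverse (of_nat (Suc n) :: complex)) \<le> 1"
    by (simp add: norm_inverse inverse_le_1_iff del: of_nat_Suc)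
  then have "norm (inverse (of_nat (Suc n) :: complex)) * norm (inverse (1 - exp (- (of_nat (Suc n) * h))))
      \<le> 1 * inverse (1 - exp (- Re h))"
    using norm_inverse_one_minus_exp[OF assms, of n] by (intro mult_mono) auto
  then show ?thesis
    by (simp add: norm_mult norm_inverse del: of_nat_Suc)
qed

lemma summable_qlog:
  assumes "Re h > 0" "norm x < 1"
  shows "summable (\<lambda>n. x ^ Suc n / (of_nat (Suc n) * (1 - exp (- (of_nat (Suc n) * h)))))"
proof (rule summable_comparison_test')
  show "summable (\<lambda>n. norm x ^ Suc n * inverse (1 - exp (- Re h)))"
    using assms by (intro summable_mult2) (subst summable_Suc_iff, simp add: summable_geometric)
  show "norm (x ^ Suc n / (of_nat (Suc n) * (1 - exp (- (of_nat (Suc n) * h)))))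
      \<le> norm x ^ Suc n * inverse (1 - exp (- Re h))" if "n \<ge> 0" for n
    unfolding divide_inverse norm_mult norm_power
    using norm_qlog_coeff[OF assms(1), of n] by (intro mult_left_mono) auto
qed

lemma holomorphic_qlog:
  assumes "Re h > 0"
  shows "qlog h holomorphic_on ball 0 1"
proof -
  define c where "c n = (if n = 0 then 0 else inverse (of_nat n * (1 - exp (- (of_nat n * h)))))" for n
  show ?thesis
  proof (rule power_series_holomorphic)
    fix w :: complex assume "w \<in> ball 0 1"
    then have w: "norm w < 1" by simp
    have "(\<lambda>n. c (Suc n) * (w - 0) ^ Suc n) sums qlog h w"
      using summable_sums[OF summable_qlog[OF assms w]]
      by (simp add: c_def qlog_def divide_inverse mult_ac del: of_nat_Suc power_Suc)
    then show "(\<lambda>n. c n * (w - 0) ^ n) sums qlog h w"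
      by (subst (asm) sums_Suc_iff) (simp add: c_def)
  qed
qed

text \<open>Replacing x by x p removes the first factor 1 - x of the infinite product. In the
  series, 1 - p^m cancels the denominator and the logarithmic series remains.\<close>

lemma qlog_shift:
  assumes h: "Re h > 0" and x: "norm x < 1"
  shows "qlog h (x * exp (- h)) = qlog h x + Ln (1 - x)"
proof -
  have "norm x * exp (- Re h) < 1 * 1"
    using assms by (intro mult_strict_mono') auto
  then have x': "norm (x * exp (- h)) < 1"
    by (simp add: norm_mult)
  have "(\<lambda>n. x ^ Suc n / (of_nat (Suc n) * (1 - exp (- (of_nat (Suc n) * h)))) -
      (x * exp (- h)) ^ Suc n / (of_nat (Suc n) * (1 - exp (- (of_nat (Suc n) * h)))))
      sums (qlog h x - qlog h (x * exp (- h)))"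
    unfolding qlog_def
    by (intro sums_diff summable_sums summable_qlog[OF h x] summable_qlog[OF h x'])
  moreover have "x ^ Suc n / (of_nat (Suc n) * (1 - exp (- (of_nat (Suc n) * h)))) -
      (x * exp (- h)) ^ Suc n / (of_nat (Suc n) * (1 - exp (- (of_nat (Suc n) * h))))
      = x ^ Suc n / of_nat (Suc n)" for n
  proof -
    have "norm (exp (- (of_nat (Suc n) * h))) < 1"
      using h by (intro norm_exp_neg_less_1) simp
    then have "1 - exp (- (of_nat (Suc n) * h)) \<noteq> 0"
      by (metis norm_one less_irrefl right_minus_eq)
    moreover have "exp (- h) ^ Suc n = exp (- (of_nat (Suc n) * h))"
      by (simp add: exp_of_nat_mult[symmetric] del: of_nat_Suc power_Suc)
    ultimately show ?thesis
      by (simp add: power_mult_distrib divide_simps del: of_nat_Suc power_Suc) (simp add: algebra_simps)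
  qed
  ultimately have "(\<lambda>n. x ^ Suc n / of_nat (Suc n)) sums (qlog h x - qlog h (x * exp (- h)))"
    by simp
  from sums_unique2[OF this Ln_sums[OF x]] show ?thesis
    by (simp add: algebra_simps)
qed

lemma exp_qlog_shift:
  assumes "Re h > 0" "norm x < 1"
  shows "exp (- qlog h x) = (1 - x) * exp (- qlog h (x * exp (- h)))"
proof -
  have "1 - x \<noteq> 0" using assms by auto
  then show ?thesis
    unfolding qlog_shift[OF assms] minus_add_distrib exp_add
    by (simp add: exp_minus[of "Ln (1 - x)"])
qed

text \<open>The series \<open>qlog\<close> converges only in the unit disc. Splitting off J factors
  leaves a tail at x p^J, so this continues the infinite product (x; p) to the disc of radius exp (J
  Re h).\<close>

definition qpoch :: "complex \<Rightarrow> nat \<Rightarrow> complex \<Rightarrow> complex" where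
  "qpoch h J x = (\<Prod>j<J. 1 - x * exp (- (of_nat j * h))) * exp (- qlog h (x * exp (- (of_nat J * h))))"

lemma holomorphic_qpoch:
  assumes h: "Re h > 0"
  shows "qpoch h J holomorphic_on ball 0 (exp (real J * Re h))"
proof -
  have "(\<lambda>x. x * exp (- (of_nat J * h))) ` ball 0 (exp (real J * Re h)) \<subseteq> ball 0 1"
  proof safe
    fix x :: complex assume "x \<in> ball 0 (exp (real J * Re h))"
    then have "norm x * exp (- (real J * Re h)) < exp (real J * Re h) * exp (- (real J * Re h))"
      by (intro mult_strict_right_mono) auto
    then show "x * exp (- (of_nat J * h)) \<in> ball 0 1"
      by (simp add: norm_mult flip: exp_add)
  qed
  then have "qlog h \<circ> (\<lambda>x. x * exp (- (of_nat J * h))) holomorphic_on ball 0 (exp (real J * Re h))"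
    by (intro holomorphic_on_compose_gen[OF _ holomorphic_qlog[OF h]]) (auto intro!: holomorphic_intros)
  then show ?thesis
    unfolding qpoch_def o_def by (intro holomorphic_intros) auto
qed

lemma qpoch_eq_exp_qlog:
  assumes h: "Re h > 0" and x: "norm x < 1"
  shows "qpoch h J x = exp (- qlog h x)"
proof (induction J)
  case (Suc J)
  have "norm x * exp (- (real J * Re h)) \<le> norm x * 1"
    using assms by (intro mult_left_mono) auto
  then have "norm (x * exp (- (of_nat J * h))) < 1"
    using x by (simp add: norm_mult)
  note 1 = exp_qlog_shift[OF h this]
  have 2: "x * exp (- (of_nat J * h)) * exp (- h) = x * exp (- (of_nat (Suc J) * h))"
    by (simp add: algebra_simps flip: exp_add)
  show ?case
    using Suc 1 unfolding qpoch_def 2 prod.lessThan_Suc by (simp add: mult_ac)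
qed (simp add: qpoch_def)

text \<open>J stays fixed: passing from x to x e^h creates a new first factor, and the last finite
  factor on the right is absorbed into the tail. The norm hypothesis keeps the larger tail argument
  in the unit disc.\<close>

lemma qpoch_shift:
  assumes h: "Re h > 0" and x: "norm (x * exp h * exp (- (of_nat J * h))) < 1"
  shows "qpoch h J (x * exp h) = (1 - x * exp h) * qpoch h J x"
proof (cases J)
  case 0
  then show ?thesis
    using exp_qlog_shift[OF h, of "x * exp h"] x by (simp add: qpoch_def mult.assoc flip: exp_add)
next
  case (Suc j)
  have e: "exp h * exp (- (of_nat (Suc j) * h)) = exp (- (of_nat j * h))" for j
    by (simp add: algebra_simps flip: exp_add)
  have "norm (x * exp (- (of_nat j * h))) < 1"
    using x by (simp only: Suc mult.assoc e)
  note 1 = exp_qlog_shift[OF h this]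
  have 2: "exp (- (of_nat j * h)) * exp (- h) = exp (- (of_nat (Suc j) * h))"
    by (simp add: algebra_simps flip: exp_add)
  show ?thesis
    unfolding qpoch_def Suc prod.lessThan_Suc_shift[where n = j and g = "\<lambda>i. 1 - x * exp h * exp (- (of_nat i * h))"]
    using 1 unfolding mult.assoc e 2
    by (simp add: prod.lessThan_Suc mult_ac)
qed

text \<open>Near 0, 1 / (1 - e^-w) = 1/w + 1/2 + O(w). On the ray through \<open>\<xi>\<close> a
  bound linear in r holds for all r > 0, because far from 0 the left side is bounded while r is
  bounded below.\<close>

lemma qlog_remainder_kernel:
  fixes \<xi> :: complex
  assumes "Re \<xi> > 0"
  shows "\<exists>C>0. \<forall>r>0. norm (inverse (1 - exp (- (of_real r * \<xi>))) - inverse (of_real r * \<xi>) - 1 / 2) \<le> C * r"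
proof -
  define s where "s = norm \<xi>"
  have s: "s > 0" using assms by (auto simp: s_def)
  \<comment> \<open>One summand for each of the three terms, valid once the norm of r
    \<open>\<xi>\<close> is at least 1/2.\<close>
  define B where "B = inverse (1 - exp (- (1 / (2 * s) * Re \<xi>))) + 2 + 1 / 2"
  have B0: "inverse (1 - exp (- (1 / (2 * s) * Re \<xi>))) > 0"
    using assms s by simp
  have small: "norm (inverse (1 - exp (- w)) - inverse w - 1 / 2) \<le> 4 * norm w"
    if w: "norm w \<le> 1 / 2" "w \<noteq> 0" for w :: complex
  proof -
    define R where "R = exp (- w) - (1 - w + w ^ 2 / 2)"
    have "norm (exp (- w) - (\<Sum>k\<le>2. (- w) ^ k / fact k)) \<le> exp \<bar>Re (- w)\<bar> * norm (- w) ^ Suc 2 / fact 2"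
      by (rule Taylor_exp)
    moreover have "(\<Sum>k\<le>2. (- w) ^ k / fact k) = 1 - w + w ^ 2 / 2"
      by (simp add: numeral_2_eq_2 field_simps)
    moreover have "exp \<bar>Re (- w)\<bar> \<le> 2"
    proof -
      have "\<bar>Re w\<bar> \<le> 1 / 2" using abs_Re_le_cmod[of w] w by linarith
      then have "exp \<bar>Re w\<bar> \<le> exp (1/2 :: real)" by simp
      also have "exp (1/2 :: real) \<le> 1 + 1/2 + (1/2)^2"
        by (rule exp_bound) auto
      finally show ?thesis by (simp add: power2_eq_square)
    qed
    ultimately have R: "norm R \<le> norm w ^ 3"
      using mult_right_mono[of "exp \<bar>Re (- w)\<bar>" 2 "norm w ^ 3 / 2"] by (simp add: R_def numeral_3_eq_3 fact_numeral field_simps)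
    define D where "D = 1 - exp (- w)"
    have D: "D = w - w ^ 2 / 2 - R" by (simp add: D_def R_def)
    have n3: "norm w ^ 3 \<le> norm w * (1 / 4)"
    proof -
      have "norm w ^ 2 \<le> (1/2)^2" using w by (intro power_mono) auto
      then have "norm w * norm w ^ 2 \<le> norm w * (1 / 4)"
        by (intro mult_left_mono) (auto simp: power2_eq_square)
      then show ?thesis by (simp add: power2_eq_square power3_eq_cube)
    qed
    have n2: "norm w ^ 2 \<le> norm w * (1 / 2)"
      using mult_left_mono[OF w(1), of "norm w"] by (simp add: power2_eq_square)
    have "norm w - norm (w ^ 2 / 2) - norm R \<le> norm D"
      unfolding D using norm_triangle_ineq2[of w "w ^ 2 / 2"] norm_triangle_ineq2[of "w - w ^ 2 / 2" R]
      by linarith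
    then have nD: "norm D \<ge> norm w / 2"
      using n2 n3 R by (simp add: norm_divide norm_power)
    then have D0: "D \<noteq> 0" using w by auto
    \<comment> \<open>The second-order terms in w cancel in the numerator, leaving O(w^3) against a
      denominator of order w^2.\<close>
    have eq: "inverse D - inverse w - 1 / 2 = (R + w ^ 3 / 4 + w * R / 2) / (w * D)"
      using D0 w by (simp add: divide_simps) (simp add: D power2_eq_square power3_eq_cube algebra_simps)
    have "norm (R + w ^ 3 / 4 + w * R / 2) \<le> norm R + norm (w ^ 3 / 4) + norm (w * R / 2)"
      by (intro norm_triangle_le add_mono order_refl)
    also have "\<dots> \<le> norm w ^ 3 + norm w ^ 3 / 4 + norm w ^ 3 / 2"
    proof -
      have "norm w * norm R \<le> 1 * norm w ^ 3"
        using R w by (intro mult_mono) auto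
      moreover have "norm (w * R / 2) = norm w * norm R / 2" "norm (w ^ 3 / 4) = norm w ^ 3 / 4"
        by (simp_all add: norm_mult norm_divide norm_power)
      ultimately show ?thesis using R by linarith
    qed
    also have "\<dots> \<le> 2 * norm w ^ 3" by simp
    finally have num: "norm (R + w ^ 3 / 4 + w * R / 2) \<le> 2 * norm w ^ 3" .
    have "norm (inverse D - inverse w - 1 / 2) \<le> (2 * norm w ^ 3) / (norm w * (norm w / 2))"
    proof -
      have "norm w * (norm w / 2) \<le> norm w * norm D" using nD by (intro mult_left_mono) auto
      moreover have "0 < norm w * (norm w / 2)" using w by simp
      ultimately show ?thesis
        unfolding eq norm_divide norm_mult using num by (intro frac_le) auto
    qed
    also have "\<dots> = 4 * norm w"
      using w by (simp add: field_simps power3_eq_cube)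
    finally show ?thesis by (simp add: D_def)
  qed
  have large: "norm (inverse (1 - exp (- (of_real r * \<xi>))) - inverse (of_real r * \<xi>) - 1 / 2) \<le> B"
    if r: "r \<ge> 1 / (2 * s)" for r
  proof -
    have r0: "r > 0" using r s by (smt (verit) divide_pos_pos)
    have "1 - exp (- (1 / (2 * s) * Re \<xi>)) \<le> 1 - exp (- (r * Re \<xi>))"
      using mult_right_mono[OF r, of "Re \<xi>"] assms by simp
    also have "\<dots> \<le> norm (1 - exp (- (of_real r * \<xi>)))"
      using norm_one_minus_exp_neg[of "of_real r * \<xi>"] by simp
    finally have "inverse (norm (1 - exp (- (of_real r * \<xi>)))) \<le> inverse (1 - exp (- (1 / (2 * s) * Re \<xi>)))"
      using B0 by (intro le_imp_inverse_le) auto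
    moreover have "inverse (norm (of_real r * \<xi>)) \<le> 2"
    proof -
      have "1 / 2 \<le> r * s" using r s by (simp add: field_simps)
      then have "inverse (r * s) \<le> inverse (1 / 2)" by (intro le_imp_inverse_le) auto
      then show ?thesis using r0 by (simp add: norm_mult s_def)
    qed
    moreover have "norm (inverse (1 - exp (- (of_real r * \<xi>))) - inverse (of_real r * \<xi>) - 1 / 2)
      \<le> norm (inverse (1 - exp (- (of_real r * \<xi>)))) + norm (inverse (of_real r * \<xi>)) + norm (1 / 2 :: complex)"
      using norm_triangle_ineq4[of "inverse (1 - exp (- (of_real r * \<xi>)))" "inverse (of_real r * \<xi>)"]
        norm_triangle_ineq4[of "inverse (1 - exp (- (of_real r * \<xi>))) - inverse (of_real r * \<xi>)" "1 / 2"]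
      by linarith
    moreover have "norm (1 / 2 :: complex) = 1 / 2"
      by (simp add: norm_divide)
    ultimately show ?thesis
      unfolding B_def norm_inverse by linarith
  qed
  define C where "C = max (4 * s) (B * (2 * s))"
  have "norm (inverse (1 - exp (- (of_real r * \<xi>))) - inverse (of_real r * \<xi>) - 1 / 2) \<le> C * r"
    if r: "r > 0" for r
  proof (cases "r \<le> 1 / (2 * s)")
    case True
    then have "norm (of_real r * \<xi>) \<le> 1 / 2"
      using r s by (simp add: norm_mult s_def[symmetric] field_simps)
    then have "norm (inverse (1 - exp (- (of_real r * \<xi>))) - inverse (of_real r * \<xi>) - 1 / 2) \<le> 4 * norm (of_real r * \<xi>)"
      using r s by (intro small) (auto simp: s_def)
    also have "\<dots> = (4 * s) * r" using r by (simp add: norm_mult s_def)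
    also have "\<dots> \<le> C * r" using r by (intro mult_right_mono) (auto simp: C_def)
    finally show ?thesis .
  next
    case False
    then have "1 \<le> r * (2 * s)" using s by (simp add: field_simps)
    then have "B * 1 \<le> B * (r * (2 * s))" using B0 by (intro mult_left_mono) (auto simp: B_def)
    also have "\<dots> = (B * (2 * s)) * r" by simp
    also have "\<dots> \<le> C * r" using r by (intro mult_right_mono) (auto simp: C_def)
    finally show ?thesis using large[of r] False by simp
  qed
  moreover have "C > 0" using s by (auto simp: C_def)
  ultimately show ?thesis by blast
qed

text \<open>Exchanging \<open>1 / (1 - e\<^sup>-\<^sup>m\<^sup>h)\<close> for \<open>1 / (m h) + 1 / 2\<close> termwise turns \<open>qlog h\<close> into \<open>Li2 / h - Ln (1 - x) / 2\<close>.\<close>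

lemma qlog_asymptotics:
  fixes \<xi> :: complex
  assumes \<xi>: "Re \<xi> > 0" and \<rho>: "0 \<le> \<rho>" "\<rho> < 1"
  shows "\<exists>C>0. \<forall>M>0. \<forall>x. norm x \<le> \<rho> \<longrightarrow>
    norm (qlog (\<xi> / of_nat M) x - (Li2 x * of_nat M / \<xi> - Ln (1 - x) / 2)) \<le> C / real M"
proof -
  obtain C where C: "C > 0" and bound: "\<And>r. r > 0 \<Longrightarrow>
      norm (inverse (1 - exp (- (of_real r * \<xi>))) - inverse (of_real r * \<xi>) - 1 / 2) \<le> C * r"
    using qlog_remainder_kernel[OF \<xi>] by blast
  have \<xi>0: "\<xi> \<noteq> 0" using \<xi> by auto
  have "norm (qlog (\<xi> / of_nat M) x - (Li2 x * of_nat M / \<xi> - Ln (1 - x) / 2)) \<le> (C / (1 - \<rho>)) / real M"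
    if M: "M > 0" and x: "norm x \<le> \<rho>" for M x
  proof -
    define h where "h = \<xi> / of_nat M"
    have h: "Re h > 0" using M \<xi> by (simp add: h_def)
    have x1: "norm x < 1" using x \<rho> by simp
    define t where "t n = x ^ Suc n / of_nat (Suc n) * (inverse (1 - exp (- (of_nat (Suc n) * h)))
       - inverse (of_nat (Suc n) * h) - 1 / 2)" for n
    have s1: "(\<lambda>n. x ^ Suc n / (of_nat (Suc n) * (1 - exp (- (of_nat (Suc n) * h))))) sums qlog h x"
      unfolding qlog_def by (rule summable_sums[OF summable_qlog[OF h x1]])
    have s2: "(\<lambda>n. x ^ Suc n / of_nat (Suc n) ^ 2 * of_nat M / \<xi>) sums (Li2 x * of_nat M / \<xi>)"
      by (rule sums_divide[OF sums_mult2[OF Li2_sums[OF x1]]])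
    have s3: "(\<lambda>n. x ^ Suc n / of_nat (Suc n) / 2) sums (- Ln (1 - x) / 2)"
      by (rule sums_divide[OF Ln_sums[OF x1]])
    have "(\<lambda>n. x ^ Suc n / (of_nat (Suc n) * (1 - exp (- (of_nat (Suc n) * h)))) -
        (x ^ Suc n / of_nat (Suc n) ^ 2 * of_nat M / \<xi> + x ^ Suc n / of_nat (Suc n) / 2))
      sums (qlog h x - (Li2 x * of_nat M / \<xi> + - Ln (1 - x) / 2))"
      by (rule sums_diff[OF s1 sums_add[OF s2 s3]])
    moreover have "x ^ Suc n / (of_nat (Suc n) * (1 - exp (- (of_nat (Suc n) * h)))) -
        (x ^ Suc n / of_nat (Suc n) ^ 2 * of_nat M / \<xi> + x ^ Suc n / of_nat (Suc n) / 2) = t n" for n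
    proof -
      have eq: "A / (b * D) - (A / b ^ 2 * m / \<xi> + A / b / 2) = A / b * (inverse D - m / (b * \<xi>) - 1 / 2)"
        for A b D m :: complex
        using \<xi>0 by (cases "b = 0"; cases "D = 0") (auto simp: field_simps power2_eq_square)
      have "inverse (of_nat (Suc n) * h) = of_nat M / (of_nat (Suc n) * \<xi>)"
        using M \<xi>0 by (simp add: h_def divide_inverse mult_ac del: of_nat_Suc)
      then show ?thesis
        unfolding t_def by (simp only: eq)
    qed
    ultimately have sums: "t sums (qlog h x - (Li2 x * of_nat M / \<xi> - Ln (1 - x) / 2))"
      by simp
    \<comment> \<open>The factor \<open>Suc n\<close> of the kernel bound cancels the denominator of
      the coefficient, so a geometric series in \<open>\<rho>\<close> remains.\<close>
    have tn: "norm (t n) \<le> C / real M * \<rho> ^ n" for n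
    proof -
      have "norm (inverse (1 - exp (- (of_nat (Suc n) * h))) - inverse (of_nat (Suc n) * h) - 1 / 2)
          \<le> C * (real (Suc n) / real M)"
        using bound[of "real (Suc n) / real M"] M by (simp add: h_def mult.commute del: of_nat_Suc)
      then have "norm (t n) \<le> norm (x ^ Suc n / of_nat (Suc n)) * (C * (real (Suc n) / real M))"
        unfolding t_def norm_mult by (intro mult_left_mono) auto
      also have "\<dots> = C / real M * norm x ^ Suc n"
        by (simp add: norm_divide norm_power del: of_nat_Suc power_Suc)
      also have "\<dots> \<le> C / real M * \<rho> ^ n"
      proof (intro mult_left_mono)
        have "norm x * norm x ^ n \<le> 1 * \<rho> ^ n"
          using x x1 by (intro mult_mono power_mono) auto
        then show "norm x ^ Suc n \<le> \<rho> ^ n" by simp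
      qed (use C in auto)
      finally show ?thesis .
    qed
    have "(\<lambda>n. C / real M * \<rho> ^ n) sums (C / real M * (1 / (1 - \<rho>)))"
      using \<rho> by (intro sums_mult geometric_sums) auto
    from norm_sums_le[OF sums this tn] show ?thesis
      by (simp add: h_def mult.commute)
  qed
  moreover have "C / (1 - \<rho>) > 0" using C \<rho> by simp
  ultimately show ?thesis by blast
qed

section \<open>Complex Gaussian integrals\<close>

lemma gaussian_real:
  fixes b :: real
  assumes b: "b > 0"
  shows "integrable lborel (\<lambda>t. exp (- (b * t ^ 2)))" "(LINT t|lborel. exp (- (b * t ^ 2))) = sqrt (pi / b)"
proof -
  \<comment> \<open>With variance 1/(2 b) the normal density is a multiple of the integrand.\<close>
  define \<sigma> where "\<sigma> = 1 / sqrt (2 * b)"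
  have \<sigma>: "\<sigma> > 0" "\<sigma> ^ 2 = 1 / (2 * b)" using b by (auto simp: \<sigma>_def power_divide)
  have eq: "exp (- (b * t ^ 2)) = sqrt (pi / b) * normal_density 0 \<sigma> t" for t
  proof -
    have "sqrt (2 * pi * \<sigma> ^ 2) = sqrt (pi / b)" by (simp add: \<sigma>(2))
    moreover have "- (t - 0)\<^sup>2 / (2 * \<sigma>\<^sup>2) = - (b * t ^ 2)" using b by (simp add: \<sigma>(2))
    moreover have "sqrt (pi / b) > 0" using b by simp
    ultimately show ?thesis unfolding normal_density_def using b by simp
  qed
  show "integrable lborel (\<lambda>t. exp (- (b * t ^ 2)))"
    unfolding eq using \<sigma>(1) by (intro integrable_mult_right) simp
  show "(LINT t|lborel. exp (- (b * t ^ 2))) = sqrt (pi / b)"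
    unfolding eq using \<sigma>(1) by simp
qed

abbreviation gauss :: "complex \<Rightarrow> real \<Rightarrow> complex" where
  "gauss z t \<equiv> exp (- (z * of_real t ^ 2))"

lemma norm_exp_gaussian:
  fixes z :: complex and t :: real
  shows "norm (gauss z t) = exp (- (Re z * t ^ 2))"
proof -
  have "z * of_real t ^ 2 = of_real (t ^ 2) * z" by (simp only: of_real_power mult.commute)
  moreover have "Re (of_real r * z) = r * Re z" for r by simp
  ultimately have "Re (- (z * of_real t ^ 2)) = - (Re z * t ^ 2)"
    by (simp only: uminus_complex.sel mult.commute)
  then show ?thesis by (simp only: norm_exp_eq_Re)
qed

lemma csqrt_of_real_pos: "x > 0 \<Longrightarrow> csqrt (of_real x) = of_real (sqrt x)"
  by (simp add: csqrt_of_real_nonneg)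

text \<open>With \<open>I\<^sub>R\<close> the integral over \<open>{-R..R}\<close>, the derivative of \<open>sqrt \<beta> I\<^sub>R(\<beta>)\<close> is the boundary term
  \<open>R exp (- \<beta> R\<^sup>2) / sqrt \<beta>\<close>, so in the limit \<open>sqrt \<beta> I(\<beta>)\<close> is constant along vertical lines.\<close>

lemma gaussian_complex:
  fixes \<beta> :: complex
  assumes \<beta>: "Re \<beta> > 0"
  shows "integrable lborel (\<lambda>t. gauss \<beta> t)"
    and "(LINT t|lborel. gauss \<beta> t) = of_real (sqrt pi) / csqrt \<beta>"
proof -
  define b where "b = Re \<beta>"
  have b: "b > 0" using \<beta> by (simp add: b_def)
  define F where "F R z = integral {- R..R} (\<lambda>t. gauss z t)" for R :: real and z :: complex
  have int: "integrable lborel (\<lambda>t. gauss z t)" if "Re z = b" for z :: complex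
  proof (rule Bochner_Integration.integrable_bound[OF gaussian_real(1)[OF b]])
    show "AE t in lborel. norm (gauss z t) \<le> norm (exp (- (b * t ^ 2)))"
      unfolding norm_exp_gaussian using that by simp
    have "continuous_on UNIV (\<lambda>t. gauss z t)" by (intro continuous_intros)
    then show "(\<lambda>t. gauss z t) \<in> borel_measurable lborel"
      using borel_measurable_continuous_onI by auto
  qed
  have lim: "(\<lambda>n. F (real n) z) \<longlonglongrightarrow> (LINT t|lborel. gauss z t)" if z: "Re z = b" for z
  proof -
    have "(\<lambda>n. LINT t|lborel. indicator {- real n..real n} t *\<^sub>R gauss z t)
      \<longlonglongrightarrow> (LINT t|lborel. gauss z t)"
    proof (rule integral_dominated_convergence[where w = "\<lambda>t. exp (- (b * t ^ 2))"])
      show "AE t in lborel. (\<lambda>n. indicator {- real n..real n} t *\<^sub>R gauss z t) \<longlonglongrightarrow> gauss z t"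
      proof (rule AE_I2)
        fix t :: real
        have "\<forall>\<^sub>F n in sequentially. indicator {- real n..real n} t *\<^sub>R gauss z t = gauss z t"
          using eventually_ge_at_top[of "nat \<lceil>\<bar>t\<bar>\<rceil>"]
        proof eventually_elim
          case (elim n)
          then have "\<bar>t\<bar> \<le> real n" by linarith
          then show ?case by (auto simp: indicator_def)
        qed
        then show "(\<lambda>n. indicator {- real n..real n} t *\<^sub>R gauss z t) \<longlonglongrightarrow> gauss z t"
          by (rule tendsto_eventually)
      qed
      show "AE t in lborel. norm (indicator {- real n..real n} t *\<^sub>R gauss z t) \<le> exp (- (b * t ^ 2))" for n
        unfolding norm_scaleR norm_exp_gaussian by (auto simp: z indicator_def)
    qed (use gaussian_real(1)[OF b] in auto)
    moreover have "(LINT t|lborel. indicator {- real n..real n} t *\<^sub>R gauss z t) = F (real n) z" for n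
    proof -
      have "set_integrable lborel {- real n..real n} (\<lambda>t. gauss z t)"
        unfolding set_integrable_def by (intro integrable_mult_indicator int z) simp
      from set_borel_integral_eq_integral(2)[OF this] show ?thesis
        by (simp add: F_def set_lebesgue_integral_def)
    qed
    ultimately show ?thesis by simp
  qed
  have der: "((\<lambda>z. csqrt z * F R z) has_field_derivative of_real R * gauss z R / csqrt z) (at z)"
    if R: "R > 0" and z: "Re z > 0" for R z
  proof -
    let ?U = "{z. Re z > 0}"
    have zn: "z \<notin> \<real>\<^sub>\<le>\<^sub>0" "z \<noteq> 0" using z by (auto simp: complex_nonpos_Reals_iff)
    define J where "J = integral {- R..R} (\<lambda>t. - (of_real t ^ 2) * gauss z t)"
    have "((\<lambda>z. integral (cbox (- R) R) (\<lambda>t. gauss z t)) has_field_derivative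
        integral (cbox (- R) R) (\<lambda>t. - (of_real t ^ 2) * gauss z t)) (at z within ?U)"
    proof (rule leibniz_rule_field_derivative[where fx = "\<lambda>z t. - (of_real t ^ 2) * gauss z t" and U = ?U])
      show "((\<lambda>z. gauss z t) has_field_derivative - (of_real t ^ 2) * gauss z t) (at z within ?U)" for z t
        by (auto intro!: derivative_eq_intros)
      show "continuous_on (?U \<times> cbox (- R) R) (\<lambda>(z, t). - (of_real t ^ 2) * gauss z t)"
        unfolding case_prod_beta by (intro continuous_intros)
      show "(\<lambda>t. gauss z t) integrable_on cbox (- R) R" for z :: complex
        by (intro integrable_continuous continuous_intros)
    qed (use z in \<open>auto simp: convex_halfspace_Re_gt\<close>)
    then have Fd: "(F R has_field_derivative J) (at z)"
      using z unfolding F_def[abs_def] J_def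
      by (subst (asm) at_within_open) (auto simp: open_halfspace_Re_gt)
    \<comment> \<open>Integrating the derivative of t exp (- z t^2) expresses J through
      \<open>F R z\<close> and the boundary values. This eliminates J from the derivative of
      \<open>csqrt z * F R z\<close>.\<close>
    have "((\<lambda>t. gauss z t + 2 * z * (- (of_real t ^ 2) * gauss z t)) has_integral
       (of_real R * gauss z R - of_real (- R) * exp (- (z * of_real (- R) ^ 2)))) {- R..R}"
    proof (rule fundamental_theorem_of_calculus)
      show "((\<lambda>t. of_real t * gauss z t) has_vector_derivative
         gauss z t + 2 * z * (- (of_real t ^ 2) * gauss z t)) (at t within {- R..R})" for t
      proof -
        have "((\<lambda>w. w * exp (- (z * w ^ 2))) has_field_derivative
            gauss z t + 2 * z * (- (of_real t ^ 2) * gauss z t)) (at (of_real t))"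
          by (auto intro!: derivative_eq_intros simp: power2_eq_square algebra_simps)
        from has_vector_derivative_real_field[OF this] show ?thesis .
      qed
    qed (use R in auto)
    then have 1: "integral {- R..R} (\<lambda>t. gauss z t + 2 * z * (- (of_real t ^ 2) * gauss z t)) =
      2 * of_real R * gauss z R"
      by (intro integral_unique) (simp add: mult.assoc)
    have "integral {- R..R} (\<lambda>t. gauss z t + 2 * z * (- (of_real t ^ 2) * gauss z t)) =
      F R z + integral {- R..R} (\<lambda>t. 2 * z * (- (of_real t ^ 2) * gauss z t))"
      unfolding F_def
      by (rule Henstock_Kurzweil_Integration.integral_add; intro integrable_continuous_real continuous_intros)
    also have "integral {- R..R} (\<lambda>t. 2 * z * (- (of_real t ^ 2) * gauss z t)) = 2 * z * J"
      unfolding J_def by (rule integral_mult_right)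
    finally have "J = (2 * of_real R * gauss z R - F R z) / (2 * z)"
      using 1 zn by (simp add: field_simps)
    moreover have "((\<lambda>z. csqrt z * F R z) has_field_derivative inverse (2 * csqrt z) * F R z + J * csqrt z) (at z)"
      by (intro DERIV_mult has_field_derivative_csqrt zn Fd)
    moreover have "inverse (2 * csqrt z) * F R z + (2 * of_real R * gauss z R - F R z) / (2 * z) * csqrt z
       = of_real R * gauss z R / csqrt z"
    proof -
      have "w \<noteq> 0 \<Longrightarrow> inverse (2 * w) * A + (2 * B - A) / (2 * w ^ 2) * w = B / w" for w A B :: complex
        by (simp add: field_simps power2_eq_square)
      from this[of "csqrt z" "F R z" "of_real R * gauss z R"] show ?thesis
        using zn by (simp add: mult.assoc)
    qed
    ultimately show ?thesis by simp
  qed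
  \<comment> \<open>Mean value bound on the vertical line through \<open>\<beta>\<close>, where the
    modulus of \<open>gauss z R\<close> is constant and |z| >= b.\<close>
  have diff: "norm (csqrt \<beta> * F R \<beta> - csqrt (of_real b) * F R (of_real b)) \<le>
      R * exp (- (b * R ^ 2)) / sqrt b * norm (\<beta> - of_real b)" if R: "R > 0" for R
  proof (rule field_differentiable_bound[where S = "{z. Re z = b}" and f' = "\<lambda>z. of_real R * gauss z R / csqrt z"])
    have "{z. Re z = b} = {z. Re z \<le> b} \<inter> {z. Re z \<ge> b}" by auto
    then show "convex {z. Re z = b}"
      by (auto intro!: convex_Int convex_halfspace_Re_le convex_halfspace_Re_ge)
    show "((\<lambda>z. csqrt z * F R z) has_field_derivative of_real R * gauss z R / csqrt z) (at z within {z. Re z = b})"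
      if "z \<in> {z. Re z = b}" for z
    proof -
      have "Re z > 0" using that b by simp
      from der[OF R this] show ?thesis by (rule has_field_derivative_at_within)
    qed
    show "norm (of_real R * gauss z R / csqrt z) \<le> R * exp (- (b * R ^ 2)) / sqrt b"
      if "z \<in> {z. Re z = b}" for z
    proof -
      have "norm (csqrt z) = sqrt (norm z)" by (rule norm_csqrt)
      moreover have "sqrt b \<le> sqrt (norm z)" using that complex_Re_le_cmod[of z] by simp
      moreover have "norm (of_real R * gauss z R) = R * exp (- (b * R ^ 2))"
        unfolding norm_mult norm_exp_gaussian using that R by simp
      ultimately show ?thesis
        unfolding norm_divide using b R by (intro frac_le) auto
    qed
  qed (auto simp: b_def)
  have z1: "(\<lambda>n. csqrt \<beta> * F (real n) \<beta> - csqrt (of_real b) * F (real n) (of_real b)) \<longlonglongrightarrow> 0"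
  proof (rule tendsto_norm_zero_cancel, rule tendsto_sandwich[OF _ _ tendsto_const])
    show "\<forall>\<^sub>F n in sequentially. norm (csqrt \<beta> * F (real n) \<beta> - csqrt (of_real b) * F (real n) (of_real b)) \<le>
        real n * exp (- (b * real n ^ 2)) / sqrt b * norm (\<beta> - of_real b)"
      using eventually_gt_at_top[of 0] by eventually_elim (rule diff, simp)
    have "(\<lambda>n. real n * exp (- (b * real n ^ 2))) \<longlonglongrightarrow> 0"
      using b by real_asymp
    then show "(\<lambda>n. real n * exp (- (b * real n ^ 2)) / sqrt b * norm (\<beta> - of_real b)) \<longlonglongrightarrow> 0"
      by (rule tendsto_mult_left_zero[OF tendsto_divide_zero])
  qed auto
  define I where "I z = (LINT t|lborel. gauss z t)" for z :: complex
  have "(\<lambda>n. csqrt \<beta> * F (real n) \<beta> - csqrt (of_real b) * F (real n) (of_real b)) \<longlonglongrightarrow>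
     csqrt \<beta> * I \<beta> - csqrt (of_real b) * I (of_real b)"
  proof (rule tendsto_diff)
    have e: "Re \<beta> = b" "Re (of_real b) = b" by (simp_all add: b_def)
    show "(\<lambda>n. csqrt \<beta> * F (real n) \<beta>) \<longlonglongrightarrow> csqrt \<beta> * I \<beta>"
      unfolding I_def by (rule tendsto_mult_left[OF lim[OF e(1)]])
    show "(\<lambda>n. csqrt (of_real b) * F (real n) (of_real b)) \<longlonglongrightarrow> csqrt (of_real b) * I (of_real b)"
      unfolding I_def by (rule tendsto_mult_left[OF lim[OF e(2)]])
  qed
  from LIMSEQ_unique[OF this z1] have eq: "csqrt \<beta> * I \<beta> = csqrt (of_real b) * I (of_real b)" by simp
  have "I (of_real b) = (LINT t|lborel. of_real (exp (- (b * t ^ 2))))"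
    unfolding I_def by (simp add: exp_of_real[symmetric])
  also have "\<dots> = of_real (sqrt (pi / b))"
    using gaussian_real(2)[OF b] by (simp only: integral_complex_of_real)
  finally have "csqrt (of_real b) * I (of_real b) = of_real (sqrt b * sqrt (pi / b))"
    using csqrt_of_real_pos[OF b] by simp
  also have "sqrt b * sqrt (pi / b) = sqrt pi" using b by (simp add: real_sqrt_divide)
  finally have "csqrt \<beta> * I \<beta> = of_real (sqrt pi)" using eq by simp
  moreover have "csqrt \<beta> \<noteq> 0" using \<beta> by auto
  ultimately show "(LINT t|lborel. gauss \<beta> t) = of_real (sqrt pi) / csqrt \<beta>"
    unfolding I_def by (simp add: field_simps)
  show "integrable lborel (\<lambda>t. gauss \<beta> t)" by (rule int) (simp add: b_def)
qed

section \<open>Interpolating the summands\<close>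

locale fig8 =
  fixes u :: real
  assumes u_pos: "0 < u" and u_less: "u < ln ((3 + sqrt 5) / 2)"
begin

text \<open>(3 + sqrt 5)/2 and (3 - sqrt 5)/2 are mutually inverse with sum 3. The bound keeps cosh
  u - 1/2 below 1, so that its arccos is positive.\<close>

lemma cosh_u_less: "cosh u < 3 / 2"
proof -
  have g: "(3 + sqrt 5) / 2 > 0"
    by (smt (verit) real_sqrt_ge_0_iff divide_pos_pos)
  have "cosh u < cosh (ln ((3 + sqrt 5) / 2))"
    using u_pos u_less by (subst cosh_real_nonneg_less_iff) auto
  also have "\<dots> = ((3 + sqrt 5) / 2 + inverse ((3 + sqrt 5) / 2)) / 2"
    using g by (rule cosh_ln_real)
  also have "inverse ((3 + sqrt 5) / 2) = (3 - sqrt 5) / 2"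
    using g by (simp add: field_simps)
  also have "((3 + sqrt 5) / 2 + (3 - sqrt 5) / 2) / 2 = 3 / 2"
    by (simp add: field_simps)
  finally show ?thesis .
qed

text \<open>A round bound for the contour estimates; the supremum of u is about 0.96. If u >= 1,
  then e^u >= (13/8)^2, which exceeds the larger root of t + 1/t = 3.\<close>

lemma u_less_1: "u < 1"
proof (rule ccontr)
  assume "\<not> u < 1"
  then have u1: "1 \<le> u" by simp
  have "(13 / 8 :: real) \<le> exp (1 / 2)"
    using exp_lower_Taylor_quadratic[of "1 / 2 :: real"] by (simp add: power2_eq_square)
  then have "(13 / 8 :: real) ^ 2 \<le> exp (1 / 2) ^ 2" by (intro power_mono) auto
  also have "exp (1 / 2 :: real) ^ 2 = exp 1" by (simp flip: exp_double)
  finally have e: "exp (1 :: real) \<ge> 169 / 64" by (simp add: power2_eq_square)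
  also have "exp 1 \<le> exp u" using u1 by simp
  finally have e: "exp u \<ge> 169 / 64" .
  define c :: real where "c = 169 / 64"
  have "0 \<le> (exp u - c) * (exp u + c - 3)"
    using e by (intro mult_nonneg_nonneg) (auto simp: c_def)
  then have "exp u * (exp u - 3) \<ge> c * (c - 3)"
    by (simp add: algebra_simps)
  moreover have "c * (c - 3) \<ge> - 1" by (simp add: c_def)
  ultimately have "exp u * (exp u - 3) \<ge> - 1" by linarith
  then have "exp u + inverse (exp u) \<ge> 3"
    by (simp add: field_simps)
  then show False using cosh_u_less by (simp add: cosh_def exp_minus)
qed

lemma cosh_u_gt: "cosh u > 1"
  using u_pos by (metis cosh_real_ge_1 cosh_real_one_iff less_irrefl order_le_less)

definition \<xi> :: complex where "\<xi> = 2 * of_real pi * \<i> + of_real u"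

lemma Re_xi [simp]: "Re \<xi> = u" and Im_xi [simp]: "Im \<xi> = 2 * pi"
  by (simp_all add: \<xi>_def)

lemma xi_nonzero [simp]: "\<xi> \<noteq> 0"
  using u_pos by (auto simp: complex_eq_iff)

text \<open>This is |\<open>\<xi>\<close>|^2, the denominator of real and imaginary parts of
  quotients by \<open>\<xi>\<close>.\<close>

definition nx :: real where "nx = u ^ 2 + (2 * pi) ^ 2"

lemma nx_pos [simp]: "nx > 0"
  using u_pos by (auto simp: nx_def intro: add_pos_pos)

lemma Re_divide_xi: "Re (z / \<xi>) = (u * Re z + 2 * pi * Im z) / nx"
  by (simp add: Re_divide nx_def mult.commute)

lemma Im_divide_xi: "Im (z / \<xi>) = (u * Im z - 2 * pi * Re z) / nx"
  by (simp add: Im_divide nx_def mult.commute)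

definition h :: "nat \<Rightarrow> complex" where "h M = \<xi> / of_nat M"

lemma Re_h: "Re (h M) = u / real M" and Im_h: "Im (h M) = 2 * pi / real M"
  by (simp_all add: h_def)

lemma Re_h_pos: "M > 0 \<Longrightarrow> Re (h M) > 0"
  using u_pos by (simp add: Re_h)

lemma of_nat_h: "M > 0 \<Longrightarrow> of_nat M * h M = \<xi>"
  by (simp add: h_def)

section \<open>The factor f and its potential V\<close>

definition f :: "complex \<Rightarrow> complex" where
  "f z = exp (of_real u) * (1 - exp (z - of_real u)) * (1 - exp (- z - of_real u))"

lemma f_eq: "f z = 2 * of_real (cosh u) - 2 * cosh z"
proof -
  have e: "exp (of_real u) * exp (z - of_real u) = exp z"
    "exp (of_real u) * exp (- z - of_real u) = exp (- z)"
    "exp (of_real u) * (exp (z - of_real u) * exp (- z - of_real u)) = exp (- of_real u)"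
    by (simp_all flip: exp_add)
  have "2 * of_real (cosh u) = exp (of_real u :: complex) + exp (- of_real u)"
    using exp_of_real[of "- u", where 'a = complex] exp_of_real[of u, where 'a = complex]
    by (simp add: cosh_def)
  moreover have "2 * cosh z = exp z + exp (- z)"
    by (simp add: cosh_def scaleR_conv_of_real)
  moreover have "f z = exp (of_real u) - exp (of_real u) * exp (z - of_real u)
     - exp (of_real u) * exp (- z - of_real u) + exp (of_real u) * (exp (z - of_real u) * exp (- z - of_real u))"
    by (simp add: f_def algebra_simps)
  ultimately show ?thesis unfolding e by simp
qed

lemma norm_f_le: "norm (f z) \<le> 2 * cosh u + 2 * cosh (Re z)"
proof -
  have "norm (cosh z) \<le> cosh (Re z)"
  proof -
    have "norm (exp z + exp (- z)) \<le> norm (exp z) + norm (exp (- z))" by (rule norm_triangle_ineq)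
    moreover have "norm (cosh z) = norm (exp z + exp (- z)) / 2"
      by (simp add: cosh_def scaleR_conv_of_real norm_mult flip: distrib_left)
    ultimately show ?thesis by (simp add: cosh_def)
  qed
  moreover have "norm (f z) \<le> norm (2 * of_real (cosh u) :: complex) + norm (2 * cosh z)"
    unfolding f_eq by (rule norm_triangle_ineq4)
  ultimately show ?thesis by (simp add: norm_mult)
qed

text \<open>Here both dilogarithms of \<open>V\<close> are on the principal branch. The cuts are
  horizontal rays, going right from u + 2 pi i k and left from -u + 2 pi i k. The strip |Re z| < u
  and the band 0 < Im z < 2 pi avoid them.\<close>

definition dom :: "complex set" where
  "dom = {z. exp (z - of_real u) \<in> cut_plane \<and> exp (- z - of_real u) \<in> cut_plane}"

lemma open_dom: "open dom"
proof -
  have "dom = (\<lambda>z. exp (z - of_real u)) -` cut_plane \<inter> (\<lambda>z. exp (- z - of_real u)) -` cut_plane"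
    by (auto simp: dom_def)
  then show ?thesis
    by (auto intro!: continuous_open_vimage open_cut_plane continuous_intros)
qed

lemma exp_cut_plane: "Re w < 0 \<Longrightarrow> exp w \<in> cut_plane"
  by (intro norm_less_1_cut_plane) simp

text \<open>In this range exp w is real only for Im w = +-pi, and then it is negative.\<close>

lemma exp_cut_plane': 
  assumes "0 < \<bar>Im w\<bar>" "\<bar>Im w\<bar> < 2 * pi"
  shows "exp w \<in> cut_plane"
proof -
  have "Re (exp w) < 1" if "Im (exp w) = 0"
  proof -
    have "sin (Im w) = 0" using that by (simp add: Im_exp)
    moreover have "cos (Im w) \<noteq> 1"
    proof
      assume "cos (Im w) = 1"
      then obtain k :: int where k: "Im w = of_int k * 2 * pi"
        by (auto simp: cos_one_2pi_int)
      have "\<bar>real_of_int k\<bar> * (2 * pi) < 1 * (2 * pi)" "0 < \<bar>real_of_int k\<bar> * (2 * pi)"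
        using assms unfolding k by (simp_all add: abs_mult)
      then show False by (simp add: mult_less_cancel_right zero_less_mult_iff)
    qed
    ultimately have "cos (Im w) = - 1"
      using sin_zero_abs_cos_one[of "Im w"] by (simp add: abs_if split: if_splits)
    then show ?thesis by (simp add: Re_exp) (smt (verit) exp_gt_zero)
  qed
  then show ?thesis by (simp add: cut_plane_def)
qed

lemma dom_strip: "\<bar>Re z\<bar> < u \<Longrightarrow> z \<in> dom"
  by (auto simp: dom_def intro!: exp_cut_plane)

lemma dom_upper: "0 < Im z \<Longrightarrow> Im z < 2 * pi \<Longrightarrow> z \<in> dom"
  by (auto simp: dom_def intro!: exp_cut_plane')

text \<open>This is h times what remains of log g when \<open>qlog h\<close> is replaced by
  \<open>Li2\<close> / h. The linear term matches the factor e^u of \<open>f\<close>.\<close>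

definition V :: "complex \<Rightarrow> complex" where
  "V z = of_real u * z + Li2 (exp (- z - of_real u)) - Li2 (exp (z - of_real u))"

definition V' :: "complex \<Rightarrow> complex" where
  "V' z = of_real u + Ln (1 - exp (z - of_real u)) + Ln (1 - exp (- z - of_real u))"

lemma has_field_derivative_V:
  assumes "z \<in> dom"
  shows "(V has_field_derivative V' z) (at z)"
proof -
  have "((\<lambda>z. - z - of_real u) has_field_derivative - 1) (at z)"
    by (auto intro!: derivative_eq_intros)
  from DERIV_chain2[OF has_field_derivative_Li2_exp this]
  have 1: "((\<lambda>z. Li2 (exp (- z - of_real u))) has_field_derivative
      - Ln (1 - exp (- z - of_real u)) * - 1) (at z)"
    using assms by (simp add: dom_def)
  have "((\<lambda>z. z - of_real u) has_field_derivative 1) (at z)"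
    by (auto intro!: derivative_eq_intros)
  from DERIV_chain2[OF has_field_derivative_Li2_exp this]
  have 2: "((\<lambda>z. Li2 (exp (z - of_real u))) has_field_derivative
      - Ln (1 - exp (z - of_real u)) * 1) (at z)"
    using assms by (simp add: dom_def)
  show ?thesis
    unfolding V_def V'_def
    by (rule derivative_eq_intros 1 2 refl)+ simp
qed

lemma one_minus_exp_nonzero:
  assumes "z \<in> dom"
  shows "1 - exp (z - of_real u) \<noteq> 0" "1 - exp (- z - of_real u) \<noteq> 0"
  using assms by (auto simp: dom_def cut_plane_def)

lemma exp_V': "z \<in> dom \<Longrightarrow> exp (V' z) = f z"
  using one_minus_exp_nonzero[of z] by (simp add: V'_def f_def exp_add)

lemma f_nonzero: "z \<in> dom \<Longrightarrow> f z \<noteq> 0"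
  using exp_V' exp_not_eq_zero by metis

lemma Re_V': "z \<in> dom \<Longrightarrow> Re (V' z) = ln (norm (f z))"
  by (simp flip: exp_V')

lemma holomorphic_V': "V' holomorphic_on dom"
  unfolding V'_def
  by (auto intro!: holomorphic_intros simp: dom_def one_minus_cut_plane)

lemma continuous_on_V: "continuous_on dom V"
  by (rule DERIV_continuous_on[OF has_field_derivative_at_within[OF has_field_derivative_V]])

text \<open>With p = e^-h and infinite products this is e^(u z/h) (e^(z-u); p) / ((1 - e^-u) (p
  e^(-z-u); p)). The factor 1 - e^(-z-u) moves the lower product from e^(-z-u) to p e^(-z-u), so
  that a shift by h yields f at the new point. The constant 1 - e^-u makes g equal to 1 at 0. As Re
  h = u/M, splitting off 2 M factors extends holomorphy to Re z < 3 u.\<close>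

definition g :: "nat \<Rightarrow> complex \<Rightarrow> complex" where
  "g M z = exp (of_real u * z * of_nat M / \<xi>) * ((1 - exp (- z - of_real u)) / (1 - exp (- of_real u)))
     * qpoch (h M) (2 * M) (exp (z - of_real u)) * exp (qlog (h M) (exp (- z - of_real u)))"

lemma one_minus_exp_u: "1 - exp (- of_real u :: complex) \<noteq> 0"
  using u_pos by (simp add: exp_minus exp_of_real flip: of_real_inverse)

lemma g_shift:
  assumes M: "M > 0" and z: "- u < Re z" "Re z + u / real M < 3 * u"
  shows "g M (z + h M) = f (z + h M) * g M z"
proof -
  have n1: "norm (exp (- z - of_real u)) < 1"
    using z by simp
  have Mh: "h M * of_nat M / \<xi> = 1"
    using M by (simp add: h_def)
  have "of_real u * (z + h M) * of_nat M / \<xi> = of_real u * z * of_nat M / \<xi> + of_real u * (h M * of_nat M / \<xi>)"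
    by (simp add: add_divide_distrib algebra_simps)
  then have e1: "exp (of_real u * (z + h M) * of_nat M / \<xi>) = exp (of_real u * z * of_nat M / \<xi>) * exp (of_real u)"
    unfolding Mh by (simp add: exp_add)
  have x: "exp (z + h M - of_real u) = exp (z - of_real u) * exp (h M)"
    by (simp flip: exp_add add: algebra_simps)
  have "norm (exp (z - of_real u) * exp (h M) * exp (- (of_nat (2 * M) * h M))) = exp (Re z - u + u / real M - 2 * u)"
    using M of_nat_h[OF M] by (simp add: norm_mult Re_h flip: exp_add)
  then have e2: "qpoch (h M) (2 * M) (exp (z + h M - of_real u)) =
      (1 - exp (z + h M - of_real u)) * qpoch (h M) (2 * M) (exp (z - of_real u))"
    unfolding x using z by (intro qpoch_shift Re_h_pos M) simp
  have y: "exp (- (z + h M) - of_real u) = exp (- z - of_real u) * exp (- h M)"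
    by (simp flip: exp_add add: algebra_simps)
  have "exp (- z - of_real u) \<noteq> 1" using n1 by (metis norm_one less_irrefl)
  then have e3: "exp (qlog (h M) (exp (- (z + h M) - of_real u))) =
      (1 - exp (- z - of_real u)) * exp (qlog (h M) (exp (- z - of_real u)))"
    unfolding y qlog_shift[OF Re_h_pos[OF M] n1] by (simp add: exp_add)
  show ?thesis
    unfolding g_def e1 e2 e3 by (simp add: f_def)
qed

lemma g_0:
  assumes "M > 0"
  shows "g M 0 = 1"
proof -
  have "norm (exp (- of_real u :: complex)) < 1" using u_pos by simp
  from qpoch_eq_exp_qlog[OF Re_h_pos[OF assms] this, of "2 * M"] show ?thesis
    using one_minus_exp_u by (simp add: g_def flip: exp_add)
qed

lemma g_grid_shift:
  assumes M: "M > 0" and b: "- u < Re b" "Re b + real k * u / real M < 3 * u"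
  shows "g M (b + of_nat k * h M) = (\<Prod>l=1..k. f (b + of_nat l * h M)) * g M b"
  using b
proof (induction k)
  case (Suc k)
  have k0: "0 \<le> real k * u / real M" using u_pos by simp
  have eq: "real (Suc k) * u / real M = real k * u / real M + u / real M"
    by (simp add: algebra_simps add_divide_distrib)
  have "u / real M \<ge> 0" using u_pos by simp
  then have IH: "g M (b + of_nat k * h M) = (\<Prod>l=1..k. f (b + of_nat l * h M)) * g M b"
    using Suc eq by (intro Suc.IH) auto
  have "g M (b + of_nat k * h M + h M) = f (b + of_nat k * h M + h M) * g M (b + of_nat k * h M)"
    using Suc.prems k0 unfolding eq by (intro g_shift M) (simp_all add: Re_h)
  then show ?case
    unfolding IH by (simp add: algebra_simps)
qed simp

lemma g_grid:
  assumes M: "M > 0" and k: "k \<le> M"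
  shows "g M (of_nat k * h M) = (\<Prod>l=1..k. f (of_nat l * h M))"
proof -
  have "real k * u / real M \<le> u"
    using k M u_pos by (simp add: field_simps)
  then have "real k * u / real M < 3 * u" using u_pos by linarith
  from g_grid_shift[OF M, of 0 k] this show ?thesis
    using u_pos g_0[OF M] by simp
qed

lemma holomorphic_g:
  assumes M: "M > 0"
  shows "g M holomorphic_on {z. - u < Re z \<and> Re z < 3 * u}"
proof -
  let ?S = "{z. - u < Re z \<and> Re z < 3 * u}"
  have "(\<lambda>z. exp (z - of_real u)) ` ?S \<subseteq> ball 0 (exp (real (2 * M) * Re (h M)))"
    using M by (auto simp: Re_h)
  then have "qpoch (h M) (2 * M) \<circ> (\<lambda>z. exp (z - of_real u)) holomorphic_on ?S"
    by (intro holomorphic_on_compose_gen[OF _ holomorphic_qpoch[OF Re_h_pos[OF M]]])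
       (auto intro!: holomorphic_intros)
  moreover have "(\<lambda>z. exp (- z - of_real u)) ` ?S \<subseteq> ball 0 1"
    by auto
  then have "qlog (h M) \<circ> (\<lambda>z. exp (- z - of_real u)) holomorphic_on ?S"
    by (intro holomorphic_on_compose_gen[OF _ holomorphic_qlog[OF Re_h_pos[OF M]]])
       (auto intro!: holomorphic_intros)
  ultimately show ?thesis
    unfolding g_def o_def using one_minus_exp_u by (intro holomorphic_intros) auto
qed

text \<open>Collects the half logarithms from the expansions of both \<open>qlog\<close> terms. The
  factor 1 - e^(-z-u) in \<open>g\<close> turns the coefficient -1/2 of its logarithm into
  +1/2.\<close>

definition amp :: "complex \<Rightarrow> complex" where
  "amp z = exp ((Ln (1 - exp (z - of_real u)) + Ln (1 - exp (- z - of_real u))) / 2) / (1 - exp (- of_real u))"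

text \<open>For |Re z| <= \<open>\<sigma>\<close> < u both arguments of \<open>qlog\<close> stay in
  a disc of radius less than 1, so the expansion is uniform. The error is multiplicative and hence
  meaningful even where g is exponentially small.\<close>

lemma g_asymptotics:
  assumes \<sigma>: "0 \<le> \<sigma>" "\<sigma> < u"
  shows "\<exists>C>0. \<forall>M>0. \<forall>z. \<bar>Re z\<bar> \<le> \<sigma> \<longrightarrow>
    (\<exists>e. norm e \<le> C / real M \<and> g M z = exp (V z * of_nat M / \<xi>) * amp z * exp e)"
proof -
  have \<rho>: "0 \<le> exp (\<sigma> - u)" "exp (\<sigma> - u) < 1" using \<sigma> by auto
  obtain C where C: "C > 0" and bound: "\<And>M x. M > 0 \<Longrightarrow> norm x \<le> exp (\<sigma> - u) \<Longrightarrow>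
    norm (qlog (\<xi> / of_nat M) x - (Li2 x * of_nat M / \<xi> - Ln (1 - x) / 2)) \<le> C / real M"
    using qlog_asymptotics[of \<xi>, OF _ \<rho>] u_pos by auto
  have "\<exists>e. norm e \<le> (2 * C) / real M \<and> g M z = exp (V z * of_nat M / \<xi>) * amp z * exp e"
    if M: "M > 0" and z: "\<bar>Re z\<bar> \<le> \<sigma>" for M z
  proof -
    define x y where "x = exp (z - of_real u)" and "y = exp (- z - of_real u)"
    define r where "r x = qlog (h M) x - (Li2 x * of_nat M / \<xi> - Ln (1 - x) / 2)" for x
    have zd: "z \<in> dom" using z \<sigma> by (intro dom_strip) auto
    have x1: "norm x \<le> exp (\<sigma> - u)" and y1: "norm y \<le> exp (\<sigma> - u)"
      using z by (auto simp: x_def y_def)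
    have "norm (r y - r x) \<le> norm (r y) + norm (r x)" by (rule norm_triangle_ineq4)
    also have "\<dots> \<le> C / real M + C / real M"
      using bound[OF M x1] bound[OF M y1] by (auto simp: r_def h_def)
    finally have e: "norm (r y - r x) \<le> (2 * C) / real M" by simp
    have qx: "qpoch (h M) (2 * M) x = exp (- qlog (h M) x)"
      using x1 \<rho>(2) by (intro qpoch_eq_exp_qlog Re_h_pos M) linarith
    have y0: "1 - y = exp (Ln (1 - y))"
      using one_minus_exp_nonzero[OF zd] by (simp add: y_def)
    have "g M z = exp (of_real u * z * of_nat M / \<xi>) * (exp (Ln (1 - y)) / (1 - exp (- of_real u)))
      * exp (- qlog (h M) x) * exp (qlog (h M) y)"
      unfolding g_def x_def[symmetric] y_def[symmetric] qx using y0 by simp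
    also have "\<dots> = exp (of_real u * z * of_nat M / \<xi> + Ln (1 - y) - qlog (h M) x + qlog (h M) y) / (1 - exp (- of_real u))"
      by (simp add: exp_add exp_diff exp_minus divide_inverse mult_ac)
    also have "of_real u * z * of_nat M / \<xi> + Ln (1 - y) - qlog (h M) x + qlog (h M) y =
       V z * of_nat M / \<xi> + (Ln (1 - x) + Ln (1 - y)) / 2 + (r y - r x)"
      unfolding V_def x_def[symmetric] y_def[symmetric] r_def
      by (simp add: add_divide_distrib diff_divide_distrib ring_distribs)
    finally have "g M z = exp (V z * of_nat M / \<xi>) * amp z * exp (r y - r x)"
      unfolding amp_def x_def[symmetric] y_def[symmetric] by (simp add: exp_add)
    then show ?thesis using e by blast
  qed
  then show ?thesis using C by (intro exI[of _ "2 * C"]) auto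
qed

section \<open>The potential function\<close>

definition \<theta> :: real where "\<theta> = arccos (cosh u - 1 / 2)"

lemma cos_theta: "cos \<theta> = cosh u - 1 / 2"
  unfolding \<theta>_def using cosh_u_less cosh_u_gt by (intro cos_arccos) auto

lemma theta_bounds: "0 < \<theta>" "\<theta> < pi / 2"
proof -
  have *: "0 \<le> \<theta>" "\<theta> \<le> pi"
    unfolding \<theta>_def using cosh_u_less cosh_u_gt by (auto intro!: arccos_lbound arccos_ubound)
  have "\<theta> \<noteq> 0" using cos_theta cosh_u_less by auto
  then show "0 < \<theta>" using * by simp
  show "\<theta> < pi / 2"
  proof (rule ccontr)
    assume "\<not> \<theta> < pi / 2"
    then have "cos \<theta> \<le> cos (pi / 2)" using * by (intro cos_monotone_0_pi_le) auto
    then show False using cos_theta cosh_u_gt by simp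
  qed
qed

lemma sin_theta_pos: "sin \<theta> > 0"
  using theta_bounds by (intro sin_gt_zero) auto

text \<open>On [0, 2 pi] the equation f(i y) = 1 has the solutions \<open>\<theta>\<close> and 2 pi
  - \<open>\<theta>\<close>. The second is the maximum of \<open>Lam\<close>; the first is a local
  minimum.\<close>

definition ys :: real where "ys = 2 * pi - \<theta>"

lemma ys_bounds: "\<theta> < ys" "0 < ys" "ys < 2 * pi"
  using theta_bounds pi_gt_zero unfolding ys_def by linarith+

definition ell :: "real \<Rightarrow> real" where "ell y = ln (2 * cosh u - 2 * cos y)"

lemma ell_arg_pos: "2 * cosh u - 2 * cos y > 0"
  using cosh_u_gt cos_le_one[of y] by linarith

text \<open>On the imaginary axis the two logarithms are complex conjugates, so their sum is
  real.\<close>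

lemma V'_imag: "V' (\<i> * of_real y) = of_real (ell y)"
proof -
  have d: "\<i> * of_real y \<in> dom" using u_pos by (intro dom_strip) simp
  have e: "exp (- (\<i> * of_real y) - of_real u) = cnj (exp (\<i> * of_real y - of_real u))"
    by (simp add: exp_cnj)
  have "exp (\<i> * of_real y - of_real u) \<in> cut_plane" using d by (simp add: dom_def)
  then have "1 - exp (\<i> * of_real y - of_real u) \<notin> \<real>\<^sub>\<le>\<^sub>0" by (simp add: one_minus_cut_plane)
  then have "Ln (1 - cnj (exp (\<i> * of_real y - of_real u))) = cnj (Ln (1 - exp (\<i> * of_real y - of_real u)))"
    by (subst cnj_Ln) auto
  then have im: "Im (V' (\<i> * of_real y)) = 0"
    unfolding V'_def e by simp
  have fy: "f (\<i> * of_real y) = of_real (2 * cosh u - 2 * cos y)"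
    by (simp add: f_eq cosh_conv_cos cos_of_real mult.assoc[symmetric])
  have "norm (f (\<i> * of_real y)) = 2 * cosh u - 2 * cos y"
    unfolding fy norm_of_real using ell_arg_pos[of y] by linarith
  then have "Re (V' (\<i> * of_real y)) = ell y"
    by (simp add: Re_V'[OF d] ell_def)
  then show ?thesis using im by (simp add: complex_eq_iff)
qed

lemma V_0: "V 0 = 0"
  by (simp add: V_def)

definition Lam :: "real \<Rightarrow> real" where "Lam y = Im (V (\<i> * of_real y))"

lemma has_vector_derivative_V_imag:
  "((\<lambda>y. V (\<i> * of_real y)) has_vector_derivative (\<i> * of_real (ell y))) (at y)"
proof -
  have d: "\<i> * of_real y \<in> dom" using u_pos by (intro dom_strip) simp
  have "((\<lambda>y. \<i> * of_real y) has_vector_derivative \<i>) (at y)"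
    by (auto intro!: derivative_eq_intros)
  from field_vector_diff_chain_at[OF this, of V "of_real (ell y)"] has_field_derivative_V[OF d]
  show ?thesis by (simp add: V'_imag o_def)
qed

lemma DERIV_Lam: "(Lam has_real_derivative ell y) (at y)"
  using has_vector_derivative_V_imag[of y, THEN has_derivative_Im[OF has_vector_derivative_def[THEN iffD1]]]
  unfolding Lam_def by (simp add: has_field_derivative_def mult.commute[of _ "ell y"])

lemma V_imag: "V (\<i> * of_real y) = \<i> * of_real (Lam y)"
proof -
  have "((\<lambda>y. Re (V (\<i> * of_real y))) has_real_derivative 0) (at y)" for y
    using has_vector_derivative_V_imag[of y, THEN has_derivative_Re[OF has_vector_derivative_def[THEN iffD1]]]
    by (simp add: has_field_derivative_def lambda_zero)
  then have "Re (V (\<i> * of_real y)) = Re (V (\<i> * of_real 0))"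
    by (intro DERIV_isconst_all) auto
  then show ?thesis by (simp add: complex_eq_iff V_0 Lam_def)
qed

text \<open>Both exponentials are periodic; only the linear term changes.\<close>

lemma V_periodic: "V (z + 2 * of_real pi * \<i>) = V z + 2 * of_real pi * \<i> * of_real u"
proof -
  have "exp (z + 2 * of_real pi * \<i> - of_real u) = exp (z - of_real u)"
    "exp (- (z + 2 * of_real pi * \<i>) - of_real u) = exp (- z - of_real u)"
    by (simp_all add: exp_add exp_diff exp_minus)
  then show ?thesis by (simp add: V_def algebra_simps)
qed

lemma Lam_0: "Lam 0 = 0" by (simp add: Lam_def V_0)

lemma Lam_2pi: "Lam (2 * pi) = 2 * pi * u"
  using V_periodic[of 0] by (simp add: Lam_def V_0 mult_ac)

lemma continuous_on_Lam: "continuous_on A Lam"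
  by (rule DERIV_continuous_on[OF has_field_derivative_at_within[OF DERIV_Lam]])

lemma cos_ys: "cos ys = cos \<theta>" and sin_ys: "sin ys = - sin \<theta>"
  by (simp_all add: ys_def cos_diff sin_diff)

lemma ell_neg_iff: "ell y < 0 \<longleftrightarrow> cos y > cos \<theta>" and ell_pos_iff: "ell y > 0 \<longleftrightarrow> cos y < cos \<theta>"
  using ell_arg_pos[of y] by (auto simp: ell_def cos_theta)

lemma cos_gt_theta: "\<bar>y\<bar> < \<theta> \<Longrightarrow> cos y > cos \<theta>"
  using cos_monotone_0_pi[of "\<bar>y\<bar>" \<theta>] theta_bounds by simp

lemma ell_neg_left: "0 \<le> y \<Longrightarrow> y < \<theta> \<Longrightarrow> ell y < 0"
  unfolding ell_neg_iff by (intro cos_gt_theta) auto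

lemma ell_neg_right:
  assumes "ys < y" "y \<le> 2 * pi" shows "ell y < 0"
proof -
  have "cos (2 * pi - y) > cos \<theta>" using assms by (intro cos_gt_theta) (auto simp: ys_def)
  then show ?thesis by (simp add: ell_neg_iff cos_diff)
qed

lemma ell_pos_mid:
  assumes "\<theta> < y" "y < ys" shows "ell y > 0"
proof (cases "y \<le> pi")
  case True
  then show ?thesis unfolding ell_pos_iff
    using assms theta_bounds by (intro cos_monotone_0_pi) auto
next
  case False
  have "cos (2 * pi - y) < cos \<theta>" 
    using assms theta_bounds False by (intro cos_monotone_0_pi) (auto simp: ys_def)
  then show ?thesis by (simp add: ell_pos_iff cos_diff)
qed

text \<open>\<open>Lam\<close> falls up to \<open>\<theta>\<close>, rises up to \<open>ys\<close>
  and falls again up to 2 pi. So \<open>ys\<close> competes only with the endpoint 0, where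
  \<open>Lam\<close> is 0, less than its value 2 pi u at 2 pi.\<close>

lemma Lam_strict_max:
  assumes "0 \<le> y" "y \<le> 2 * pi" "y \<noteq> ys"
  shows "Lam y < Lam ys"
proof -
  have right: "Lam y < Lam ys" if "ys < y" "y \<le> 2 * pi" for y
    by (rule DERIV_neg_imp_decreasing_open[OF that(1)])
       (use that in \<open>auto intro!: exI[of _ "ell _"] DERIV_Lam ell_neg_right continuous_on_Lam\<close>)
  consider "y < \<theta>" | "\<theta> \<le> y" "y < ys" | "ys < y" using assms by linarith
  then show ?thesis
  proof cases
    case 1
    have "Lam y \<le> Lam 0"
    proof (rule DERIV_nonpos_imp_nonincreasing[OF assms(1)])
      fix x assume "0 \<le> x" "x \<le> y"
      then show "\<exists>l. (Lam has_real_derivative l) (at x) \<and> l \<le> 0"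
        using 1 DERIV_Lam[of x] ell_neg_left[of x] by (intro exI[of _ "ell x"]) auto
    qed
    also have "\<dots> < Lam (2 * pi)" using u_pos by (simp add: Lam_0 Lam_2pi)
    also have "\<dots> < Lam ys" using ys_bounds by (intro right) auto
    finally show ?thesis .
  next
    case 2
    show ?thesis
    proof (rule DERIV_pos_imp_increasing_open[OF 2(2)])
      fix x assume "y < x" "x < ys"
      then show "\<exists>l. (Lam has_real_derivative l) (at x) \<and> l > 0"
        using 2 by (intro exI[of _ "ell x"] conjI DERIV_Lam ell_pos_mid) auto
    qed (rule continuous_on_Lam)
  next
    case 3
    then show ?thesis using right assms by auto
  qed
qed

lemma Lam_max: "0 \<le> y \<Longrightarrow> y \<le> 2 * pi \<Longrightarrow> Lam y \<le> Lam ys"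
  using Lam_strict_max[of y] by (cases "y = ys") auto

lemma Lam_ys_gt: "2 * pi * u < Lam ys"
  using Lam_strict_max[of "2 * pi"] ys_bounds by (simp add: Lam_2pi)

lemma ell_ys: "ell ys = 0"
  by (simp add: ell_def cos_ys cos_theta)

text \<open>The limit is minus half the second derivative of \<open>Lam\<close> at
  \<open>ys\<close>. There the argument of the logarithm in \<open>ell\<close> is 1, with derivative
  2 sin ys = -2 sin \<open>\<theta>\<close>.\<close>

lemma Lam_quadratic_limit: "((\<lambda>y. (Lam ys - Lam y) / (y - ys) ^ 2) \<longlongrightarrow> sin \<theta>) (at ys)"
proof (rule lhopital[where f' = "\<lambda>y. - ell y" and g' = "\<lambda>y. 2 * (y - ys)"])
  have "isCont Lam ys" using DERIV_Lam DERIV_isCont by blast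
  then have "((\<lambda>y. Lam ys - Lam y) \<longlongrightarrow> Lam ys - Lam ys) (at ys)"
    unfolding isCont_def by (intro tendsto_intros)
  then show "((\<lambda>y. Lam ys - Lam y) \<longlongrightarrow> 0) (at ys)" by simp
  show "((\<lambda>y. (y - ys) ^ 2) \<longlongrightarrow> 0) (at ys)"
    by (auto intro!: tendsto_eq_intros)
  show "\<forall>\<^sub>F x in at ys. (x - ys) ^ 2 \<noteq> 0" "\<forall>\<^sub>F x in at ys. 2 * (x - ys) \<noteq> 0"
    by (auto simp: eventually_at_filter)
  show "\<forall>\<^sub>F x in at ys. ((\<lambda>y. Lam ys - Lam y) has_real_derivative - ell x) (at x)"
    by (auto intro!: always_eventually derivative_eq_intros DERIV_Lam)
  show "\<forall>\<^sub>F x in at ys. ((\<lambda>y. (y - ys) ^ 2) has_real_derivative 2 * (x - ys)) (at x)"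
    by (auto intro!: always_eventually derivative_eq_intros)
  have "(ell has_real_derivative (2 * sin ys) / (2 * cosh u - 2 * cos ys)) (at ys)"
    unfolding ell_def using ell_arg_pos[of ys] by (auto intro!: derivative_eq_intros)
  then have "((\<lambda>y. (ell y - ell ys) / (y - ys)) \<longlongrightarrow> - 2 * sin \<theta>) (at ys)"
    by (simp add: has_field_derivative_iff sin_ys cos_ys cos_theta)
  then have "((\<lambda>y. - (1 / 2) * ((ell y - ell ys) / (y - ys))) \<longlongrightarrow> - (1 / 2) * (- 2 * sin \<theta>)) (at ys)"
    by (intro tendsto_intros)
  moreover have "(\<lambda>y. - (1 / 2) * ((ell y - ell ys) / (y - ys))) = (\<lambda>y. - ell y / (2 * (y - ys)))"
    unfolding ell_ys by (intro ext) simp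
  ultimately show "((\<lambda>y. - ell y / (2 * (y - ys))) \<longlongrightarrow> sin \<theta>) (at ys)"
    by simp
qed

text \<open>The quotient, extended by its limit at \<open>ys\<close>, is continuous and positive on
  a compact interval. The bound supplies the Gaussian majorant for dominated convergence.\<close>

lemma Lam_quadratic_bound:
  "\<exists>\<kappa>>0. \<forall>y\<in>{0..2*pi}. Lam ys - Lam y \<ge> \<kappa> * (y - ys) ^ 2"
proof -
  define r where "r y = (if y = ys then sin \<theta> else (Lam ys - Lam y) / (y - ys) ^ 2)" for y
  have "continuous_on {0..2*pi} r"
  proof (rule continuous_at_imp_continuous_on, rule ballI)
    fix y
    show "isCont r y"
    proof (cases "y = ys")
      case True
      have "(r \<longlongrightarrow> sin \<theta>) (at ys)"
        using Lam_quadratic_limit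
        by (rule Lim_transform_eventually) (auto simp: r_def eventually_at_filter)
      then show ?thesis using True by (simp add: isCont_def r_def)
    next
      case False
      have "isCont Lam y" using DERIV_Lam DERIV_isCont by blast
      then have "isCont (\<lambda>y. (Lam ys - Lam y) / (y - ys) ^ 2) y"
        using False by (auto intro!: continuous_intros)
      moreover have "\<forall>\<^sub>F x in nhds y. r x = (Lam ys - Lam x) / (x - ys) ^ 2"
        using t1_space_nhds[OF False] by eventually_elim (auto simp: r_def)
      ultimately show ?thesis using isCont_cong by fast
    qed
  qed
  then obtain y0 where y0: "y0 \<in> {0..2*pi}" "\<And>y. y \<in> {0..2*pi} \<Longrightarrow> r y0 \<le> r y"
    using continuous_attains_inf[of "{0..2*pi}" r] by auto
  have "r y0 > 0"
    using Lam_strict_max[of y0] y0(1) sin_theta_pos by (auto simp: r_def)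
  moreover have "Lam ys - Lam y \<ge> r y0 * (y - ys) ^ 2" if "y \<in> {0..2*pi}" for y
    using y0(2)[OF that] by (cases "y = ys") (auto simp: r_def field_simps split: if_splits)
  ultimately show ?thesis by blast
qed

section \<open>Growth rate off the imaginary axis\<close>

definition Psi :: "complex \<Rightarrow> real" where "Psi z = Re (V z / \<xi>)"

definition X :: real where "X = 2 * pi * Lam ys / nx"

lemma Psi_imag: "Psi (\<i> * of_real y) = 2 * pi * Lam y / nx"
  by (simp add: Psi_def Re_divide_xi V_imag)

lemma Psi_imag_le: "0 \<le> y \<Longrightarrow> y \<le> 2 * pi \<Longrightarrow> Psi (\<i> * of_real y) \<le> X"
  unfolding Psi_imag X_def by (intro divide_right_mono mult_left_mono Lam_max) (auto intro: less_imp_le[OF nx_pos])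

text \<open>The left side is \<open>Psi\<close> at 2 pi i, so this is the strict gap between the
  saddle and the upper end of the axis.\<close>

lemma X_gt: "4 * pi ^ 2 * u / nx < X"
proof -
  have "2 * pi * (2 * pi * u) / nx < 2 * pi * Lam ys / nx"
    by (intro divide_strict_right_mono mult_strict_left_mono Lam_ys_gt) auto
  then show ?thesis by (simp add: X_def power2_eq_square)
qed

text \<open>Crude estimate: |f| <= 2 cosh u + 2 cosh (2 u) <= 3 + 7 = 10 <= e^3.\<close>

lemma Re_V'_le:
  assumes "z \<in> dom" "0 \<le> Re z" "Re z \<le> 2 * u"
  shows "Re (V' z) \<le> 3"
proof -
  have "cosh (Re z) \<le> cosh (2 * u)" using assms u_pos by (subst cosh_real_nonneg_le_iff) auto
  also have "\<dots> = 2 * cosh u ^ 2 - 1" by (rule cosh_double_cosh)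
  also have "\<dots> \<le> 2 * (3 / 2) ^ 2 - 1"
    using cosh_u_less cosh_u_gt by (intro diff_right_mono mult_left_mono power_mono) auto
  finally have "norm (f z) \<le> 10"
    using norm_f_le[of z] cosh_u_less by (simp add: power2_eq_square)
  also have "(10::real) \<le> exp 3"
  proof -
    have "(2::real) \<le> exp (3 / 4)" using exp_ge_add_one_self[of "3 / 4 :: real"] 
      exp_lower_Taylor_quadratic[of "3 / 4 :: real"] by (simp add: power2_eq_square)
    then have "(2::real) ^ 4 \<le> exp (3 / 4) ^ 4" by (intro power_mono) auto
    then show ?thesis by (simp flip: exp_of_nat_mult)
  qed
  finally have "ln (norm (f z)) \<le> ln (exp 3)"
    using f_nonzero[OF assms(1)] by (subst ln_le_cancel_iff) auto
  then show ?thesis by (simp add: Re_V'[OF assms(1)])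
qed

lemma Im_Ln_le_0: "w \<notin> \<real>\<^sub>\<le>\<^sub>0 \<Longrightarrow> Im w \<le> 0 \<Longrightarrow> Im (Ln w) \<le> 0"
  using Im_Ln_less_pi[of w] Im_Ln_pos_lt[of w] by (cases "w = 0") auto

text \<open>The arguments of the two logarithms have imaginary parts of opposite sign (or zero), so
  at most one logarithm contributes positively. Its contribution is at most pi/2 if its argument
  lies in the right half plane, which for the first logarithm is guaranteed by Re z <= u.\<close>

lemma Im_V'_le:
  assumes d: "z \<in> dom" and s: "0 \<le> Re z"
  shows "Im (V' z) \<le> pi" and "Re z \<le> u \<Longrightarrow> Im (V' z) \<le> pi / 2"
proof -
  define w1 w2 where "w1 = 1 - exp (z - of_real u)" and "w2 = 1 - exp (- z - of_real u)"
  have n: "w1 \<notin> \<real>\<^sub>\<le>\<^sub>0" "w2 \<notin> \<real>\<^sub>\<le>\<^sub>0" "w1 \<noteq> 0" "w2 \<noteq> 0"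
    using d one_minus_exp_nonzero[OF d] by (auto simp: w1_def w2_def dom_def one_minus_cut_plane)
  have "Re (exp (- z - of_real u)) \<le> norm (exp (- z - of_real u))" by (rule complex_Re_le_cmod)
  also have "\<dots> < 1" using s u_pos by simp
  finally have "Re w2 \<ge> 0" by (simp add: w2_def)
  then have w2: "\<bar>Im (Ln w2)\<bar> \<le> pi / 2" using Re_Ln_pos_le[OF n(4)] by simp
  have V': "Im (V' z) = Im (Ln w1) + Im (Ln w2)"
    by (simp add: V'_def w1_def w2_def)
  have Im_w: "Im w1 = - (exp (Re z - u) * sin (Im z))" "Im w2 = exp (- Re z - u) * sin (Im z)"
    by (simp_all add: w1_def w2_def Im_exp)
  have neg: "Im (Ln w1) \<le> 0 \<or> Im (Ln w2) \<le> 0"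
  proof (cases "sin (Im z) \<ge> 0")
    case True
    then have "Im (Ln w1) \<le> 0" by (intro Im_Ln_le_0 n) (simp add: Im_w)
    then show ?thesis ..
  next
    case False
    then have "Im (Ln w2) \<le> 0" by (intro Im_Ln_le_0 n) (simp add: Im_w mult_le_0_iff)
    then show ?thesis ..
  qed
  show "Im (V' z) \<le> pi"
    using neg Im_Ln_less_pi[OF n(1)] w2 pi_gt_zero unfolding V' by linarith
  show "Im (V' z) \<le> pi / 2" if "Re z \<le> u"
  proof -
    have "Re (exp (z - of_real u)) \<le> norm (exp (z - of_real u))" by (rule complex_Re_le_cmod)
    also have "\<dots> \<le> 1" using that by simp
    finally have "Re w1 \<ge> 0" by (simp add: w1_def)
    then have "\<bar>Im (Ln w1)\<bar> \<le> pi / 2" using Re_Ln_pos_le[OF n(3)] by simp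
    then show ?thesis using neg w2 unfolding V' by linarith
  qed
qed

lemma DERIV_Psi:
  assumes "Complex x y \<in> dom"
  shows "((\<lambda>s. Psi (Complex s y)) has_real_derivative Re (V' (Complex x y) / \<xi>)) (at x)"
proof -
  have "((\<lambda>s. Complex s y) has_vector_derivative 1) (at x)"
    unfolding Complex_eq by (auto intro!: derivative_eq_intros)
  from field_vector_diff_chain_at[OF this, of V "V' (Complex x y)"] has_field_derivative_V[OF assms]
  have "((\<lambda>s. V (Complex s y)) has_vector_derivative V' (Complex x y)) (at x)"
    by (simp add: o_def)
  then have "((\<lambda>s. V (Complex s y) / \<xi>) has_vector_derivative V' (Complex x y) / \<xi>) (at x)"
    by (rule has_vector_derivative_divide)
  from has_derivative_Re[OF this[unfolded has_vector_derivative_def]] show ?thesis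
    unfolding Psi_def by (simp add: has_field_derivative_def mult.commute[of _ "Re _"])
qed

text \<open>Integrates the derivative (u Re V' + 2 pi Im V') / nx of \<open>Psi\<close> in the real
  direction, using Re V' <= 3.\<close>

lemma Psi_horizontal:
  assumes s: "0 \<le> s0" "s0 \<le> s1" "s1 \<le> 2 * u"
    and d: "\<And>s. s0 \<le> s \<Longrightarrow> s \<le> s1 \<Longrightarrow> Complex s y \<in> dom"
    and B: "\<And>s. s0 \<le> s \<Longrightarrow> s \<le> s1 \<Longrightarrow> Im (V' (Complex s y)) \<le> B"
  shows "Psi (Complex s1 y) \<le> Psi (Complex s0 y) + (s1 - s0) * ((3 * u + 2 * pi * B) / nx)"
proof -
  define k where "k = (3 * u + 2 * pi * B) / nx"
  have "Psi (Complex s1 y) - k * s1 \<le> Psi (Complex s0 y) - k * s0"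
  proof (rule DERIV_nonpos_imp_nonincreasing[OF s(2)])
    fix x assume x: "s0 \<le> x" "x \<le> s1"
    have "((\<lambda>s. Psi (Complex s y)) has_real_derivative Re (V' (Complex x y) / \<xi>)) (at x)"
      by (rule DERIV_Psi[OF d[OF x]])
    then have "((\<lambda>s. Psi (Complex s y) - k * s) has_real_derivative Re (V' (Complex x y) / \<xi>) - k) (at x)"
      by (auto intro!: derivative_eq_intros)
    moreover have "u * Re (V' (Complex x y)) + 2 * pi * Im (V' (Complex x y)) \<le> u * 3 + 2 * pi * B"
      using s x u_pos by (intro add_mono mult_left_mono B Re_V'_le d) auto
    then have "Re (V' (Complex x y) / \<xi>) - k \<le> 0"
      unfolding Re_divide_xi k_def using nx_pos
      by (simp add: divide_right_mono mult.commute less_imp_le)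
    ultimately show "\<exists>l. ((\<lambda>s. Psi (Complex s y) - k * s) has_real_derivative l) (at x) \<and> l \<le> 0"
      by blast
  qed
  then have "Psi (Complex s1 y) \<le> Psi (Complex s0 y) + (s1 - s0) * k" by (simp add: algebra_simps)
  then show ?thesis by (simp only: k_def)
qed

lemma Psi_inner:
  assumes y: "0 < y" "y < 2 * pi" and s: "0 \<le> s0" "s0 \<le> s1" "s1 \<le> u"
  shows "Psi (Complex s1 y) \<le> Psi (Complex s0 y) + (s1 - s0) * ((3 * u + pi ^ 2) / nx)"
  using Psi_horizontal[of s0 s1 y "pi / 2"] dom_upper[of "Complex _ y"] Im_V'_le(2)[of "Complex _ y"] assms u_pos
  by (simp add: power2_eq_square)

lemma Psi_outer:
  assumes y: "0 < y" "y < 2 * pi" and s: "0 \<le> s0" "s0 \<le> s1" "s1 \<le> 2 * u"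
  shows "Psi (Complex s1 y) \<le> Psi (Complex s0 y) + (s1 - s0) * ((3 * u + 2 * pi ^ 2) / nx)"
  using Psi_horizontal[of s0 s1 y "pi"] dom_upper[of "Complex _ y"] Im_V'_le(1)[of "Complex _ y"] assms
  by (simp add: power2_eq_square mult.assoc)

lemma Complex_0_eq: "Complex 0 y = \<i> * of_real y"
  by (simp add: complex_eq_iff)

lemma pi_sq_gt_9: "pi ^ 2 > 9"
proof -
  have "(3::real) ^ 2 < pi ^ 2" using pi_gt3 by (intro power_strict_mono) auto
  then show ?thesis by simp
qed

text \<open>The side of the contour parallel to \<open>\<xi>\<close> meets the real axis at \<open>cr\<close>. The choice
  \<open>cr = 9 u / 10\<close> makes the crude bounds \<open>Re V' \<le> 3\<close> and \<open>Im V' \<le> \<pi>\<close> sufficient, and stays below \<open>u\<close>.\<close>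

definition cr :: real where "cr = 9 * u / 10"

lemma cr_bounds: "0 < cr" "cr < u"
  using u_pos by (auto simp: cr_def)

text \<open>The subtracted term is log |E| / M on this side, constant because the side is parallel
  to \<open>\<xi>\<close>. It is the gain from 1 / E, which has to outweigh the growth of
  \<open>Psi\<close> away from the imaginary axis.\<close>

lemma Psi_slanted:
  assumes x: "0 < x" "x < 1"
  shows "Psi (of_real cr + of_real x * \<xi>) - 4 * pi ^ 2 * cr / nx \<le> X - u / nx"
proof -
  define s y where "s = cr + x * u" and "y = 2 * pi * x"
  have z: "of_real cr + of_real x * \<xi> = Complex s y"
    by (simp add: complex_eq_iff s_def y_def)
  have y: "0 < y" "y < 2 * pi" using x by (auto simp: y_def)
  have s0: "0 \<le> s" "s \<le> u + cr" "s \<le> 2 * u"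
    using x u_pos cr_bounds by (auto simp: s_def intro!: add_nonneg_nonneg) (smt (verit) mult_left_le_one_le)+
  \<comment> \<open>The bound on Im V' changes from pi/2 to pi at Re z = u, and at most a length
    \<open>cr\<close> lies beyond that line.\<close>
  define m where "m = min s u"
  have m: "0 \<le> m" "m \<le> u" "m \<le> s" "s - m \<le> cr" using s0 cr_bounds u_pos by (auto simp: m_def)
  have "Psi (Complex s y) \<le> Psi (Complex m y) + (s - m) * ((3 * u + 2 * pi ^ 2) / nx)"
    using m s0 by (intro Psi_outer y) auto
  also have "(s - m) * ((3 * u + 2 * pi ^ 2) / nx) \<le> cr * ((3 + 2 * pi ^ 2) / nx)"
    using m u_less_1 u_pos less_imp_le[OF nx_pos] by (intro mult_mono divide_right_mono add_right_mono) auto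
  also have "Psi (Complex m y) \<le> Psi (Complex 0 y) + (m - 0) * ((3 * u + pi ^ 2) / nx)"
    using m by (intro Psi_inner y) auto
  also have "Psi (Complex 0 y) \<le> X"
    using y unfolding Complex_0_eq by (intro Psi_imag_le) auto
  also have "(m - 0) * ((3 * u + pi ^ 2) / nx) \<le> u * ((3 + pi ^ 2) / nx)"
    using m u_less_1 u_pos less_imp_le[OF nx_pos] by (intro mult_mono divide_right_mono add_right_mono) auto
  finally have "Psi (Complex s y) \<le> X + u * ((3 + pi ^ 2) / nx) + cr * ((3 + 2 * pi ^ 2) / nx)"
    by simp
  \<comment> \<open>For cr = 9 u/10 the coefficients are 3 + 27/10 = 57/10 and 1 + 18/10 - 36/10 =
    -8/10.\<close>
  moreover have "u * ((3 + pi ^ 2) / nx) + cr * ((3 + 2 * pi ^ 2) / nx) - 4 * pi ^ 2 * cr / nx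
      = (u * (57 / 10 - 8 / 10 * pi ^ 2)) / nx"
    by (simp add: cr_def add_divide_distrib diff_divide_distrib algebra_simps)
  moreover have "(u * (57 / 10 - 8 / 10 * pi ^ 2)) / nx \<le> (u * - 1) / nx"
    using pi_sq_gt_9 u_pos less_imp_le[OF nx_pos] by (intro divide_right_mono mult_left_mono) auto
  ultimately show ?thesis
    unfolding z by simp
qed

text \<open>Near the real axis \<open>Lam\<close> is close to \<open>Lam 0\<close> = 0. Even with
  the horizontal growth added, the value stays below that of \<open>Psi\<close> at 2 pi i, hence
  below \<open>X\<close>.\<close>

lemma Psi_bottom:
  "\<exists>y0>0. \<forall>y t. 0 < y \<and> y < y0 \<and> 0 \<le> t \<and> t \<le> u \<longrightarrow> Psi (Complex t y) \<le> X - u / nx"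
proof -
  have "isCont Lam 0" using DERIV_Lam DERIV_isCont by blast
  then have "\<forall>\<^sub>F y in at 0. Lam y < u"
    using u_pos unfolding isCont_def by (intro order_tendstoD(2)) (auto simp: Lam_0)
  then obtain d where d: "d > 0" "\<And>y. y \<noteq> 0 \<Longrightarrow> dist y 0 < d \<Longrightarrow> Lam y < u"
    unfolding eventually_at by auto
  have "Psi (Complex t y) \<le> X - u / nx" if "0 < y" "y < min d 1" "0 \<le> t" "t \<le> u" for y t
  proof -
    have y: "y < 2 * pi" using that pi_gt3 by simp
    have "Psi (Complex t y) \<le> Psi (Complex 0 y) + (t - 0) * ((3 * u + pi ^ 2) / nx)"
      using that y by (intro Psi_inner) auto
    also have "(t - 0) * ((3 * u + pi ^ 2) / nx) \<le> u * ((3 + pi ^ 2) / nx)"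
      using that u_less_1 u_pos less_imp_le[OF nx_pos] by (intro mult_mono divide_right_mono add_right_mono) auto
    also have "Psi (Complex 0 y) \<le> 2 * pi * u / nx"
      unfolding Complex_0_eq Psi_imag using d(2)[of y] that less_imp_le[OF nx_pos]
      by (intro divide_right_mono mult_left_mono) auto
    also have "2 * pi * u / nx + u * ((3 + pi ^ 2) / nx) = (u * (2 * pi + 3 + pi ^ 2)) / nx"
      by (simp add: add_divide_distrib algebra_simps)
    also have "\<dots> \<le> (u * (4 * pi ^ 2 - 1)) / nx"
    proof -
      have "3 * pi \<le> pi ^ 2" unfolding power2_eq_square using pi_gt3 by (intro mult_right_mono) auto
      then have "2 * pi + 3 + pi ^ 2 \<le> 4 * pi ^ 2 - 1"
        using pi_sq_gt_9 pi_gt3 by linarith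
      then show ?thesis
        using u_pos less_imp_le[OF nx_pos] by (intro divide_right_mono mult_left_mono) auto
    qed
    also have "\<dots> = 4 * pi ^ 2 * u / nx - u / nx"
      by (simp add: diff_divide_distrib algebra_simps)
    also have "\<dots> \<le> X - u / nx" using X_gt by simp
    finally show ?thesis by simp
  qed
  then show ?thesis using d(1) by (intro exI[of _ "min d 1"]) auto
qed

text \<open>On [0, u) the derivative V' is real and nonpositive, because 0 < f <= 2 cosh u - 2 <
  1.\<close>

lemma Psi_real_le:
  assumes "0 \<le> t" "t < u"
  shows "Psi (Complex t 0) \<le> 0"
proof -
  have der: "Re (V' (Complex s 0)) \<le> 0 \<and> Im (V' (Complex s 0)) = 0" if "0 \<le> s" "s \<le> t" for s
  proof -
    have d: "Complex s 0 \<in> dom" using that assms by (intro dom_strip) auto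
    have "Complex s 0 - of_real u = of_real (s - u)" "- Complex s 0 - of_real u = of_real (- s - u)"
      by (simp_all add: complex_eq_iff)
    then have e: "exp (Complex s 0 - of_real u) = of_real (exp (s - u))"
      "exp (- Complex s 0 - of_real u) = of_real (exp (- s - u))"
      by (simp_all only: exp_of_real)
    have l: "exp (s - u) < 1" "exp (- s - u) < 1" using that assms u_pos by auto
    have r: "1 - of_real x = (of_real (1 - x) :: complex)" for x by simp
    have im: "Im (V' (Complex s 0)) = 0"
      unfolding V'_def e r using l by (subst (1 2) Ln_of_real) auto
    have "f (Complex s 0) = of_real (2 * cosh u - 2 * cosh s)"
      unfolding f_eq by (simp add: complex_of_real_def[symmetric] cosh_def scaleR_conv_of_real exp_of_real[symmetric])
    then have "norm (f (Complex s 0)) = \<bar>2 * cosh u - 2 * cosh s\<bar>" by (simp only: norm_of_real)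
    also have "\<dots> \<le> 1"
    proof -
      have "cosh s \<le> cosh u" "cosh s \<ge> 1"
        using that assms cosh_real_ge_1 by (auto simp: cosh_real_nonneg_le_iff)
      then show ?thesis using cosh_u_less by linarith
    qed
    finally have "ln (norm (f (Complex s 0))) \<le> 0"
      using f_nonzero[OF d] by simp
    then have "Re (V' (Complex s 0)) \<le> 0" using Re_V'[OF d] by simp
    then show ?thesis using im by simp
  qed
  have "Psi (Complex t 0) \<le> Psi (Complex 0 0)"
  proof (rule DERIV_nonpos_imp_nonincreasing[OF assms(1)])
    fix x assume x: "0 \<le> x" "x \<le> t"
    have d: "Complex x 0 \<in> dom" using x assms by (intro dom_strip) auto
    have "((\<lambda>s. Psi (Complex s 0)) has_real_derivative Re (V' (Complex x 0) / \<xi>)) (at x)"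
      by (rule DERIV_Psi[OF d])
    moreover have "Re (V' (Complex x 0) / \<xi>) \<le> 0"
      unfolding Re_divide_xi using der[OF x] u_pos less_imp_le[OF nx_pos]
      by (simp add: divide_le_0_iff mult_le_0_iff)
    ultimately show "\<exists>l. ((\<lambda>s. Psi (Complex s 0)) has_real_derivative l) (at x) \<and> l \<le> 0"
      by blast
  qed
  also have "Complex 0 0 = 0" by (simp add: complex_eq_iff)
  finally show ?thesis by (simp add: Psi_def V_0)
qed

lemma Psi_top:
  "\<exists>\<epsilon>>0. \<exists>\<delta>>0. \<epsilon> < 1 \<and> (\<forall>y t. 2 * pi - \<epsilon> < y \<and> y < 2 * pi \<and> 0 \<le> t \<and> t \<le> u \<longrightarrow> Psi (Complex t y) \<le> X - \<delta>)"
proof -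
  define \<delta> where "\<delta> = (X - 4 * pi ^ 2 * u / nx) / 3"
  have \<delta>: "\<delta> > 0" using X_gt by (simp add: \<delta>_def)
  define k where "k = (3 * u + pi ^ 2) / nx"
  have k: "k > 0" using u_pos nx_pos by (auto simp: k_def intro!: divide_pos_pos add_pos_pos)
  define \<sigma> where "\<sigma> = u - min (u / 2) (\<delta> / k)"
  have \<sigma>: "0 \<le> \<sigma>" "\<sigma> < u" "(u - \<sigma>) * k \<le> \<delta>"
    using u_pos \<delta> k by (auto simp: \<sigma>_def min_def field_simps)
  define K where "K = (\<lambda>(t, y). Complex t y) ` ({0..\<sigma>} \<times> {0..2*pi})"
  have cC: "continuous_on A (\<lambda>(t, y). Complex t y)" for A
    unfolding case_prod_beta Complex_eq by (intro continuous_intros)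
  have "compact K" unfolding K_def
    by (intro compact_continuous_image compact_Times cC) auto
  moreover have "K \<subseteq> dom" using \<sigma> by (auto simp: K_def intro!: dom_strip)
  then have "continuous_on K Psi"
    unfolding Psi_def by (intro continuous_intros continuous_on_subset[OF continuous_on_V]) auto
  ultimately have "uniformly_continuous_on K Psi"
    by (intro compact_uniformly_continuous)
  then obtain d where d: "d > 0" "\<And>z w. z \<in> K \<Longrightarrow> w \<in> K \<Longrightarrow> dist w z < d \<Longrightarrow> dist (Psi w) (Psi z) < \<delta>"
    using \<delta> unfolding uniformly_continuous_on_def by metis
  define \<epsilon> where "\<epsilon> = min d (1 / 2)"
  have inner: "Psi (Complex t y) \<le> X - 2 * \<delta>" if "2 * pi - \<epsilon> < y" "y < 2 * pi" "0 \<le> t" "t \<le> \<sigma>" for t y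
  proof -
    have "0 \<le> y" using that pi_gt3 by (auto simp: \<epsilon>_def)
    then have "Complex t y \<in> K" "Complex t (2 * pi) \<in> K"
      using that by (auto simp: K_def)
    moreover have "dist (Complex t y) (Complex t (2 * pi)) < d"
      using that by (simp add: dist_norm complex_diff cmod_def \<epsilon>_def)
    ultimately have "dist (Psi (Complex t y)) (Psi (Complex t (2 * pi))) < \<delta>"
      using d(2) by blast
    moreover have e: "Complex t (2 * pi) = Complex t 0 + 2 * of_real pi * \<i>"
      by (simp add: complex_eq_iff)
    have "Psi (Complex t (2 * pi)) = Psi (Complex t 0) + 4 * pi ^ 2 * u / nx"
      unfolding e Psi_def V_periodic Re_divide_xi
      by (simp add: add_divide_distrib algebra_simps power2_eq_square)
    moreover have "Psi (Complex t 0) \<le> 0" using that \<sigma> by (intro Psi_real_le) auto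
    moreover have "4 * pi ^ 2 * u / nx = X - 3 * \<delta>"
      unfolding \<delta>_def by (simp only: times_divide_eq_right nonzero_mult_div_cancel_left)
    ultimately show ?thesis unfolding dist_real_def by linarith
  qed
  have "Psi (Complex t y) \<le> X - \<delta>" if "2 * pi - \<epsilon> < y" "y < 2 * pi" "0 \<le> t" "t \<le> u" for t y
  proof (cases "t \<le> \<sigma>")
    case True
    then show ?thesis using inner[OF that(1-3)] \<delta> by simp
  next
    case False
    have "0 < y" using that pi_gt3 by (auto simp: \<epsilon>_def)
    then have "Psi (Complex t y) \<le> Psi (Complex \<sigma> y) + (t - \<sigma>) * k"
      unfolding k_def using that False \<sigma> by (intro Psi_inner) auto
    also have "(t - \<sigma>) * k \<le> (u - \<sigma>) * k" using that k by (intro mult_right_mono) auto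
    finally show ?thesis using inner[OF that(1,2) \<sigma>(1)] \<sigma>(3) by simp
  qed
  then show ?thesis using \<delta> d(1) by (intro exI[of _ \<epsilon>] exI[of _ \<delta>] conjI) (auto simp: \<epsilon>_def)
qed

section \<open>Bounds off the imaginary axis\<close>

definition EE :: "nat \<Rightarrow> complex \<Rightarrow> complex" where
  "EE M z = exp (2 * of_real pi * \<i> * z * of_nat M / \<xi>)"

text \<open>At z = k h the first factors come from the quotient of q-factorials. The second ones
  account for a shift by d in the product over l, up to the constant \<open>dfac\<close>.\<close>

definition rho :: "nat \<Rightarrow> nat \<Rightarrow> complex \<Rightarrow> complex" where
  "rho d M z = (\<Prod>i=1..d. (1 - exp (z + of_nat i * h M)) * (1 - exp (of_real u - z - of_nat i * h M)))"

definition Phi :: "nat \<Rightarrow> nat \<Rightarrow> complex \<Rightarrow> complex" where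
  "Phi d M z = rho d M z * g M z / (EE M z - 1)"

abbreviation summand :: "nat \<Rightarrow> nat \<Rightarrow> nat \<Rightarrow> complex" where
  "summand d M k \<equiv> rho d M (of_nat k * h M) * g M (of_nat k * h M)"

abbreviation line_int :: "nat \<Rightarrow> nat \<Rightarrow> complex \<Rightarrow> complex \<Rightarrow> complex" where
  "line_int d M a b \<equiv> contour_integral (linepath a b) (Phi d M)"

text \<open>The exponent is positive exactly to the right of the line through 0 and
  \<open>\<xi>\<close>, so E is large there and small on the other side.\<close>

lemma norm_EE: "norm (EE M z) = exp (real M * (2 * pi * (2 * pi * Re z - u * Im z) / nx))"
proof -
  have "Re (2 * of_real pi * \<i> * z * of_nat M / \<xi>) = real M * Re ((2 * of_real pi * \<i> * z) / \<xi>)"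
    by (metis Re_complex_of_real complex_Re_numeral mult.commute of_real_of_nat_eq times_divide_eq_right
        Re_divide_of_real scaleR_complex.sel(1) scaleR_conv_of_real)
  also have "Re ((2 * of_real pi * \<i> * z) / \<xi>) = 2 * pi * (2 * pi * Re z - u * Im z) / nx"
    unfolding Re_divide_xi by (simp add: algebra_simps)
  finally show ?thesis by (simp add: EE_def)
qed

lemma EE_eq_1_iff:
  assumes "M > 0"
  shows "EE M z = 1 \<longleftrightarrow> (\<exists>k::int. z = of_int k * h M)"
proof -
  have "EE M z = 1 \<longleftrightarrow> (\<exists>k::int. 2 * of_real pi * \<i> * z * of_nat M / \<xi> = of_int (2 * k) * (of_real pi * \<i>))"
    unfolding EE_def by (subst exp_eq_1) (auto simp: complex_eq_iff algebra_simps)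
  also have "\<dots> \<longleftrightarrow> (\<exists>k::int. z = of_int k * h M)"
  proof (intro ex_cong1)
    fix k :: int
    have "2 * of_real pi * \<i> * z * of_nat M / \<xi> = of_int (2 * k) * (of_real pi * \<i>)
      \<longleftrightarrow> (2 * of_real pi * \<i>) * (z * of_nat M / \<xi>) = (2 * of_real pi * \<i>) * of_int k"
      by (simp add: mult_ac)
    also have "\<dots> \<longleftrightarrow> z * of_nat M / \<xi> = of_int k"
      by (subst mult_cancel_left) simp
    also have "\<dots> \<longleftrightarrow> z = of_int k * h M"
      using assms by (auto simp: h_def field_simps)
    finally show "2 * of_real pi * \<i> * z * of_nat M / \<xi> = of_int (2 * k) * (of_real pi * \<i>)
      \<longleftrightarrow> z = of_int k * h M" .
  qed
  finally show ?thesis .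
qed

lemma EE_derivative:
  "(EE M has_field_derivative (2 * of_real pi * \<i> * of_nat M / \<xi>) * EE M z) (at z)"
  unfolding EE_def by (auto intro!: derivative_eq_intros)

text \<open>On a horizontal line halfway between grid points E = -w with w = exp
  (\<open>\<tau>\<close> + i \<open>\<tau>\<close> v) and 0 <= v <= 1. If |\<open>\<tau>\<close>| <=
  1 the phase is below pi/2, so Re w >= 0. Otherwise |E| is above e or below 1/e.\<close>

lemma norm_EE_minus_1_half:
  fixes m :: int and t :: real
  assumes M: "M > 0" and z: "z = (of_int m - 1 / 2) * h M + of_real t"
  shows "norm (EE M z - 1) \<ge> 1 / 2" "norm (EE M z - 1) \<ge> norm (EE M z) / 2"
proof -
  define \<tau> where "\<tau> = real M * (4 * pi ^ 2 * t) / nx"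
  define v where "v = u / (2 * pi)"
  define w where "w = exp (Complex \<tau> (\<tau> * v))"
  have v: "0 \<le> v" "v \<le> 1"
    using u_pos u_less_1 pi_gt3 by (auto simp: v_def field_simps)
  have "2 * of_real pi * \<i> * z * of_nat M / \<xi> = 2 * of_real pi * \<i> * (of_int m - 1 / 2) * (h M * of_nat M / \<xi>)
     + 2 * of_real pi * \<i> * of_real t * of_nat M / \<xi>"
    unfolding z by (simp add: add_divide_distrib diff_divide_distrib ring_distribs mult_ac)
  also have "h M * of_nat M / \<xi> = 1" using M by (simp add: h_def)
  also have "2 * of_real pi * \<i> * of_real t * of_nat M / \<xi> = Complex \<tau> (\<tau> * v)"
  proof -
    have "2 * of_real pi * \<i> * of_real t * of_nat M = Complex 0 (2 * pi * t * real M)"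
      by (simp add: complex_eq_iff)
    then show ?thesis
      by (simp add: complex_eq_iff Re_divide_xi Im_divide_xi \<tau>_def v_def power2_eq_square mult_ac)
  qed
  also have "2 * of_real pi * \<i> * (of_int m - 1 / 2) * 1 + Complex \<tau> (\<tau> * v) =
      of_int m * (2 * of_real pi * \<i>) + - (of_real pi * \<i>) + Complex \<tau> (\<tau> * v)"
    by (simp add: algebra_simps)
  finally have "EE M z = exp (of_int m * (2 * of_real pi * \<i>)) * exp (- (of_real pi * \<i>)) * w"
    unfolding EE_def w_def by (simp only: exp_add)
  also have "exp (of_int m * (2 * of_real pi * \<i>)) = 1"
    by (subst exp_eq_1) (auto intro!: exI[of _ m])
  also have "exp (- (of_real pi * \<i>)) = - 1"
    by (simp add: exp_minus exp_pi_i)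
  finally have E: "EE M z = - w" by simp
  have n: "norm (EE M z - 1) = norm (1 + w)" "norm (EE M z) = norm w"
  proof -
    have "- w - 1 = - (1 + w)" by simp
    then show "norm (EE M z - 1) = norm (1 + w)" "norm (EE M z) = norm w"
      unfolding E by (simp_all only: norm_minus_cancel)
  qed
  have nw: "norm w = exp \<tau>" by (simp add: w_def)
  have tri: "norm (1 + w) \<ge> 1 - exp \<tau>" "norm (1 + w) \<ge> exp \<tau> - 1"
    using norm_diff_ineq[of 1 w] norm_diff_ineq[of w 1] by (simp_all add: nw add.commute)
  have "norm (1 + w) \<ge> 1 / 2 \<and> norm (1 + w) \<ge> exp \<tau> / 2"
  proof (cases "\<bar>\<tau>\<bar> \<le> 1")
    case True
    have "\<bar>\<tau> * v\<bar> \<le> 1 * 1" unfolding abs_mult using True v by (intro mult_mono) auto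
    then have "\<bar>\<tau> * v\<bar> < pi / 2" using pi_gt3 by linarith
    then have "cos (\<tau> * v) > 0" by (intro cos_gt_zero_pi) auto
    then have Re: "Re w \<ge> 0" by (simp add: w_def Re_exp)
    have "Re (1 + w) \<le> norm (1 + w)" by (rule complex_Re_le_cmod)
    then have 1: "norm (1 + w) \<ge> 1" using Re by simp
    have "norm w ^ 2 \<le> norm (1 + w) ^ 2"
    proof -
      have "norm w ^ 2 = Re w ^ 2 + Im w ^ 2" "norm (1 + w) ^ 2 = (1 + Re w) ^ 2 + Im w ^ 2"
        by (simp_all add: cmod_power2)
      moreover have "Re w ^ 2 \<le> (1 + Re w) ^ 2" using Re by (intro power_mono) auto
      ultimately show ?thesis by simp
    qed
    then have "norm w \<le> norm (1 + w)" by (rule power2_le_imp_le) simp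
    then show ?thesis using 1 nw by (smt (verit) exp_gt_zero field_sum_of_halves)
  next
    case False
    have e2: "exp 1 \<ge> (2 :: real)" using exp_ge_add_one_self[of "1::real"] by simp
    show ?thesis
    proof (cases "\<tau> > 0")
      case True
      then have "exp 1 \<le> exp \<tau>" using False by simp
      then show ?thesis using tri e2 by linarith
    next
      case neg: False
      then have "exp \<tau> \<le> exp (- 1)" using False by simp
      also have "\<dots> \<le> (1/2 :: real)" using e2 by (simp add: exp_minus field_simps)
      finally show ?thesis using tri exp_gt_zero[of \<tau>] by linarith
    qed
  qed
  then show "norm (EE M z - 1) \<ge> 1 / 2" "norm (EE M z - 1) \<ge> norm (EE M z) / 2"
    using n nw by auto
qed

section \<open>Uniform bounds for rho and g\<close>

lemma rho_bound:
  "\<exists>R>0. \<forall>M z. d \<le> M \<and> 0 < M \<and> 0 \<le> Re z \<and> Re z \<le> 2 * u \<longrightarrow> norm (rho d M z) \<le> R"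
proof -
  define R where "R = ((1 + exp (3 * u)) * (1 + exp u)) ^ d"
  have "norm (rho d M z) \<le> R" if *: "d \<le> M" "0 < M" "0 \<le> Re z" "Re z \<le> 2 * u" for M z
  proof -
    have "norm ((1 - exp (z + of_nat i * h M)) * (1 - exp (of_real u - z - of_nat i * h M)))
      \<le> (1 + exp (3 * u)) * (1 + exp u)" if i: "i \<in> {1..d}" for i
    proof -
      have iu: "0 \<le> real i * (u / real M)" "real i * (u / real M) \<le> u"
        using i * u_pos by (auto simp: field_simps)
      have "norm (1 - exp (z + of_nat i * h M)) \<le> norm (1 :: complex) + norm (exp (z + of_nat i * h M))"
        by (rule norm_triangle_ineq4)
      also have "\<dots> \<le> 1 + exp (3 * u)" using iu * by (simp add: Re_h)
      finally have 1: "norm (1 - exp (z + of_nat i * h M)) \<le> 1 + exp (3 * u)" .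
      have "norm (1 - exp (of_real u - z - of_nat i * h M)) \<le> norm (1 :: complex) + norm (exp (of_real u - z - of_nat i * h M))"
        by (rule norm_triangle_ineq4)
      also have "norm (exp (of_real u - z - of_nat i * h M)) = exp (u - Re z - real i * (u / real M))"
        by (simp add: Re_h)
      also have "exp (u - Re z - real i * (u / real M)) \<le> exp u"
        unfolding exp_le_cancel_iff using iu * by linarith
      finally show ?thesis using 1 unfolding norm_mult by (intro mult_mono) (auto intro!: add_nonneg_nonneg)
    qed
    then have "norm (rho d M z) \<le> (\<Prod>i=1..d. (1 + exp (3 * u)) * (1 + exp u))"
      unfolding rho_def prod_norm[symmetric] by (intro prod_mono) auto
    then show ?thesis by (simp add: R_def)
  qed
  moreover have "R > 0" by (auto simp: R_def intro!: zero_less_power mult_pos_pos add_pos_pos)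
  ultimately show ?thesis by blast
qed

lemma Re_V_M: "Re (V z * of_nat M / \<xi>) = real M * Psi z"
proof -
  have "V z * of_nat M / \<xi> = of_real (real M) * (V z / \<xi>)" by simp
  moreover have "Re (of_real r * w) = r * Re w" for r w by simp
  ultimately show ?thesis by (simp only: Psi_def)
qed

lemma norm_amp_le:
  assumes "\<bar>Re z\<bar> < u"
  shows "norm (amp z) \<le> 2 / norm (1 - exp (- of_real u :: complex))"
proof -
  have d: "z \<in> dom" using assms by (rule dom_strip)
  have 1: "norm (1 - exp w) \<le> 2" if "Re w \<le> 0" for w :: complex
  proof -
    have "norm (1 - exp w) \<le> norm (1 :: complex) + norm (exp w)" by (rule norm_triangle_ineq4)
    then show ?thesis using that by simp (smt (verit) exp_le_one_iff)
  qed
  have "Re (Ln (1 - exp (z - of_real u))) \<le> ln 2"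
    using 1[of "z - of_real u"] one_minus_exp_nonzero[OF d] assms by (subst Re_Ln) auto
  moreover have "Re (Ln (1 - exp (- z - of_real u))) \<le> ln 2"
    using 1[of "- z - of_real u"] one_minus_exp_nonzero[OF d] assms by (subst Re_Ln) auto
  ultimately have "exp (Re ((Ln (1 - exp (z - of_real u)) + Ln (1 - exp (- z - of_real u))) / 2)) \<le> exp (ln 2)"
    unfolding exp_le_cancel_iff by simp
  then have "exp (Re ((Ln (1 - exp (z - of_real u)) + Ln (1 - exp (- z - of_real u))) / 2)) \<le> 2"
    by simp
  then show ?thesis
    unfolding amp_def norm_divide norm_exp_eq_Re by (intro divide_right_mono) auto
qed

lemma g_bound_strip:
  assumes \<sigma>: "0 \<le> \<sigma>" "\<sigma> < u"
  shows "\<exists>C>0. \<forall>M>0. \<forall>z. \<bar>Re z\<bar> \<le> \<sigma> \<longrightarrow> norm (g M z) \<le> C * exp (real M * Psi z)"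
proof -
  obtain C where C: "C > 0" and e: "\<And>M z. M > 0 \<Longrightarrow> \<bar>Re z\<bar> \<le> \<sigma> \<Longrightarrow>
    \<exists>e. norm e \<le> C / real M \<and> g M z = exp (V z * of_nat M / \<xi>) * amp z * exp e"
    using g_asymptotics[OF \<sigma>] by blast
  define A where "A = 2 / norm (1 - exp (- of_real u :: complex))"
  have A: "A > 0" using one_minus_exp_u by (simp add: A_def)
  have "norm (g M z) \<le> (A * exp C) * exp (real M * Psi z)" if M: "M > 0" and z: "\<bar>Re z\<bar> \<le> \<sigma>" for M z
  proof -
    obtain e where e: "norm e \<le> C / real M" "g M z = exp (V z * of_nat M / \<xi>) * amp z * exp e"
      using e[OF M z] by blast
    have "C / real M \<le> C / 1" using M C by (intro divide_left_mono) auto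
    then have "Re e \<le> C" using e(1) complex_Re_le_cmod[of e] by simp
    then have ne: "exp (Re e) \<le> exp C" by simp
    have "norm (g M z) = exp (real M * Psi z) * norm (amp z) * exp (Re e)"
      unfolding e(2) norm_mult norm_exp_eq_Re Re_V_M ..
    also have "\<dots> \<le> exp (real M * Psi z) * A * exp C"
      using norm_amp_le[of z] z \<sigma> ne A unfolding A_def
      by (intro mult_mono) (auto intro: less_imp_le)
    finally show ?thesis by (simp add: mult_ac)
  qed
  moreover have "A * exp C > 0" using A by simp
  ultimately show ?thesis by blast
qed

text \<open>The parallelogram spanned by \<open>cr\<close> and (1 - \<open>\<eta>\<close>)
  \<open>\<xi>\<close>. Omitting the top part keeps it a compact subset of \<open>dom\<close>, away
  from the branch point \<open>\<xi>\<close>.\<close>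

definition KK :: "real \<Rightarrow> complex set" where
  "KK \<eta> = (\<lambda>(c, x). of_real c + of_real x * \<xi>) ` ({0..cr} \<times> {0..1-\<eta>})"

lemma KK_subset_dom:
  assumes "0 < \<eta>" shows "KK \<eta> \<subseteq> dom"
proof -
  have "of_real c + of_real x * \<xi> \<in> dom" if "0 \<le> c" "c \<le> cr" "0 \<le> x" "x \<le> 1 - \<eta>" for c x
  proof (cases "x = 0")
    case True
    then show ?thesis using that cr_bounds by (intro dom_strip) auto
  next
    case False
    then show ?thesis using that assms by (intro dom_upper) auto
  qed
  then show ?thesis by (auto simp: KK_def)
qed

lemma compact_KK: "compact (KK \<eta>)"
  unfolding KK_def case_prod_beta by (intro compact_continuous_image compact_Times continuous_intros) auto

lemma convex_KK: "convex (KK \<eta>)"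
proof -
  have "linear (\<lambda>(c, x). of_real c + of_real x * \<xi>)"
    by (rule linearI) (auto simp: algebra_simps scaleR_conv_of_real)
  then show ?thesis unfolding KK_def by (intro convex_linear_image convex_Times) auto
qed

text \<open>Only part of the parallelogram \<open>KK \<eta>\<close> lies in the strip \<open>\<bar>Re z\<bar> < u\<close>. Outside of it, the functional
  equation of \<open>g\<close> is compared step by step with the increments of \<open>V\<close>.\<close>

lemma g_step:
  assumes \<eta>: "0 < \<eta>"
  shows "\<exists>B\<ge>0. \<forall>M>0. \<forall>w. w \<in> KK \<eta> \<and> w + h M \<in> KK \<eta> \<longrightarrow>
    norm (f (w + h M)) \<le> exp (real M * (Psi (w + h M) - Psi w) + B / real M)"
proof -
  have "continuous_on dom (deriv V')"
    by (intro holomorphic_on_imp_continuous_on holomorphic_deriv holomorphic_V' open_dom)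
  then have "compact (deriv V' ` KK \<eta>)"
    by (intro compact_continuous_image compact_KK) (use KK_subset_dom[OF \<eta>] continuous_on_subset in blast)
  then obtain B where B: "B > 0" "\<And>z. z \<in> KK \<eta> \<Longrightarrow> norm (deriv V' z) \<le> B"
    using compact_imp_bounded bounded_pos by (metis (no_types, lifting) image_eqI)
  have "norm (f (w + h M)) \<le> exp (real M * (Psi (w + h M) - Psi w) + (B * norm \<xi>) / real M)"
    if M: "M > 0" and w: "w \<in> KK \<eta>" "w + h M \<in> KK \<eta>" for M w
  proof -
    define F where "F i = (if i = 0 then V else if i = 1 then V' else deriv V')" for i :: nat
    have wd: "w + h M \<in> dom" using w KK_subset_dom[OF \<eta>] by blast
    \<comment> \<open>The expansion is about w + h M because the functional equation contributes f
      at the new point.\<close>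
    have "norm (F 0 w - (\<Sum>i\<le>1. F i (w + h M) * (w - (w + h M)) ^ i / fact i)) \<le> B * norm (w - (w + h M)) ^ Suc 1 / fact 1"
    proof (rule complex_Taylor[OF convex_KK])
      show "(F i has_field_derivative F (Suc i) x) (at x within KK \<eta>)" if "x \<in> KK \<eta>" "i \<le> 1" for i x
      proof -
        have x: "x \<in> dom" using that KK_subset_dom[OF \<eta>] by blast
        have "(F i has_field_derivative F (Suc i) x) (at x)"
          using that has_field_derivative_V[OF x] holomorphic_derivI[OF holomorphic_V' open_dom x]
          by (cases i) (auto simp: F_def)
        then show ?thesis by (rule has_field_derivative_at_within)
      qed
    qed (use w B in \<open>auto simp: F_def\<close>)
    then have "norm (V w - (V (w + h M) - V' (w + h M) * h M)) \<le> B * norm (h M) ^ 2"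
      by (simp add: F_def power2_eq_square)
    then have "norm (V' (w + h M) * h M - (V (w + h M) - V w)) \<le> B * norm (h M) ^ 2"
      by (simp add: algebra_simps)
    then have "norm (V' (w + h M) * h M - (V (w + h M) - V w)) / norm (h M) \<le> (B * norm (h M) ^ 2) / norm (h M)"
      by (intro divide_right_mono) auto
    moreover have h0: "h M \<noteq> 0" using M by (simp add: h_def)
    moreover have "norm (V' (w + h M) - (V (w + h M) / h M - V w / h M)) =
       norm (V' (w + h M) * h M - (V (w + h M) - V w)) / norm (h M)"
      unfolding norm_divide[symmetric] using h0 by (intro arg_cong[of _ _ norm]) (simp add: field_simps)
    ultimately have "norm (V' (w + h M) - (V (w + h M) / h M - V w / h M)) \<le> B * norm (h M)"
      by (simp add: power2_eq_square)
    then have "Re (V' (w + h M) - (V (w + h M) / h M - V w / h M)) \<le> B * norm (h M)"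
      using complex_Re_le_cmod order_trans by blast
    moreover have "V z / h M = V z * of_nat M / \<xi>" for z using M by (simp add: h_def)
    ultimately have "Re (V' (w + h M)) \<le> real M * (Psi (w + h M) - Psi w) + B * norm \<xi> / real M"
      by (simp add: Re_V_M right_diff_distrib h_def norm_divide)
    moreover have "norm (f (w + h M)) = exp (Re (V' (w + h M)))"
      by (simp add: exp_V'[OF wd, symmetric])
    ultimately show ?thesis by simp
  qed
  then show ?thesis using B by (intro exI[of _ "B * norm \<xi>"]) auto
qed

text \<open>Each point is at most M steps h M away from a point b of the strip |Re z| <= 19 u/20:
  for M >= 20 the remainder x' is at most 1/20, and cr + u/20 = 19 u/20. Every step costs a factor
  exp (B / M), so at most exp B in total.\<close>

lemma g_bound_KK:
  assumes \<eta>: "0 < \<eta>" "\<eta> < 1"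
  shows "\<exists>C>0. \<forall>M\<ge>20. \<forall>z\<in>KK \<eta>. norm (g M z) \<le> C * exp (real M * Psi z)"
proof -
  obtain B where B: "B \<ge> 0" and step: "\<And>M w. M > 0 \<Longrightarrow> w \<in> KK \<eta> \<Longrightarrow> w + h M \<in> KK \<eta> \<Longrightarrow>
    norm (f (w + h M)) \<le> exp (real M * (Psi (w + h M) - Psi w) + B / real M)"
    using g_step[OF \<eta>(1)] by blast
  obtain C where C: "C > 0" and strip: "\<And>M z. M > 0 \<Longrightarrow> \<bar>Re z\<bar> \<le> 19 * u / 20 \<Longrightarrow>
    norm (g M z) \<le> C * exp (real M * Psi z)"
    using g_bound_strip[of "19 * u / 20"] u_pos by auto
  have "norm (g M z) \<le> (C * exp B) * exp (real M * Psi z)" if M: "M \<ge> 20" and z: "z \<in> KK \<eta>" for M z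
  proof -
    have M0: "M > 0" using M by simp
    obtain c x where cx: "0 \<le> c" "c \<le> cr" "0 \<le> x" "x \<le> 1 - \<eta>" "z = of_real c + of_real x * \<xi>"
      using z by (auto simp: KK_def)
    define k where "k = nat \<lfloor>x * real M\<rfloor>"
    define x' where "x' = x - real k / real M"
    have k: "real k \<le> x * real M" "x * real M < real k + 1"
      using cx by (auto simp: k_def)
    have x': "0 \<le> x'" "x' \<le> 1 / 20"
    proof -
      show "0 \<le> x'" using k M0 by (simp add: x'_def field_simps)
      have "(x * real M - real k) / real M \<le> 1 / real M" using k by (intro divide_right_mono) auto
      then have "x' \<le> 1 / real M" using M0 by (simp add: x'_def diff_divide_distrib)
      also have "\<dots> \<le> 1 / 20" using M by (intro divide_left_mono) auto
      finally show "x' \<le> 1 / 20" .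
    qed
    define b where "b = of_real c + of_real x' * \<xi>"
    have kM: "real k \<le> real M" using k cx \<eta> by (smt (verit) mult_left_le_one_le of_nat_0_le_iff)
    have pt: "b + of_nat j * h M = of_real c + of_real (x' + real j / real M) * \<xi>" for j
      by (simp add: b_def h_def algebra_simps)
    have inK: "b + of_nat j * h M \<in> KK \<eta>" if "j \<le> k" for j
    proof -
      have "real j / real M \<le> real k / real M" using that by (simp add: divide_right_mono)
      then have "0 \<le> x' + real j / real M" "x' + real j / real M \<le> 1 - \<eta>"
        using x' cx by (auto simp: x'_def)
      then show ?thesis unfolding pt KK_def using cx by force
    qed
    have zk: "z = b + of_nat k * h M"
      unfolding pt by (simp add: x'_def cx)
    have "x' * u \<le> (1 / 20) * u" using x' u_pos by (intro mult_right_mono) auto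
    moreover have "c \<le> 9 * u / 10" using cx by (simp add: cr_def)
    moreover have "Re b = c + x' * u" "0 \<le> x' * u" using x' u_pos by (simp_all add: b_def)
    ultimately have Reb: "0 \<le> Re b" "Re b \<le> 19 * u / 20"
      using cx by linarith+
    have ind: "norm (g M (b + of_nat j * h M)) \<le>
        norm (g M b) * exp (real M * (Psi (b + of_nat j * h M) - Psi b) + real j * (B / real M))"
      if "j \<le> k" for j
      using that
    proof (induction j)
      case (Suc j)
      have e: "b + of_nat (Suc j) * h M = (b + of_nat j * h M) + h M" by (simp add: algebra_simps)
      have "real j / real M \<le> 1" "0 \<le> real j / real M" using Suc.prems kM M0 by (auto simp: field_simps)
      then have "real j / real M * u \<le> 1 * u" "0 \<le> real j / real M * u" 
        using u_pos by (intro mult_right_mono mult_nonneg_nonneg; simp)+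
      moreover have "u / real M \<le> u" using M0 u_pos by (simp add: field_simps)
      moreover have "Re (b + of_nat j * h M) = Re b + real j / real M * u" by (simp add: Re_h)
      ultimately have "- u < Re (b + of_nat j * h M)" "Re (b + of_nat j * h M) + u / real M < 3 * u"
        using Reb u_pos by linarith+
      then have "g M (b + of_nat j * h M + h M) = f (b + of_nat j * h M + h M) * g M (b + of_nat j * h M)"
        by (rule g_shift[OF M0])
      then have "norm (g M (b + of_nat (Suc j) * h M)) =
          norm (f (b + of_nat j * h M + h M)) * norm (g M (b + of_nat j * h M))"
        by (simp only: e norm_mult)
      also have "\<dots> \<le> exp (real M * (Psi (b + of_nat j * h M + h M) - Psi (b + of_nat j * h M)) + B / real M)
         * (norm (g M b) * exp (real M * (Psi (b + of_nat j * h M) - Psi b) + real j * (B / real M)))"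
        using Suc inK[of j] inK[of "Suc j"] unfolding e
        by (intro mult_mono step M0) auto
      also have "\<dots> = norm (g M b) * exp (real M * (Psi (b + of_nat (Suc j) * h M) - Psi b) + real (Suc j) * (B / real M))"
        unfolding e by (simp add: exp_add[symmetric] algebra_simps add_divide_distrib)
      finally show ?case .
    qed simp
    have "norm (g M z) \<le> norm (g M b) * exp (real M * (Psi z - Psi b) + real k * (B / real M))"
      using ind[of k] by (simp only: zk order_refl simp_thms)
    also have "\<dots> \<le> (C * exp (real M * Psi b)) * exp (real M * (Psi z - Psi b) + B)"
    proof (intro mult_mono)
      show "norm (g M b) \<le> C * exp (real M * Psi b)" using Reb by (intro strip M0) auto
      have "real k * (B / real M) \<le> real M * (B / real M)" using kM B by (intro mult_right_mono) auto
      then show "exp (real M * (Psi z - Psi b) + real k * (B / real M)) \<le> exp (real M * (Psi z - Psi b) + B)"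
        using M0 by simp
    qed (use C in auto)
    also have "\<dots> = (C * exp B) * exp (real M * Psi z)"
      by (simp add: exp_add[symmetric] algebra_simps)
    finally show ?thesis .
  qed
  then show ?thesis using C by (intro exI[of _ "C * exp B"]) auto
qed

section \<open>The sum as a contour integral\<close>

lemma holomorphic_rho: "rho d M holomorphic_on A"
  unfolding rho_def by (intro holomorphic_intros)

lemma holomorphic_EE: "EE M holomorphic_on A"
  unfolding EE_def by (intro holomorphic_intros) auto

lemma holomorphic_Phi:
  assumes "M > 0" "A \<subseteq> {z. - u < Re z \<and> Re z < 3 * u}" "\<And>z. z \<in> A \<Longrightarrow> EE M z \<noteq> 1"
  shows "Phi d M holomorphic_on A"
  unfolding Phi_def using assms
  by (intro holomorphic_intros holomorphic_rho holomorphic_EE holomorphic_on_subset[OF holomorphic_g]) auto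

lemma EE_grid: "M > 0 \<Longrightarrow> EE M (of_int k * h M) = 1"
  using EE_eq_1_iff by blast

text \<open>At a grid point E - 1 has a simple zero with derivative 2 pi i / h, so the pole is at
  most simple.\<close>

lemma residue_Phi:
  assumes M: "M > 0" and k: "- u < real_of_int k * u / real M" "real_of_int k * u / real M < 3 * u"
  shows "2 * of_real pi * \<i> * residue (Phi d M) (of_int k * h M) =
    h M * (rho d M (of_int k * h M) * g M (of_int k * h M))"
proof -
  define z where "z = of_int k * h M"
  define D where "D = 2 * of_real pi * \<i> * of_nat M / \<xi>"
  have D: "D \<noteq> 0" using M by (simp add: D_def)
  define S where "S = {z. - u < Re z \<and> Re z < 3 * u}"
  have zS: "z \<in> S" using k by (simp add: z_def S_def Re_h)
  have S: "open S"
    unfolding S_def by (auto intro!: open_Collect_conj open_Collect_less continuous_intros)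
  have "(EE M has_field_derivative D * EE M z) (at z)" unfolding D_def by (rule EE_derivative)
  then have der: "((\<lambda>w. (EE M w - 1) / (w - z)) \<longlongrightarrow> D) (at z)"
    using EE_grid[OF M, of k] by (simp add: has_field_derivative_iff z_def)
  have cont: "isCont (\<lambda>w. rho d M w * g M w) z"
    using holomorphic_on_mult[OF holomorphic_rho[of d M S] holomorphic_g[OF M, folded S_def]] S zS
    by (meson continuous_on_eq_continuous_at holomorphic_on_imp_continuous_on)
  have lim: "((\<lambda>w. Phi d M w * (w - z)) \<longlongrightarrow> rho d M z * g M z / D) (at z)"
  proof (rule Lim_transform_eventually)
    show "((\<lambda>w. rho d M w * g M w / ((EE M w - 1) / (w - z))) \<longlongrightarrow> rho d M z * g M z / D) (at z)"
      using cont der D unfolding isCont_def by (intro tendsto_divide)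
    show "\<forall>\<^sub>F w in at z. rho d M w * g M w / ((EE M w - 1) / (w - z)) = Phi d M w * (w - z)"
      by (auto simp: Phi_def eventually_at_filter)
  qed
  have ev: "\<forall>\<^sub>F w in at z. EE M w \<noteq> 1"
  proof -
    have "\<forall>\<^sub>F w in at z. (EE M w - 1) / (w - z) \<noteq> 0"
      using der D by (rule tendsto_imp_eventually_ne)
    then show ?thesis by eventually_elim auto
  qed
  then obtain T where T: "open T" "z \<in> T" "\<And>w. w \<in> T \<Longrightarrow> w \<noteq> z \<Longrightarrow> EE M w \<noteq> 1"
    unfolding eventually_at_topological by blast
  have "residue (Phi d M) z = rho d M z * g M z / D"
  proof (rule residue_simple'[OF _ _ _ lim])
    show "open (S \<inter> T)" "z \<in> S \<inter> T" using S T zS by auto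
    show "Phi d M holomorphic_on S \<inter> T - {z}"
      by (rule holomorphic_Phi[OF M]) (use T in \<open>auto simp: S_def\<close>)
  qed
  moreover have "2 * of_real pi * \<i> / D = h M"
    using M by (simp add: D_def h_def)
  ultimately show ?thesis
    unfolding z_def[symmetric] by (metis mult.commute times_divide_eq_left times_divide_eq_right)
qed

text \<open>Half the vertical grid spacing, midway between k = 0 and k = 1; likewise
  \<open>ytop k1\<close> is midway between k1 - 1 and k1. The point k = 0 lies on the imaginary axis
  and stays outside the contour.\<close>

definition ybot :: "nat \<Rightarrow> real" where "ybot M = pi / real M"

definition xtop :: "nat \<Rightarrow> nat \<Rightarrow> real" where "xtop k1 M = (real k1 - 1 / 2) / real M"

definition ytop :: "nat \<Rightarrow> nat \<Rightarrow> real" where "ytop k1 M = 2 * pi * xtop k1 M"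

lemma Re_grid: "Re (of_int k * h M) = real_of_int k * u / real M"
  and Im_grid: "Im (of_int k * h M) = 2 * pi * real_of_int k / real M"
  by (simp_all add: Re_h Im_h)

lemma rect_integral:
  assumes M: "M > 0" and k1: "2 \<le> k1" "k1 \<le> M"
  shows "contour_integral (rectpath (Complex 0 (ybot M)) (Complex (cr + u * xtop k1 M) (ytop k1 M))) (Phi d M) =
    h M * (\<Sum>k=1..<k1. summand d M k)"
proof -
  define c1 where "c1 = cr + u * xtop k1 M"
  define a1 a3 where "a1 = Complex 0 (ybot M)" and "a3 = Complex c1 (ytop k1 M)"
  define S where "S = {z. - u < Re z \<and> Re z < 3 * u}"
  \<comment> \<open>A finite set containing every pole in the strip \<open>S\<close>, as the residue
    theorem requires. Those outside the rectangle have winding number 0.\<close>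
  define pts where "pts = (\<lambda>k::int. of_int k * h M) ` {- int M..3 * int M}"
  have xt: "0 < xtop k1 M" "xtop k1 M < 1"
    using k1 M by (auto simp: xtop_def field_simps)
  have c1: "0 < c1" "c1 < 2 * u"
    using cr_bounds mult_strict_left_mono[OF xt(2) u_pos] mult_pos_pos[OF u_pos xt(1)]
    unfolding c1_def by linarith+
  have yy: "ybot M < ytop k1 M"
  proof -
    have "1 < 2 * (real k1 - 1 / 2)" using k1 by simp
    then have "pi * 1 / real M < pi * (2 * (real k1 - 1 / 2)) / real M"
      using M by (intro divide_strict_right_mono mult_strict_left_mono) auto
    moreover have "pi * (2 * (real k1 - 1 / 2)) / real M = 2 * pi * ((real k1 - 1 / 2) / real M)"
      by simp
    ultimately show ?thesis by (simp only: ybot_def ytop_def xtop_def mult_1_right)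
  qed
  have S: "open S" "convex S"
  proof -
    have "S = {z. - u < Re z} \<inter> {z. Re z < 3 * u}" by (auto simp: S_def)
    then show "open S" "convex S"
      by (auto intro!: open_Int convex_Int open_halfspace_Re_gt open_halfspace_Re_lt
          convex_halfspace_Re_gt convex_halfspace_Re_lt)
  qed
  have inpts: "z \<in> pts" if z: "EE M z = 1" "z \<in> S" for z
  proof -
    obtain k :: int where k: "z = of_int k * h M" using z(1) unfolding EE_eq_1_iff[OF M] by auto
    have "Re z = real_of_int k * u / real M" unfolding k by (rule Re_grid)
    moreover have "- u < Re z" "Re z < 3 * u" using that(2) by (simp_all add: S_def)
    ultimately have "- u < real_of_int k * u / real M" "real_of_int k * u / real M < 3 * u" by simp_all
    moreover have "real M > 0" using M by simp
    ultimately have "u * - real M < u * real_of_int k" "u * real_of_int k < u * (3 * real M)"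
      by (simp_all only: pos_less_divide_eq pos_divide_less_eq) (simp_all add: mult_ac)
    then have "- real M < real_of_int k" "real_of_int k < 3 * real M"
      using u_pos by (simp_all only: mult_less_cancel_left_pos)
    then have "k \<in> {- int M..3 * int M}" by auto
    then show ?thesis by (auto simp: pts_def k)
  qed
  have Im_lt: "2 * pi * x / real M < 2 * pi * y / real M \<longleftrightarrow> x < y" for x y
    using M by (simp add: divide_less_cancel)
  have yb': "ybot M = 2 * pi * (1 / 2) / real M" and yt': "ytop k1 M = 2 * pi * (real k1 - 1 / 2) / real M"
    by (simp_all add: ybot_def ytop_def xtop_def)
  have Im_iff: "ybot M < Im (of_int k * h M) \<longleftrightarrow> k \<ge> 1" "Im (of_int k * h M) < ytop k1 M \<longleftrightarrow> k < int k1" for k :: int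
    unfolding Im_grid yb' yt' Im_lt by linarith+
  have Im_iff': "ybot M \<le> Im (of_int k * h M) \<longleftrightarrow> k \<ge> 1" "Im (of_int k * h M) \<le> ytop k1 M \<longleftrightarrow> k < int k1" for k :: int
    unfolding Im_grid yb' yt' not_less[symmetric] Im_lt by linarith+
  have Re_in: "0 < Re (of_int k * h M)" "Re (of_int k * h M) < c1" if "1 \<le> k" "k < int k1" for k
  proof -
    show "0 < Re (of_int k * h M)" unfolding Re_grid using that M u_pos by (intro divide_pos_pos mult_pos_pos) auto
    have "real_of_int k - 1 / 2 \<le> real k1 - 1 / 2" "real_of_int k \<le> real k1 - 1" using that by linarith+
    then have "u * (real_of_int k / real M) \<le> u * xtop k1 M"
      unfolding xtop_def using u_pos by (intro mult_left_mono divide_right_mono) auto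
    then show "Re (of_int k * h M) < c1" unfolding Re_grid c1_def using cr_bounds by (simp add: mult.commute)
  qed
  have a13: "Re a1 \<le> Re a3" "Im a1 \<le> Im a3" using c1 yy by (auto simp: a1_def a3_def)
  have cboxS: "cbox a1 a3 \<subseteq> S"
    using c1 u_pos by (auto simp: in_cbox_complex_iff S_def a1_def a3_def)
  have box_iff: "of_int k * h M \<in> box a1 a3 \<longleftrightarrow> 1 \<le> k \<and> k < int k1" for k :: int
    using Re_in[of k] Im_iff[of k] by (auto simp: in_box_complex_iff a1_def a3_def simp del: times_complex.sel)
  have cbox_iff: "of_int k * h M \<in> cbox a1 a3 \<longleftrightarrow> 1 \<le> k \<and> k < int k1" for k :: int
    using Re_in[of k] Im_iff'[of k] by (auto simp: in_cbox_complex_iff a1_def a3_def simp del: times_complex.sel)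
  have disj: "path_image (rectpath a1 a3) \<subseteq> S - pts"
  proof -
    have "path_image (rectpath a1 a3) = cbox a1 a3 - box a1 a3"
      using path_image_rectpath_cbox_minus_box[OF a13] .
    then show ?thesis using cboxS box_iff cbox_iff by (auto simp: pts_def)
  qed
  have "contour_integral (rectpath a1 a3) (Phi d M) =
     2 * pi * \<i> * (\<Sum>p\<in>pts. winding_number (rectpath a1 a3) p * residue (Phi d M) p)"
  proof (rule Residue_theorem[OF S(1) convex_connected[OF S(2)]])
    show "finite pts" by (simp add: pts_def)
    show "Phi d M holomorphic_on S - pts"
      by (rule holomorphic_Phi[OF M]) (use inpts in \<open>auto simp: S_def\<close>)
    show "\<forall>z. z \<notin> S \<longrightarrow> winding_number (rectpath a1 a3) z = 0"
      using winding_number_rectpath_outside[OF a13] cboxS by blast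
  qed (use disj in auto)
  also have "(\<Sum>p\<in>pts. winding_number (rectpath a1 a3) p * residue (Phi d M) p) =
    (\<Sum>k\<in>{- int M..3 * int M}. winding_number (rectpath a1 a3) (of_int k * h M) * residue (Phi d M) (of_int k * h M))"
    unfolding pts_def
  proof (rule sum.reindex_cong[OF _ refl refl])
    have "h M \<noteq> 0" using M by (simp add: h_def)
    then show "inj_on (\<lambda>k::int. of_int k * h M) {- int M..3 * int M}" by (auto simp: inj_on_def)
  qed
  also have "\<dots> = (\<Sum>k\<in>{1..<int k1}. residue (Phi d M) (of_int k * h M))"
  proof (rule sum.mono_neutral_cong_right)
    show "{1..<int k1} \<subseteq> {- int M..3 * int M}" using k1 by auto
    show "\<forall>k\<in>{- int M..3 * int M} - {1..<int k1}.
       winding_number (rectpath a1 a3) (of_int k * h M) * residue (Phi d M) (of_int k * h M) = 0"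
    proof
      fix k assume "k \<in> {- int M..3 * int M} - {1..<int k1}"
      then have "\<not> (1 \<le> k \<and> k < int k1)" by simp
      then have "of_int k * h M \<notin> cbox a1 a3" by (simp only: cbox_iff not_False_eq_True)
      from winding_number_rectpath_outside[OF a13 this]
      show "winding_number (rectpath a1 a3) (of_int k * h M) * residue (Phi d M) (of_int k * h M) = 0"
        by simp
    qed
    show "winding_number (rectpath a1 a3) (of_int k * h M) * residue (Phi d M) (of_int k * h M) =
      residue (Phi d M) (of_int k * h M)" if "k \<in> {1..<int k1}" for k
    proof -
      have "1 \<le> k \<and> k < int k1" using that by simp
      then have "of_int k * h M \<in> box a1 a3" by (simp only: box_iff)
      from winding_number_rectpath[OF this] show ?thesis by simp
    qed
  qed auto
  also have "\<dots> = (\<Sum>k=1..<k1. residue (Phi d M) (of_nat k * h M))"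
    by (rule sum.reindex_bij_witness[of _ int nat]) auto
  also have "2 * pi * \<i> * \<dots> = (\<Sum>k=1..<k1. h M * summand d M k)"
    unfolding sum_distrib_left
  proof (rule sum.cong[OF refl])
    fix k assume k: "k \<in> {1..<k1}"
    have "real k * u / real M \<ge> 0" using u_pos by simp
    moreover have "real k * u / real M \<le> u"
      using k k1 M u_pos by (simp add: field_simps)
    ultimately have "- u < real k * u / real M" "real k * u / real M < 3 * u" using u_pos by linarith+
    then show "2 * pi * \<i> * residue (Phi d M) (of_nat k * h M) =
      h M * summand d M k"
      using residue_Phi[OF M, of "int k" d] by simp
  qed
  finally show ?thesis
    unfolding a1_def a3_def c1_def by (simp add: sum_distrib_left)
qed

text \<open>The lower right corner of the rectangle is cut off along the segment from A to C,
  parallel to \<open>\<xi>\<close>, on which |E| is constant. The removed triangle lies to the right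
  of the line through 0 and \<open>\<xi>\<close> and so contains no pole.\<close>

lemma contour_formula:
  assumes M: "M > 0" and k1: "2 \<le> k1" "k1 \<le> M"
  defines "A \<equiv> Complex (cr + u / (2 * real M)) (ybot M)"
    and "C \<equiv> Complex (cr + u * xtop k1 M) (ytop k1 M)"
  shows "h M * (\<Sum>k=1..<k1. summand d M k) =
     line_int d M (Complex 0 (ybot M)) A +
     line_int d M A C +
     line_int d M C (Complex 0 (ytop k1 M)) -
     line_int d M (Complex 0 (ybot M)) (Complex 0 (ytop k1 M))"
    and "Phi d M contour_integrable_on linepath (Complex 0 (ybot M)) A"
    and "Phi d M contour_integrable_on linepath A C"
    and "Phi d M contour_integrable_on linepath C (Complex 0 (ytop k1 M))"
    and "Phi d M contour_integrable_on linepath (Complex 0 (ybot M)) (Complex 0 (ytop k1 M))"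
proof -
  define P where "P = Complex 0 (ybot M)"
  define Q where "Q = Complex 0 (ytop k1 M)"
  define B where "B = Complex (cr + u * xtop k1 M) (ybot M)"
  have xt: "1 / (2 * real M) < xtop k1 M" "xtop k1 M < 1"
    using k1 M by (auto simp: xtop_def field_simps)
  then have xt0: "0 < xtop k1 M" using M by (smt (verit) of_nat_0_less_iff zero_less_divide_iff)
  have uxt: "u * (1 / (2 * real M)) < u * xtop k1 M" "u * xtop k1 M < u" "0 < u / (2 * real M)"
    using mult_strict_left_mono[OF xt(1) u_pos] mult_strict_left_mono[OF xt(2) u_pos] u_pos M by simp_all
  have yy: "0 < ybot M" "ybot M < ytop k1 M"
    using xt M mult_strict_left_mono[OF xt(1), of "2 * pi"] by (auto simp: ybot_def ytop_def)
  define S where "S = {z. - u < Re z \<and> Re z < 3 * u}"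
  define T where "T = S - {z. EE M z = 1}"
  have holT: "Phi d M holomorphic_on T"
    by (rule holomorphic_Phi[OF M]) (auto simp: T_def S_def)
  have offline: "EE M z \<noteq> 1" if "2 * pi * Re z \<noteq> u * Im z" for z
  proof
    assume "EE M z = 1"
    then obtain k :: int where "z = of_int k * h M" using EE_eq_1_iff[OF M] by blast
    then show False using that M by (simp add: Re_h Im_h)
  qed
  have offhalf: "EE M z \<noteq> 1" if "z = (of_int m - 1 / 2) * h M + of_real t" for z m t
    using norm_EE_minus_1_half(1)[OF M that] by auto
  have seg: "closed_segment a b \<subseteq> T" if "a \<in> S" "b \<in> S" "Im a = Im b" "Im a = ybot M \<or> Im a = ytop k1 M" for a b
  proof
    fix z assume z: "z \<in> closed_segment a b"
    then have Im: "Im z = Im a" using that by (auto simp: closed_segment_same_Im)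
    have "convex S"
    proof -
      have "S = {z. - u < Re z} \<inter> {z. Re z < 3 * u}" by (auto simp: S_def)
      then show ?thesis by (auto intro!: convex_Int convex_halfspace_Re_gt convex_halfspace_Re_lt)
    qed
    then have "z \<in> S" using z that convex_contains_segment by blast
    moreover have "EE M z \<noteq> 1"
      using that(4)
    proof
      assume y: "Im a = ybot M"
      show ?thesis
      proof (rule offhalf)
        show "z = (of_int 1 - 1 / 2) * h M + of_real (Re z - u / (2 * real M))"
          using Im y by (simp add: complex_eq_iff Re_h Im_h ybot_def)
      qed
    next
      assume y: "Im a = ytop k1 M"
      show ?thesis
      proof (rule offhalf)
        show "z = (of_int (int k1) - 1 / 2) * h M + of_real (Re z - u * xtop k1 M)"
          using Im y by (simp add: complex_eq_iff Re_h Im_h ytop_def xtop_def)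
      qed
    qed
    ultimately show "z \<in> T" by (simp add: T_def)
  qed
  \<comment> \<open>All poles lie on the line through 0 and \<open>\<xi>\<close>. This convex part
    of the open half plane to its right contains the triangle.\<close>
  define H where "H = {z. Re z < 3 * u \<and> - u < Re z \<and> u * Im z < 2 * pi * Re z}"
  have HT: "H \<subseteq> T" using offline by (auto simp: H_def T_def S_def)
  have convH: "convex H"
  proof -
    have "H = {z. Re z < 3 * u} \<inter> {z. - u < Re z} \<inter> {z. inner (Complex (- 2 * pi) u) z < 0}"
      by (auto simp: H_def inner_complex_def)
    then show ?thesis
      by (auto intro!: convex_Int convex_halfspace_Re_gt convex_halfspace_Re_lt convex_halfspace_lt)
  qed
  have inH: "A \<in> H" "B \<in> H" "C \<in> H"
  proof -
    have 1: "u * ybot M = 2 * pi * (u / (2 * real M))" "u * ytop k1 M = 2 * pi * (u * xtop k1 M)"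
      by (simp_all add: ybot_def ytop_def)
    have c: "2 * pi * cr > 0" using cr_bounds by simp
    have "2 * pi * (u / (2 * real M)) < 2 * pi * (cr + u * xtop k1 M)"
      using uxt cr_bounds by (intro mult_strict_left_mono) auto
    moreover have "cr + u / (2 * real M) < 3 * u" "cr + u * xtop k1 M < 3 * u"
      "- u < cr + u / (2 * real M)" "- u < cr + u * xtop k1 M"
      using uxt cr_bounds u_pos unfolding mult_1_right times_divide_eq_right by linarith+
    moreover have "2 * pi * (u / (2 * real M)) < 2 * pi * (cr + u / (2 * real M))"
      "2 * pi * (u * xtop k1 M) < 2 * pi * (cr + u * xtop k1 M)"
      using cr_bounds by (intro mult_strict_left_mono; simp)+
    ultimately show "A \<in> H" "B \<in> H" "C \<in> H"
      by (simp_all only: H_def A_def B_def C_def 1 mem_Collect_eq complex.sel simp_thms)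
  qed
  have hullH: "convex hull {A, B, C} \<subseteq> H" using inH convH by (intro hull_minimal) auto
  have tri: "(Phi d M has_contour_integral 0) (linepath A B +++ linepath B C +++ linepath C A)"
    by (intro Cauchy_theorem_triangle holomorphic_on_subset[OF holT]) (use hullH HT in auto)
  have int: "Phi d M contour_integrable_on linepath a b" if "closed_segment a b \<subseteq> T" for a b
    using that by (intro contour_integrable_continuous_linepath continuous_on_subset[OF holomorphic_on_imp_continuous_on[OF holT]])
  have segH: "closed_segment a b \<subseteq> T" if "a \<in> H" "b \<in> H" for a b
    using that HT convH convex_contains_segment by blast
  have PS: "P \<in> S" "Q \<in> S" "A \<in> S" "B \<in> S" "C \<in> S"
    using inH u_pos by (auto simp: P_def Q_def S_def H_def)
  have sPQ: "closed_segment P Q \<subseteq> T"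
  proof
    fix z assume "z \<in> closed_segment P Q"
    then have "Re z = 0" "Im z \<in> closed_segment (ybot M) (ytop k1 M)"
      by (auto simp: P_def Q_def closed_segment_same_Re)
    then have "Re z = 0" "Im z > 0" using yy by (auto simp: closed_segment_eq_real_ivl)
    then show "z \<in> T" using offline[of z] u_pos by (auto simp: T_def S_def)
  qed
  have iPA: "Phi d M contour_integrable_on linepath P A"
    and iPB: "Phi d M contour_integrable_on linepath P B"
    and iAB: "Phi d M contour_integrable_on linepath A B"
    and iCQ: "Phi d M contour_integrable_on linepath C Q"
    by (intro int seg; use PS in \<open>simp add: P_def Q_def A_def B_def C_def\<close>)+
  have iAC: "Phi d M contour_integrable_on linepath A C"
    and iBC: "Phi d M contour_integrable_on linepath B C"
    and iCA: "Phi d M contour_integrable_on linepath C A"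
    by (intro int segH inH)+
  have iPQ: "Phi d M contour_integrable_on linepath P Q"
    and iQP: "Phi d M contour_integrable_on linepath Q P"
    using int[OF sPQ] int[of Q P] sPQ unfolding closed_segment_commute[of Q P] by simp_all
  have t0: "line_int d M A B + line_int d M B C
      + line_int d M C A = 0"
    using contour_integral_unique[OF tri] iAB iBC iCA by (simp add: algebra_simps)
  have rev: "line_int d M C A = - line_int d M A C"
    "line_int d M Q P = - line_int d M P Q"
    using contour_integral_reversepath[of "linepath A C" "Phi d M"]
      contour_integral_reversepath[of "linepath P Q" "Phi d M"] by simp_all
  have split: "line_int d M P B =
      line_int d M P A + line_int d M A B"
  proof (rule contour_integral_split_linepath)
    show "continuous_on (closed_segment P B) (Phi d M)"
    proof -
      have "closed_segment P B \<subseteq> T"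
        using PS by (intro seg) (auto simp: P_def B_def)
      then show ?thesis using continuous_on_subset[OF holomorphic_on_imp_continuous_on[OF holT]] by blast
    qed
    show "A \<in> closed_segment P B"
      using uxt cr_bounds
      by (auto simp: P_def A_def B_def closed_segment_same_Im closed_segment_eq_real_ivl)
  qed
  have rect: "rectpath P C = linepath P B +++ linepath B C +++ linepath C Q +++ linepath Q P"
    by (simp add: rectpath_def Let_def P_def B_def C_def Q_def)
  have "contour_integral (rectpath P C) (Phi d M) =
      line_int d M P B + line_int d M B C
      + line_int d M C Q + line_int d M Q P"
    unfolding rect using iPB iBC iCQ iQP by (simp add: add.assoc)
  also have "\<dots> = line_int d M P A
      + (line_int d M A B + line_int d M B C)
      + line_int d M C Q - line_int d M P Q"
    unfolding split rev(2) by simp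
  also have "line_int d M A B + line_int d M B C
      = line_int d M A C"
    using t0 rev(1) by simp
  finally show "h M * (\<Sum>k=1..<k1. summand d M k) =
     line_int d M (Complex 0 (ybot M)) A +
     line_int d M A C +
     line_int d M C (Complex 0 (ytop k1 M)) -
     line_int d M (Complex 0 (ybot M)) (Complex 0 (ytop k1 M))"
    using rect_integral[OF M k1, of d]
    unfolding P_def[symmetric] Q_def[symmetric] C_def[symmetric] by simp
  show "Phi d M contour_integrable_on linepath (Complex 0 (ybot M)) A"
    "Phi d M contour_integrable_on linepath A C"
    "Phi d M contour_integrable_on linepath C (Complex 0 (ytop k1 M))"
    "Phi d M contour_integrable_on linepath (Complex 0 (ybot M)) (Complex 0 (ytop k1 M))"
    using iPA iAC iCQ iPQ by (simp_all add: P_def Q_def)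
qed

section \<open>The remaining sides of the contour and the tail of the sum\<close>

lemma f_xi: "f \<xi> = 0"
proof -
  have "exp (\<xi> - of_real u) = 1" by (simp add: \<xi>_def)
  then show ?thesis by (simp add: f_def)
qed

text \<open>Serves the grid points that the contour does not reach: there the products f(h) ... f(k
  h) no longer grow in modulus.\<close>

lemma norm_f_near_xi: "\<exists>r>0. \<forall>z. norm (z - \<xi>) < r \<longrightarrow> norm (f z) \<le> 1"
proof -
  have "isCont f \<xi>" unfolding f_def by (intro continuous_intros)
  then have "\<exists>r>0. \<forall>z. dist z \<xi> < r \<longrightarrow> dist (f z) (f \<xi>) < 1"
    unfolding continuous_at_eps_delta by (auto simp: dist_norm)
  then show ?thesis by (auto simp: f_xi dist_norm intro: less_imp_le)
qed

text \<open>Everything but the left side is smaller than the peak by a factor of order exp (-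
  \<open>\<delta>\<close> M): the summand k = 0, the bottom, slanted and top sides, and the summands
  from k1 on. The level y1 keeps the peak inside the left side.\<close>

lemma sum_approx:
  "\<exists>k1 :: nat \<Rightarrow> nat. \<exists>\<delta>>0. \<exists>C>0. \<exists>M0. \<exists>y1>ys. \<forall>M\<ge>M0.
     0 < M \<and> 2 \<le> k1 M \<and> k1 M \<le> M \<and> y1 \<le> ytop (k1 M) M \<and> ytop (k1 M) M < 2 * pi \<and>
     Phi d M contour_integrable_on linepath (Complex 0 (ybot M)) (Complex 0 (ytop (k1 M) M)) \<and>
     norm (h M * (\<Sum>k<M. summand d M k)
       + line_int d M (Complex 0 (ybot M)) (Complex 0 (ytop (k1 M) M)))
     \<le> C * exp (real M * (X - \<delta>))"
proof -
  obtain R where R: "R > 0" and rho: "\<And>M z. d \<le> M \<Longrightarrow> 0 < M \<Longrightarrow> 0 \<le> Re z \<Longrightarrow> Re z \<le> 2 * u \<Longrightarrow> norm (rho d M z) \<le> R"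
    using rho_bound[of d] by blast
  obtain y0 where y0: "y0 > 0" and bottom: "\<And>y t. 0 < y \<Longrightarrow> y < y0 \<Longrightarrow> 0 \<le> t \<Longrightarrow> t \<le> u \<Longrightarrow> Psi (Complex t y) \<le> X - u / nx"
    using Psi_bottom by blast
  obtain et dt where et: "et > 0" and dt: "dt > 0" and top: "\<And>y t. 2 * pi - et < y \<Longrightarrow> y < 2 * pi \<Longrightarrow> 0 \<le> t \<Longrightarrow> t \<le> u \<Longrightarrow> Psi (Complex t y) \<le> X - dt"
    using Psi_top by blast
  obtain r where r: "r > 0" and fr: "\<And>z. norm (z - \<xi>) < r \<Longrightarrow> norm (f z) \<le> 1"
    using norm_f_near_xi by blast
  \<comment> \<open>In this order: k1 is at least 2, the top side is in the range of
    \<open>Psi_top\<close>, it lies above \<open>ys\<close>, and the grid points from k1 to M are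
    within r of \<open>\<xi>\<close>.\<close>
  define \<epsilon> where "\<epsilon> = min (1 / 4) (min (et / (8 * pi)) (min (\<theta> / (8 * pi)) (r / (2 * norm \<xi>))))"
  have \<epsilon>: "0 < \<epsilon>" "\<epsilon> \<le> 1 / 4" "4 * pi * \<epsilon> < et" "4 * pi * \<epsilon> < \<theta>" "\<epsilon> * norm \<xi> < r"
  proof -
    show "0 < \<epsilon>" using et theta_bounds r by (auto simp: \<epsilon>_def)
    show "\<epsilon> \<le> 1 / 4" by (simp add: \<epsilon>_def)
    have "\<epsilon> \<le> et / (8 * pi)" "\<epsilon> \<le> \<theta> / (8 * pi)" "\<epsilon> \<le> r / (2 * norm \<xi>)" by (auto simp: \<epsilon>_def)
    then have "8 * pi * \<epsilon> \<le> et" "8 * pi * \<epsilon> \<le> \<theta>" "2 * (\<epsilon> * norm \<xi>) \<le> r"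
      by (simp_all add: field_simps)
    then show "4 * pi * \<epsilon> < et" "4 * pi * \<epsilon> < \<theta>" "\<epsilon> * norm \<xi> < r"
      using et theta_bounds r by linarith+
  qed
  \<comment> \<open>The other half of \<open>\<epsilon>\<close> pays for rounding up in
    \<open>k1\<close>: for M >= 2/\<open>\<epsilon>\<close> one has k1 <= (1 -
    \<open>\<eta>\<close>) M.\<close>
  define \<eta> where "\<eta> = \<epsilon> / 2"
  have \<eta>: "0 < \<eta>" "\<eta> < 1" using \<epsilon> by (auto simp: \<eta>_def)
  \<comment> \<open>19 u/20 serves the bottom side, u (1 - \<open>\<eta>\<close>) the part of the
    top side left of the line through \<open>\<xi>\<close>.\<close>
  obtain C1 where C1: "C1 > 0" and strip: "\<And>M z. M > 0 \<Longrightarrow> \<bar>Re z\<bar> \<le> max (19 * u / 20) (u * (1 - \<eta>)) \<Longrightarrow>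
      norm (g M z) \<le> C1 * exp (real M * Psi z)"
  proof -
    have "0 \<le> max (19 * u / 20) (u * (1 - \<eta>))" "max (19 * u / 20) (u * (1 - \<eta>)) < u"
      using u_pos \<eta> by (simp_all add: le_max_iff_disj)
    from g_bound_strip[OF this] show ?thesis using that by blast
  qed
  obtain C2 where C2: "C2 > 0" and para: "\<And>M z. M \<ge> 20 \<Longrightarrow> z \<in> KK \<eta> \<Longrightarrow> norm (g M z) \<le> C2 * exp (real M * Psi z)"
    using g_bound_KK[OF \<eta>] by blast
  define Cg where "Cg = max C1 C2"
  have Cg: "Cg > 0" "C1 \<le> Cg" "C2 \<le> Cg" using C1 by (auto simp: Cg_def)
  define \<delta> where "\<delta> = min dt (u / nx)"
  have \<delta>: "\<delta> > 0" "\<delta> \<le> dt" "\<delta> \<le> u / nx" using dt u_pos nx_pos by (auto simp: \<delta>_def)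
  \<comment> \<open>Makes exp (M (X - \<open>\<delta>\<close>)) at least 1, which absorbs the
    bounded summand k = 0.\<close>
  have X\<delta>: "X - \<delta> \<ge> 0"
  proof -
    have "u / nx \<le> 4 * pi ^ 2 * u / nx"
      using pi_sq_gt_9 u_pos less_imp_le[OF nx_pos] by (intro divide_right_mono) auto
    then show ?thesis using X_gt \<delta> by linarith
  qed
  define k1 where "k1 M = nat \<lceil>(1 - \<epsilon>) * real M\<rceil>" for M
  \<comment> \<open>In this order, for: \<open>g_bound_KK\<close>, the rounding in
    \<open>k1\<close>, \<open>ybot\<close> below y0, \<open>rho_bound\<close>, and |E| >= 2 on the
    slanted side.\<close>
  obtain M0 :: nat where M0: "real M0 \<ge> 20" "real M0 \<ge> 2 / \<epsilon>" "real M0 > pi / y0" "real M0 \<ge> real d"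
      "real M0 \<ge> nx / (4 * pi ^ 2 * cr)"
    using real_arch_simple[of "Max {20, 2 / \<epsilon>, pi / y0 + 1, real d, nx / (4 * pi ^ 2 * cr)}"] by auto
  define Ctot where "Ctot = 2 * R * Cg * u + 2 * R * Cg * norm \<xi> + 2 * R * Cg * (2 * u) + norm \<xi> * (R + R * Cg)"
  have Ctot: "Ctot > 0"
    using R Cg u_pos by (auto simp: Ctot_def intro!: add_pos_nonneg add_pos_pos mult_pos_pos mult_nonneg_nonneg)
  have main: "0 < M \<and> 2 \<le> k1 M \<and> k1 M \<le> M \<and> 2 * pi * (1 - 2 * \<epsilon>) \<le> ytop (k1 M) M \<and> ytop (k1 M) M < 2 * pi \<and>
     Phi d M contour_integrable_on linepath (Complex 0 (ybot M)) (Complex 0 (ytop (k1 M) M)) \<and>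
     norm (h M * (\<Sum>k<M. summand d M k)
       + line_int d M (Complex 0 (ybot M)) (Complex 0 (ytop (k1 M) M)))
     \<le> Ctot * exp (real M * (X - \<delta>))" if "M \<ge> M0" for M
  proof -
    have M: "real M \<ge> 20" "real M \<ge> 2 / \<epsilon>" "real M > pi / y0" "d \<le> M" "real M \<ge> nx / (4 * pi ^ 2 * cr)"
      using M0 that by (simp_all add: of_nat_mono order.trans[OF M0(1)] order.trans[OF M0(2)] order.trans[OF M0(5)]
          order.strict_trans2[OF M0(3)])
    have Mp: "M > 0" "real M > 0" using M by auto
    define K where "K = k1 M"
    define x1 where "x1 = xtop K M"
    define e where "e = exp (real M * (X - \<delta>))"
    have e: "e \<ge> 1" using X\<delta> by (simp add: e_def)
    have Me: "\<epsilon> * real M \<ge> 2" using M(2) \<epsilon> by (simp add: field_simps)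
    have Klo: "(1 - \<epsilon>) * real M \<le> real K" and Khi: "real K < (1 - \<epsilon>) * real M + 1"
      using \<epsilon> by (auto simp: K_def k1_def of_nat_ceiling) linarith+
    have Khi': "real K \<le> (1 - \<eta>) * real M" using Khi Me by (simp add: \<eta>_def algebra_simps)
    have "(3 / 4) * real M \<le> (1 - \<epsilon>) * real M" using \<epsilon> Mp by (intro mult_right_mono) auto
    then have K2: "2 \<le> K" using Klo M by linarith
    have "(1 - \<eta>) * real M \<le> 1 * real M" using \<eta> by (intro mult_right_mono) auto
    then have KM: "K \<le> M" using Khi' by linarith
    have x1: "0 < x1" "x1 \<le> 1 - \<eta>" "1 - 2 * \<epsilon> \<le> x1" "1 / (2 * real M) < x1"
    proof -
      show "x1 \<le> 1 - \<eta>" using Khi' Mp by (simp add: x1_def xtop_def field_simps)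
      show "1 - 2 * \<epsilon> \<le> x1" using Klo Me Mp by (simp add: x1_def xtop_def field_simps)
      show "1 / (2 * real M) < x1" using K2 Mp by (simp add: x1_def xtop_def field_simps)
      then show "0 < x1" using Mp by (smt (verit) zero_less_divide_iff)
    qed
    define yt where "yt = ytop K M"
    have yt: "yt = 2 * pi * x1" by (simp add: yt_def ytop_def x1_def)
    have yt_lt: "0 < yt" "yt < 2 * pi" "2 * pi * (1 - 2 * \<epsilon>) \<le> yt"
      using x1 \<eta> by (auto simp: yt intro!: mult_left_mono)
    have yt_et: "2 * pi - et < yt" using yt_lt(3) \<epsilon>(3) by (simp add: algebra_simps)
    define yb where "yb = ybot M"
    have yb: "0 < yb" "yb < y0" "yb < 2 * pi"
    proof -
      show "0 < yb" using Mp by (simp add: yb_def ybot_def)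
      show "yb < y0" using M(3) Mp y0 by (simp add: yb_def ybot_def field_simps)
      have "pi / real M < pi / (1 / 2)" using M by (intro divide_strict_left_mono) auto
      then show "yb < 2 * pi" by (simp add: yb_def ybot_def)
    qed
    define A where "A = Complex (cr + u / (2 * real M)) yb"
    define Cc where "Cc = Complex (cr + u * x1) yt"
    define P where "P = Complex 0 yb"
    define Q where "Q = Complex 0 yt"
    have ux1: "0 \<le> u * x1" "u * x1 \<le> u * (1 - \<eta>)" "u * x1 \<le> u"
      using x1 u_pos \<eta> by (auto intro!: mult_left_mono)
    have small: "u / (2 * real M) \<le> u / 40" "0 \<le> u / (2 * real M)"
      using M u_pos by (intro divide_left_mono; simp)+ (simp add: u_pos less_imp_le)
    note CF = contour_formula[OF Mp(1) K2 KM, of d, folded x1_def yt_def yb_def, folded A_def Cc_def P_def Q_def]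
    have RCe: "0 \<le> 2 * R * Cg * e" using R Cg e by simp
    \<comment> \<open>F will be 1 where \<open>Psi\<close> alone is small enough, and |E| where 1 /
      E has to compensate for the growth of g.\<close>
    have bound: "norm (Phi d M z) \<le> 2 * R * Cg * e"
      if z: "0 \<le> Re z" "Re z \<le> 2 * u" "norm (g M z) \<le> Cg * exp (real M * Psi z)"
        and E: "1 / 2 * F \<le> norm (EE M z - 1)" "exp (real M * Psi z) \<le> F * e" "F > 0" for z F
    proof -
      have "norm (Phi d M z) = norm (rho d M z) * norm (g M z) / norm (EE M z - 1)"
        by (simp add: Phi_def norm_divide norm_mult)
      also have "\<dots> \<le> R * (Cg * (F * e)) / (1 / 2 * F)"
      proof (rule frac_le)
        have "norm (g M z) \<le> Cg * (F * e)"
          using z(3) mult_left_mono[OF E(2), of Cg] Cg by linarith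
        then show "norm (rho d M z) * norm (g M z) \<le> R * (Cg * (F * e))"
          using R rho[OF M(4) Mp(1) z(1,2)] by (intro mult_mono) auto
        show "0 \<le> R * (Cg * (F * e))" using R Cg E(3) e by auto
      qed (use E in auto)
      also have "\<dots> = 2 * R * Cg * e" using E(3) by simp
      finally show ?thesis .
    qed
    have I1: "norm (line_int d M P A) \<le> 2 * R * Cg * e * u"
    proof -
      have "norm (line_int d M P A) \<le> 2 * R * Cg * e * norm (A - P)"
      proof (rule contour_integral_bound_linepath[OF CF(2) RCe])
        fix z assume "z \<in> closed_segment P A"
        then have z: "Im z = yb" "0 \<le> Re z" "Re z \<le> cr + u / (2 * real M)"
          using cr_bounds small by (auto simp: P_def A_def closed_segment_same_Im closed_segment_eq_real_ivl split: if_splits)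
        then have z': "Re z \<le> 19 * u / 20" using small u_pos by (simp add: cr_def)
        have "norm (g M z) \<le> C1 * exp (real M * Psi z)"
          using z z' by (intro strip Mp) auto
        also have "\<dots> \<le> Cg * exp (real M * Psi z)" using Cg by simp
        finally have gz: "norm (g M z) \<le> Cg * exp (real M * Psi z)" .
        show "norm (Phi d M z) \<le> 2 * R * Cg * e"
        proof (rule bound[OF z(2) _ gz, of 1])
          show "Re z \<le> 2 * u" using z' u_pos by simp
          have "z = (of_int 1 - 1 / 2) * h M + of_real (Re z - u / (2 * real M))"
            using z by (simp add: complex_eq_iff Re_h Im_h yb_def ybot_def)
          from norm_EE_minus_1_half(1)[OF Mp(1) this] show "1 / 2 * 1 \<le> norm (EE M z - 1)" by simp
          have "Psi z = Psi (Complex (Re z) yb)" using z(1) by (metis complex_surj)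
          also have "\<dots> \<le> X - u / nx" using z z' yb u_pos by (intro bottom) auto
          also have "\<dots> \<le> X - \<delta>" using \<delta> by simp
          finally show "exp (real M * Psi z) \<le> 1 * e" using Mp by (simp add: e_def)
        qed simp
      qed
      also have "norm (A - P) \<le> u"
      proof -
        have "A - P = of_real (cr + u / (2 * real M))" by (simp add: A_def P_def complex_eq_iff)
        then have "norm (A - P) = cr + u / (2 * real M)" using cr_bounds small by (simp only: norm_of_real; simp)
        then show ?thesis using small u_pos by (simp add: cr_def)
      qed
      then have "2 * R * Cg * e * norm (A - P) \<le> 2 * R * Cg * e * u" using RCe by (intro mult_left_mono)
      finally show ?thesis .
    qed
    have Ax: "A = of_real cr + of_real (1 / (2 * real M)) * \<xi>" and Cx: "Cc = of_real cr + of_real x1 * \<xi>"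
      by (simp_all add: A_def Cc_def complex_eq_iff yb_def ybot_def yt mult.commute)
    have I2: "norm (line_int d M A Cc) \<le> 2 * R * Cg * e * norm \<xi>"
    proof -
      have "norm (line_int d M A Cc) \<le> 2 * R * Cg * e * norm (Cc - A)"
      proof (rule contour_integral_bound_linepath[OF CF(3) RCe])
        fix z assume "z \<in> closed_segment A Cc"
        then obtain s where s: "0 \<le> s" "s \<le> 1" "z = (1 - s) *\<^sub>R A + s *\<^sub>R Cc"
          by (auto simp: in_segment)
        define x where "x = (1 - s) * (1 / (2 * real M)) + s * x1"
        have zx: "z = of_real cr + of_real x * \<xi>"
          unfolding s Ax Cx x_def scaleR_conv_of_real by (simp add: algebra_simps)
        have "(1 - s) * (1 / (2 * real M)) + s * (1 / (2 * real M)) \<le> x"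
          unfolding x_def using s x1 by (intro add_mono mult_left_mono) auto
        moreover have convex_comb: "(1 - s) * b + s * b = b" for b by (simp add: algebra_simps)
        ultimately have "1 / (2 * real M) \<le> x" by (simp only:)
        then have x0: "0 < x" using Mp by (smt (verit) zero_less_divide_iff)
        have "x \<le> (1 - s) * x1 + s * x1"
          unfolding x_def using s x1 by (intro add_mono mult_left_mono) auto
        then have xx: "x \<le> x1" by (simp only: convex_comb)
        have zK: "z \<in> KK \<eta>"
          unfolding KK_def zx using x0 xx x1 cr_bounds by force
        have "norm (g M z) \<le> C2 * exp (real M * Psi z)" using M zK by (intro para) auto
        also have "\<dots> \<le> Cg * exp (real M * Psi z)" using Cg by simp
        finally have gz: "norm (g M z) \<le> Cg * exp (real M * Psi z)" .
        have ux: "0 \<le> u * x" "u * x \<le> u * x1" using x0 xx u_pos by (auto intro!: mult_left_mono)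
        have Rez: "Re z = cr + u * x" by (simp add: zx mult.commute)
        define q where "q = 4 * pi ^ 2 * cr / nx"
        have nE: "norm (EE M z) = exp (real M * q)"
          unfolding norm_EE q_def by (simp add: zx algebra_simps power2_eq_square)
        have "real M * q \<ge> 1"
          using M(5) cr_bounds nx_pos by (simp add: q_def field_simps)
        then have "exp (real M * q) \<ge> 2" using exp_ge_add_one_self[of "real M * q"] by linarith
        then have E2: "norm (EE M z) \<ge> 2" using nE by simp
        show "norm (Phi d M z) \<le> 2 * R * Cg * e"
        proof (rule bound[OF _ _ gz, of "exp (real M * q)"])
          show "0 \<le> Re z" "Re z \<le> 2 * u" using ux ux1 cr_bounds u_pos unfolding Rez by linarith+
          have "norm (EE M z) - norm (1 :: complex) \<le> norm (EE M z - 1)" by (rule norm_triangle_ineq2)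
          then show "1 / 2 * exp (real M * q) \<le> norm (EE M z - 1)" using E2 nE by simp
          have "Psi z - q \<le> X - u / nx"
            unfolding zx q_def using x0 xx x1 \<eta> by (intro Psi_slanted) auto
          also have "\<dots> \<le> X - \<delta>" using \<delta> by simp
          finally have "real M * Psi z \<le> real M * (q + (X - \<delta>))" using Mp by (intro mult_left_mono) auto
          then show "exp (real M * Psi z) \<le> exp (real M * q) * e"
            by (simp add: e_def exp_add[symmetric] ring_distribs)
        qed simp
      qed
      also have "norm (Cc - A) \<le> norm \<xi>"
      proof -
        have "Cc - A = of_real (x1 - 1 / (2 * real M)) * \<xi>"
          unfolding Ax Cx of_real_diff by (simp add: algebra_simps)
        then have "norm (Cc - A) = (x1 - 1 / (2 * real M)) * norm \<xi>"
          using x1(4) by (simp only: norm_mult norm_of_real; simp)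
        also have "\<dots> \<le> 1 * norm \<xi>"
        proof (rule mult_right_mono)
          have "0 \<le> 1 / (2 * real M)" by simp
          then show "x1 - 1 / (2 * real M) \<le> 1" using x1(2) \<eta> by linarith
        qed simp
        finally show ?thesis by simp
      qed
      then have "2 * R * Cg * e * norm (Cc - A) \<le> 2 * R * Cg * e * norm \<xi>" using RCe by (intro mult_left_mono)
      finally show ?thesis .
    qed
    have I3: "norm (line_int d M Cc Q) \<le> 2 * R * Cg * e * (2 * u)"
    proof -
      have "norm (line_int d M Cc Q) \<le> 2 * R * Cg * e * norm (Q - Cc)"
      proof (rule contour_integral_bound_linepath[OF CF(4) RCe])
        fix z assume "z \<in> closed_segment Cc Q"
        then have z: "Im z = yt" "0 \<le> Re z" "Re z \<le> cr + u * x1"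
          using cr_bounds ux1 by (auto simp: Q_def Cc_def closed_segment_same_Im closed_segment_eq_real_ivl split: if_splits)
        have zt: "z = Complex (Re z) yt" using z(1) by (metis complex_surj)
        have half: "z = (of_int (int K) - 1 / 2) * h M + of_real (Re z - u * x1)"
          using z by (simp add: complex_eq_iff Re_h Im_h yt x1_def xtop_def)
        have z2u: "Re z \<le> 2 * u" using z ux1 cr_bounds by linarith
        show "norm (Phi d M z) \<le> 2 * R * Cg * e"
        \<comment> \<open>Left of the line through \<open>\<xi>\<close> the bound
          \<open>Psi_top\<close> suffices. Further right, \<open>Psi\<close> grows at most at the
          rate (3 u + 2 pi^2) / nx, below the rate 4 pi^2 / nx of log |E| / M.\<close>
        proof (cases "Re z \<le> u * x1")
          case True
          have "norm (g M z) \<le> C1 * exp (real M * Psi z)"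
            using z True ux1 by (intro strip Mp) auto
          also have "\<dots> \<le> Cg * exp (real M * Psi z)" using Cg by simp
          finally have gz: "norm (g M z) \<le> Cg * exp (real M * Psi z)" .
          show ?thesis
          proof (rule bound[OF z(2) z2u gz, of 1])
            show "1 / 2 * 1 \<le> norm (EE M z - 1)" using norm_EE_minus_1_half(1)[OF Mp(1) half] by simp
            have "Psi z = Psi (Complex (Re z) yt)" using zt by simp
            also have "\<dots> \<le> X - dt" using z True ux1 yt_et yt_lt by (intro top) auto
            also have "\<dots> \<le> X - \<delta>" using \<delta> by simp
            finally show "exp (real M * Psi z) \<le> 1 * e" using Mp by (simp add: e_def)
          qed simp
        next
          case False
          define c where "c = Re z - u * x1"
          have c: "0 \<le> c" "c \<le> cr" using False z by (auto simp: c_def)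
          have zx: "z = of_real c + of_real x1 * \<xi>"
            using z by (simp add: complex_eq_iff c_def yt mult.commute)
          have zK: "z \<in> KK \<eta>"
            unfolding KK_def zx using c x1 by force
          have "norm (g M z) \<le> C2 * exp (real M * Psi z)" using M zK by (intro para) auto
          also have "\<dots> \<le> Cg * exp (real M * Psi z)" using Cg by simp
          finally have gz: "norm (g M z) \<le> Cg * exp (real M * Psi z)" .
          define q where "q = 4 * pi ^ 2 * c / nx"
          have nE: "norm (EE M z) = exp (real M * q)"
            unfolding norm_EE q_def by (simp add: zx algebra_simps power2_eq_square)
          show ?thesis
          proof (rule bound[OF z(2) z2u gz, of "exp (real M * q)"])
            show "1 / 2 * exp (real M * q) \<le> norm (EE M z - 1)"
              using norm_EE_minus_1_half(2)[OF Mp(1) half] nE by simp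
            have "Psi (Complex (Re z) yt) \<le> Psi (Complex (u * x1) yt) + (Re z - u * x1) * ((3 * u + 2 * pi ^ 2) / nx)"
              using yt_lt ux1 False z2u by (intro Psi_outer) auto
            also have "Psi (Complex (u * x1) yt) \<le> X - dt"
              using ux1 yt_et yt_lt by (intro top) auto
            also have "(Re z - u * x1) * ((3 * u + 2 * pi ^ 2) / nx) \<le> c * ((4 * pi ^ 2) / nx)"
              unfolding c_def[symmetric] using c u_less_1 pi_sq_gt_9 less_imp_le[OF nx_pos]
              by (intro mult_left_mono divide_right_mono) auto
            also have "c * ((4 * pi ^ 2) / nx) = q" by (simp add: q_def)
            finally have "Psi z \<le> q + (X - \<delta>)" using \<delta> zt by simp
            then have "real M * Psi z \<le> real M * (q + (X - \<delta>))" using Mp by (intro mult_left_mono) auto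
            then show "exp (real M * Psi z) \<le> exp (real M * q) * e"
              by (simp add: e_def exp_add[symmetric] ring_distribs)
          qed simp
        qed
      qed
      also have "norm (Q - Cc) \<le> 2 * u"
      proof -
        have "Q - Cc = of_real (- (cr + u * x1))" by (simp add: Q_def Cc_def complex_eq_iff)
        then have "norm (Q - Cc) = cr + u * x1" using cr_bounds ux1 by (simp only: norm_of_real; simp)
        then show ?thesis using cr_bounds ux1 by linarith
      qed
      then have "2 * R * Cg * e * norm (Q - Cc) \<le> 2 * R * Cg * e * (2 * u)" using RCe by (intro mult_left_mono)
      finally show ?thesis .
    qed
    have rho_grid: "norm (rho d M (of_nat k * h M)) \<le> R" if "k < M" for k
    proof -
      have k: "0 \<le> real k / real M" "real k / real M \<le> 1" using that Mp by auto
      have "Re (of_nat k * h M) = u * (real k / real M)" by (simp add: Re_h)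
      moreover have "0 \<le> u * (real k / real M)" using u_pos k(1) by (intro mult_nonneg_nonneg) auto
      moreover have "u * (real k / real M) \<le> u * 1" using u_pos k(2) by (intro mult_left_mono) auto
      ultimately show ?thesis using u_pos by (intro rho M(4) Mp; linarith)
    qed
    have gK: "norm (g M (of_nat K * h M)) \<le> Cg * e"
    proof -
      define x where "x = real K / real M"
      have x: "1 - \<epsilon> \<le> x" "x \<le> 1 - \<eta>" using Klo Khi' Mp by (auto simp: x_def field_simps)
      have z: "of_nat K * h M = of_real 0 + of_real x * \<xi>" by (simp add: x_def h_def)
      have z': "of_nat K * h M = Complex (u * x) (2 * pi * x)"
        unfolding z by (simp add: complex_eq_iff mult.commute)
      have "norm (g M (of_nat K * h M)) \<le> C2 * exp (real M * Psi (of_nat K * h M))"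
      proof (rule para)
        show "of_nat K * h M \<in> KK \<eta>" unfolding z KK_def using x \<epsilon> cr_bounds by force
      qed (use M in auto)
      also have "\<dots> \<le> Cg * e"
      proof (rule mult_mono)
        have "Psi (of_nat K * h M) \<le> X - dt" unfolding z'
        proof (rule top)
          have "2 * pi * (1 - 2 * \<epsilon>) \<le> 2 * pi * x" using x \<epsilon> by (intro mult_left_mono) auto
          then show "2 * pi - et < 2 * pi * x" using \<epsilon>(3) by (simp add: algebra_simps)
          show "2 * pi * x < 2 * pi" "0 \<le> u * x" "u * x \<le> u" using x \<epsilon> \<eta> u_pos by (auto simp: mult_le_cancel_left1)
        qed
        then have "Psi (of_nat K * h M) \<le> X - \<delta>" using \<delta> by simp
        then show "exp (real M * Psi (of_nat K * h M)) \<le> e" using Mp by (simp add: e_def)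
      qed (use Cg C2 in auto)
      finally show ?thesis .
    qed
    \<comment> \<open>From K on each new factor has modulus at most 1, so the bound for g at K
      persists.\<close>
    have tail: "norm (summand d M k) \<le> R * (Cg * e)" if k: "K \<le> k" "k < M" for k
    proof -
      have "norm (g M (of_nat k * h M)) = norm (\<Prod>l=1..k. f (of_nat l * h M))"
        using k by (subst g_grid[OF Mp(1)]) auto
      also have "{1..k} = {1..K} \<union> {K+1..k}" using k K2 by auto
      also have "(\<Prod>l\<in>{1..K} \<union> {K+1..k}. f (of_nat l * h M)) = (\<Prod>l=1..K. f (of_nat l * h M)) * (\<Prod>l=K+1..k. f (of_nat l * h M))"
        by (rule prod.union_disjoint) auto
      also have "(\<Prod>l=1..K. f (of_nat l * h M)) = g M (of_nat K * h M)"
        using KM by (subst g_grid[OF Mp(1)]) auto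
      also have "norm (g M (of_nat K * h M) * (\<Prod>l=K+1..k. f (of_nat l * h M))) \<le> (Cg * e) * 1"
        unfolding norm_mult
      proof (rule mult_mono[OF gK])
        have "norm (f (of_nat l * h M)) \<le> 1" if l: "l \<in> {K+1..k}" for l
        proof (rule fr)
          define x where "x = real l / real M"
          have "real K \<le> real l" "real l \<le> real M" using l k by auto
          then have x: "1 - \<epsilon> \<le> x" "x \<le> 1" using Klo Mp by (auto simp: x_def field_simps)
          have "of_nat l * h M - \<xi> = of_real (x - 1) * \<xi>" by (simp add: x_def h_def algebra_simps)
          then have "norm (of_nat l * h M - \<xi>) = (1 - x) * norm \<xi>"
            using x by (simp only: norm_mult norm_of_real; simp)
          also have "\<dots> \<le> \<epsilon> * norm \<xi>" using x by (intro mult_right_mono) auto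
          also have "\<dots> < r" by (rule \<epsilon>(5))
          finally show "norm (of_nat l * h M - \<xi>) < r" .
        qed
        then show "norm (\<Prod>l=K+1..k. f (of_nat l * h M)) \<le> 1"
          unfolding prod_norm[symmetric] by (intro prod_le_1) auto
      qed (use Cg e in auto)
      finally have "norm (g M (of_nat k * h M)) \<le> Cg * e" by simp
      then show ?thesis unfolding norm_mult using rho_grid[OF k(2)] R by (intro mult_mono) auto
    qed
    define s where "s k = summand d M k" for k
    have s0: "norm (s 0) \<le> R * e"
    proof -
      have "norm (s 0) \<le> R * 1"
        using rho_grid[OF Mp(1)] g_0[OF Mp(1)] by (simp add: s_def norm_mult)
      also have "\<dots> \<le> R * e" using e R by (intro mult_left_mono) auto
      finally show ?thesis .
    qed
    have st: "norm (\<Sum>k=K..<M. s k) \<le> real M * (R * (Cg * e))"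
    proof -
      have "norm (\<Sum>k=K..<M. s k) \<le> (\<Sum>k=K..<M. R * (Cg * e))"
        by (rule order.trans[OF norm_sum sum_mono]) (use tail in \<open>auto simp: s_def\<close>)
      also have "\<dots> = real (M - K) * (R * (Cg * e))" by simp
      also have "\<dots> \<le> real M * (R * (Cg * e))" using R Cg e by (intro mult_right_mono) auto
      finally show ?thesis .
    qed
    have split: "(\<Sum>k<M. s k) = s 0 + (\<Sum>k=1..<K. s k) + (\<Sum>k=K..<M. s k)"
    proof -
      have "(\<Sum>k<M. s k) = (\<Sum>k=0..<M. s k)" by (simp add: atLeast0LessThan)
      also have "\<dots> = (\<Sum>k=0..<1. s k) + (\<Sum>k=1..<M. s k)"
        by (rule sum.atLeastLessThan_concat[symmetric]) (use Mp in auto)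
      also have "(\<Sum>k=1..<M. s k) = (\<Sum>k=1..<K. s k) + (\<Sum>k=K..<M. s k)"
        by (rule sum.atLeastLessThan_concat[symmetric]) (use K2 KM in auto)
      finally show ?thesis by (simp add: add.assoc)
    qed
    have nh: "norm (h M) = norm \<xi> / real M" by (simp add: h_def norm_divide)
    have hs: "norm (h M * s 0) \<le> norm \<xi> * (R * e)" "norm (h M * (\<Sum>k=K..<M. s k)) \<le> norm \<xi> * (R * (Cg * e))"
    proof -
      have "norm \<xi> / real M \<le> norm \<xi> / 1" using M by (intro divide_left_mono) auto
      then have "norm \<xi> / real M * norm (s 0) \<le> norm \<xi> * (R * e)" using s0 by (intro mult_mono) auto
      then show "norm (h M * s 0) \<le> norm \<xi> * (R * e)" by (simp add: norm_mult nh)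
      have "norm \<xi> / real M * norm (\<Sum>k=K..<M. s k) \<le> norm \<xi> / real M * (real M * (R * (Cg * e)))"
        using st by (intro mult_left_mono) auto
      then show "norm (h M * (\<Sum>k=K..<M. s k)) \<le> norm \<xi> * (R * (Cg * e))" using Mp by (simp add: norm_mult nh)
    qed
    have total: "h M * (\<Sum>k<M. s k) + line_int d M P Q =
       h M * s 0 + h M * (\<Sum>k=K..<M. s k) + (line_int d M P A +
        line_int d M A Cc + line_int d M Cc Q)"
      using CF(1) unfolding split s_def[symmetric] distrib_left by (simp add: algebra_simps)
    have "norm (h M * (\<Sum>k<M. s k) + line_int d M P Q) \<le> norm (h M * s 0) + norm (h M * (\<Sum>k=K..<M. s k)) + (norm (line_int d M P A) +
        norm (line_int d M A Cc) + norm (line_int d M Cc Q))"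
      unfolding total by (intro norm_triangle_le add_mono order_refl)
    also have "\<dots> \<le> norm \<xi> * (R * e) + norm \<xi> * (R * (Cg * e)) + (2 * R * Cg * e * u + 2 * R * Cg * e * norm \<xi> + 2 * R * Cg * e * (2 * u))"
      using hs I1 I2 I3 by linarith
    also have "\<dots> = Ctot * e"
    proof -
      have "n * (R * e) + n * (R * (Cg * e)) + (2 * R * Cg * e * u + 2 * R * Cg * e * n + 2 * R * Cg * e * (2 * u))
        = (2 * R * Cg * u + 2 * R * Cg * n + 2 * R * Cg * (2 * u) + n * (R + R * Cg)) * e" for n :: real
        by algebra
      then show ?thesis unfolding Ctot_def .
    qed
    finally have "norm (h M * (\<Sum>k<M. s k) + line_int d M P Q) \<le> Ctot * e" .
    then show ?thesis
      using Mp K2 KM yt_lt CF(5) unfolding s_def e_def P_def Q_def yt_def yb_def K_def by simp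
  qed
  have y1: "ys < 2 * pi * (1 - 2 * \<epsilon>)" using \<epsilon>(4) by (simp add: ys_def algebra_simps)
  show ?thesis
    by (rule exI[of _ k1], rule exI[of _ \<delta>], rule conjI[OF \<delta>(1)], rule exI[of _ Ctot],
        rule conjI[OF Ctot], rule exI[of _ M0], rule exI[of _ "2 * pi * (1 - 2 * \<epsilon>)"],
        rule conjI[OF y1], intro allI impI, rule main)
qed

section \<open>Laplace asymptotics on the imaginary axis\<close>

definition rho_lim :: "nat \<Rightarrow> complex" where
  "rho_lim d = ((1 - exp (\<i> * of_real ys)) * (1 - exp (of_real u - \<i> * of_real ys))) ^ d"

definition lead :: "nat \<Rightarrow> complex" where
  "lead M = exp (V (\<i> * of_real ys) * of_nat M / \<xi>)"

text \<open>With y = ys + t / sqrt M, the quadratic term -i sin \<open>\<theta>\<close> (y - ys)^2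
  of V, multiplied by M / \<open>\<xi>\<close>, becomes -beta t^2.\<close>

definition beta :: complex where "beta = \<i> * of_real (sin \<theta>) / \<xi>"

lemma Re_beta: "Re beta = 2 * pi * sin \<theta> / nx"
  by (simp add: beta_def Re_divide_xi)

lemma Re_beta_pos: "Re beta > 0"
  unfolding Re_beta using sin_theta_pos nx_pos by (intro divide_pos_pos mult_pos_pos) auto

lemma norm_EE_imag: "norm (EE M (\<i> * of_real y)) = exp (- (2 * pi * u / nx) * (real M * y))"
  unfolding norm_EE by (simp add: mult_ac)

text \<open>E equals 1 at 0, but from y = pi / M upwards |E| is bounded by a constant below 1 that
  is independent of M. So 1 / (E - 1) stays bounded on the whole left side.\<close>

lemma norm_EE_imag_le:
  assumes "M > 0" "ybot M \<le> y"
  shows "norm (EE M (\<i> * of_real y)) \<le> exp (- (2 * pi * u / nx) * pi)"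
proof -
  have "real M * ybot M \<le> real M * y" using assms by (intro mult_left_mono) auto
  then have "pi \<le> real M * y" using assms by (simp add: ybot_def)
  then have "(2 * pi * u / nx) * pi \<le> (2 * pi * u / nx) * (real M * y)"
    using u_pos less_imp_le[OF nx_pos] by (intro mult_left_mono divide_nonneg_nonneg) auto
  then show ?thesis unfolding norm_EE_imag by simp
qed

lemma EE_gap: "exp (- (2 * pi * u / nx) * pi) < 1"
proof -
  have "0 < (2 * pi * u / nx) * pi" using u_pos nx_pos by (intro mult_pos_pos divide_pos_pos) auto
  then show ?thesis by simp
qed

lemma Phi_imag_bound:
  "\<exists>C>0. \<forall>M y. 0 < M \<and> d \<le> M \<and> ybot M \<le> y \<longrightarrow>
    norm (Phi d M (\<i> * of_real y)) \<le> C * exp (real M * (2 * pi * Lam y / nx))"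
proof -
  define r where "r = exp (- (2 * pi * u / nx) * pi)"
  have r: "r < 1" unfolding r_def by (rule EE_gap)
  obtain R where R: "R > 0" and rho: "\<And>M z. d \<le> M \<Longrightarrow> 0 < M \<Longrightarrow> 0 \<le> Re z \<Longrightarrow> Re z \<le> 2 * u \<Longrightarrow> norm (rho d M z) \<le> R"
    using rho_bound[of d] by blast
  obtain C where C: "C > 0" and g: "\<And>M z. M > 0 \<Longrightarrow> \<bar>Re z\<bar> \<le> 0 \<Longrightarrow> norm (g M z) \<le> C * exp (real M * Psi z)"
    using g_bound_strip[of 0] u_pos by blast
  have "norm (Phi d M (\<i> * of_real y)) \<le> (R * C / (1 - r)) * exp (real M * (2 * pi * Lam y / nx))"
    if "0 < M" "d \<le> M" "ybot M \<le> y" for M y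
  proof -
    have "norm (Phi d M (\<i> * of_real y)) = norm (rho d M (\<i> * of_real y)) * norm (g M (\<i> * of_real y)) / norm (EE M (\<i> * of_real y) - 1)"
      by (simp add: Phi_def norm_divide norm_mult)
    also have "\<dots> \<le> (R * (C * exp (real M * (2 * pi * Lam y / nx)))) / (1 - r)"
    proof (rule frac_le)
      have "norm (g M (\<i> * of_real y)) \<le> C * exp (real M * (2 * pi * Lam y / nx))"
        using g[OF that(1), of "\<i> * of_real y"] by (simp add: Psi_imag)
      moreover have "norm (rho d M (\<i> * of_real y)) \<le> R"
        using that u_pos by (intro rho) auto
      ultimately show "norm (rho d M (\<i> * of_real y)) * norm (g M (\<i> * of_real y)) \<le> R * (C * exp (real M * (2 * pi * Lam y / nx)))"
        using R by (intro mult_mono) auto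
      have "norm (1 :: complex) - norm (EE M (\<i> * of_real y)) \<le> norm (1 - EE M (\<i> * of_real y))"
        by (rule norm_triangle_ineq2)
      then show "1 - r \<le> norm (EE M (\<i> * of_real y) - 1)"
        using norm_EE_imag_le[OF that(1,3)] by (simp add: r_def norm_minus_commute)
    qed (use R C r in auto)
    finally show ?thesis by simp
  qed
  moreover have "R * C / (1 - r) > 0" using R C r by simp
  ultimately show ?thesis by blast
qed

lemma h_tendsto_0: "h \<longlonglongrightarrow> 0"
proof -
  have "(\<lambda>M. \<xi> * inverse (of_nat M)) \<longlonglongrightarrow> \<xi> * 0"
    by (intro tendsto_mult_left lim_inverse_n)
  then show ?thesis by (simp add: h_def[abs_def] divide_inverse)
qed

text \<open>The minus sign is the limit of 1 / (E - 1), since E tends to 0. The point may vary with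
  M because the Laplace substitution moves it.\<close>

lemma Phi_imag_limit:
  assumes y: "y \<longlonglongrightarrow> ys"
  shows "(\<lambda>M. Phi d M (\<i> * of_real (y M)) / exp (V (\<i> * of_real (y M)) * of_nat M / \<xi>)) \<longlonglongrightarrow>
    - (rho_lim d * amp (\<i> * of_real ys))"
proof -
  obtain C where C: "C > 0" and ex: "\<And>M z. M > 0 \<Longrightarrow> \<bar>Re z\<bar> \<le> 0 \<Longrightarrow>
    \<exists>e. norm e \<le> C / real M \<and> g M z = exp (V z * of_nat M / \<xi>) * amp z * exp e"
    using g_asymptotics[of 0] u_pos by blast
  have "\<forall>M. \<exists>e. M > 0 \<longrightarrow> norm e \<le> C / real M \<and>
      g M (\<i> * of_real (y M)) = exp (V (\<i> * of_real (y M)) * of_nat M / \<xi>) * amp (\<i> * of_real (y M)) * exp e"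
    using ex by simp
  then obtain e where e: "\<And>M. M > 0 \<Longrightarrow> norm (e M) \<le> C / real M"
      "\<And>M. M > 0 \<Longrightarrow> g M (\<i> * of_real (y M)) = exp (V (\<i> * of_real (y M)) * of_nat M / \<xi>) * amp (\<i> * of_real (y M)) * exp (e M)"
    by metis
  have iy: "(\<lambda>M. \<i> * of_real (y M)) \<longlonglongrightarrow> \<i> * of_real ys"
    using y by (intro tendsto_intros)
  have e0: "e \<longlonglongrightarrow> 0"
  proof (rule tendsto_norm_zero_cancel, rule tendsto_sandwich[OF _ _ tendsto_const])
    show "\<forall>\<^sub>F M in sequentially. norm (e M) \<le> C / real M"
      using eventually_gt_at_top[of 0] by eventually_elim (rule e(1))
    show "(\<lambda>M. C / real M) \<longlonglongrightarrow> 0" by (rule lim_const_over_n)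
  qed auto
  have "(\<lambda>M. rho d M (\<i> * of_real (y M))) \<longlonglongrightarrow>
     (\<Prod>i=1..d. (1 - exp (\<i> * of_real ys + of_nat i * 0)) * (1 - exp (of_real u - \<i> * of_real ys - of_nat i * 0)))"
    unfolding rho_def by (intro tendsto_intros iy h_tendsto_0)
  then have rho: "(\<lambda>M. rho d M (\<i> * of_real (y M))) \<longlonglongrightarrow> rho_lim d"
    by (simp add: rho_lim_def)
  have dm: "\<i> * of_real ys \<in> dom" using u_pos by (intro dom_strip) simp
  have "isCont amp (\<i> * of_real ys)"
    using dm unfolding amp_def dom_def
    by (intro continuous_intros) (use one_minus_exp_u in \<open>auto simp: one_minus_cut_plane\<close>)
  then have amp: "(\<lambda>M. amp (\<i> * of_real (y M))) \<longlonglongrightarrow> amp (\<i> * of_real ys)"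
    using iy by (rule isCont_tendsto_compose)
  have EE: "(\<lambda>M. EE M (\<i> * of_real (y M))) \<longlonglongrightarrow> 0"
  proof (rule tendsto_norm_zero_cancel)
    have k: "2 * pi * u / nx > 0" using u_pos nx_pos by (intro divide_pos_pos) auto
    have "filterlim (\<lambda>M. real M * y M) at_top sequentially"
      using filterlim_at_top_mult_tendsto_pos[OF y ys_bounds(2) filterlim_real_sequentially] .
    then have "filterlim (\<lambda>M. (2 * pi * u / nx) * (real M * y M)) at_top sequentially"
      by (rule filterlim_tendsto_pos_mult_at_top[OF tendsto_const k])
    then have "filterlim (\<lambda>M. - ((2 * pi * u / nx) * (real M * y M))) at_bot sequentially"
      by (simp add: filterlim_uminus_at_top)
    from filterlim_compose[OF exp_at_bot this]
    show "(\<lambda>M. norm (EE M (\<i> * of_real (y M)))) \<longlonglongrightarrow> 0"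
      unfolding norm_EE_imag by simp
  qed
  have "(\<lambda>M. rho d M (\<i> * of_real (y M)) * amp (\<i> * of_real (y M)) * exp (e M) / (EE M (\<i> * of_real (y M)) - 1))
     \<longlonglongrightarrow> rho_lim d * amp (\<i> * of_real ys) * exp 0 / (0 - 1)"
    by (intro tendsto_intros rho amp e0 EE) auto
  moreover have "\<forall>\<^sub>F M in sequentially. rho d M (\<i> * of_real (y M)) * amp (\<i> * of_real (y M)) * exp (e M) / (EE M (\<i> * of_real (y M)) - 1)
     = Phi d M (\<i> * of_real (y M)) / exp (V (\<i> * of_real (y M)) * of_nat M / \<xi>)"
    using eventually_gt_at_top[of 0] by eventually_elim (simp add: Phi_def e(2))
  ultimately show ?thesis
    by (auto intro: Lim_transform_eventually)
qed

lemma exponent_limit: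
  "(\<lambda>M. (V (\<i> * of_real (ys + t / sqrt (real M))) - V (\<i> * of_real ys)) * of_nat M / \<xi>) \<longlonglongrightarrow> - (beta * of_real t ^ 2)"
proof (cases "t = 0")
  case False
  have y: "(\<lambda>M. ys + t / sqrt (real M)) \<longlonglongrightarrow> ys" by real_asymp
  have ev: "\<forall>\<^sub>F M in sequentially. ys + t / sqrt (real M) \<noteq> ys"
    using eventually_gt_at_top[of 0] by eventually_elim (use False in auto)
  have "filterlim (\<lambda>M. ys + t / sqrt (real M)) (at ys) sequentially"
    using y ev by (simp add: filterlim_at)
  from filterlim_compose[OF Lam_quadratic_limit this]
  have "(\<lambda>M. (Lam ys - Lam (ys + t / sqrt (real M))) / (t / sqrt (real M)) ^ 2) \<longlonglongrightarrow> sin \<theta>"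
    by simp
  then have "(\<lambda>M. - (\<i> / \<xi>) * of_real (t ^ 2 * ((Lam ys - Lam (ys + t / sqrt (real M))) / (t / sqrt (real M)) ^ 2)))
     \<longlonglongrightarrow> - (\<i> / \<xi>) * of_real (t ^ 2 * sin \<theta>)"
    by (intro tendsto_intros)
  moreover have "\<forall>\<^sub>F M in sequentially. - (\<i> / \<xi>) * of_real (t ^ 2 * ((Lam ys - Lam (ys + t / sqrt (real M))) / (t / sqrt (real M)) ^ 2))
     = (V (\<i> * of_real (ys + t / sqrt (real M))) - V (\<i> * of_real ys)) * of_nat M / \<xi>"
    using eventually_gt_at_top[of 0]
  proof eventually_elim
    case (elim M)
    define L where "L = Lam ys - Lam (ys + t / sqrt (real M))"
    have "t ^ 2 * (L / (t / sqrt (real M)) ^ 2) = L * real M"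
      using False elim by (simp add: power_divide)
    moreover have "V (\<i> * of_real (ys + t / sqrt (real M))) - V (\<i> * of_real ys) = - \<i> * of_real L"
      unfolding V_imag L_def by (simp add: algebra_simps)
    ultimately show ?case
      unfolding L_def[symmetric] by simp
  qed
  ultimately have "(\<lambda>M. (V (\<i> * of_real (ys + t / sqrt (real M))) - V (\<i> * of_real ys)) * of_nat M / \<xi>)
      \<longlonglongrightarrow> - (\<i> / \<xi>) * of_real (t ^ 2 * sin \<theta>)"
    by (rule Lim_transform_eventually)
  also have "- (\<i> / \<xi>) * of_real (t ^ 2 * sin \<theta>) = - (beta * of_real t ^ 2)"
    by (simp add: beta_def)
  finally show ?thesis .
qed simp

lemma norm_lead: "norm (lead M) = exp (real M * X)"
  unfolding lead_def norm_exp_eq_Re Re_V_M Psi_imag X_def ..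

text \<open>Laplace's method: the substitution y = ys + t / sqrt M produces the factor sqrt M, and
  \<open>Lam_quadratic_bound\<close> gives the Gaussian majorant for dominated convergence.\<close>

lemma left_side_asymptotics:
  assumes k1: "\<And>M. M \<ge> M0 \<Longrightarrow> 0 < M \<and> y1 \<le> ytop (k1 M) M \<and> ytop (k1 M) M < 2 * pi" and y1: "ys < y1"
  shows "(\<lambda>M. of_real (sqrt (real M)) * integral {ybot M..ytop (k1 M) M} (\<lambda>y. Phi d M (\<i> * of_real y)) / lead M)
    \<longlonglongrightarrow> - (rho_lim d * amp (\<i> * of_real ys)) * (of_real (sqrt pi) / csqrt beta)"
proof -
  define A where "A = rho_lim d * amp (\<i> * of_real ys)"
  obtain \<kappa> where \<kappa>: "\<kappa> > 0" "\<And>y. y \<in> {0..2*pi} \<Longrightarrow> Lam ys - Lam y \<ge> \<kappa> * (y - ys) ^ 2"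
    using Lam_quadratic_bound by blast
  obtain C where C: "C > 0" and bound: "\<And>M y. 0 < M \<Longrightarrow> d \<le> M \<Longrightarrow> ybot M \<le> y \<Longrightarrow>
    norm (Phi d M (\<i> * of_real y)) \<le> C * exp (real M * (2 * pi * Lam y / nx))"
    using Phi_imag_bound[of d] by blast
  define M1 where "M1 = max M0 d"
  define b where "b = 2 * pi * \<kappa> / nx"
  have b: "b > 0" using \<kappa> nx_pos by (simp add: b_def)
  define yM where "yM M t = ys + t / sqrt (real M)" for M :: nat and t :: real
  define I where "I M = {ybot M..ytop (k1 M) M}" for M
  define F where "F M y = indicator (I M) y *\<^sub>R (Phi d M (\<i> * of_real y) / lead M)" for M y
  have lead0: "lead M \<noteq> 0" for M by (simp add: lead_def)
  have M1: "M \<ge> M0" "M > 0" "d \<le> M" if "M \<ge> M1" for M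
    using that k1[of M] by (auto simp: M1_def)
  have cont: "continuous_on (I M) (\<lambda>y. Phi d M (\<i> * of_real y) / lead M)" if "M \<ge> M1" for M
  proof -
    have "Phi d M holomorphic_on (\<lambda>y. \<i> * of_real y) ` I M"
    proof (rule holomorphic_Phi[OF M1(2)[OF that]])
      show "EE M z \<noteq> 1" if z: "z \<in> (\<lambda>y. \<i> * of_real y) ` I M" for z
      proof
        assume "EE M z = 1"
        moreover have "norm (EE M z) < 1"
        proof -
          obtain y where y: "z = \<i> * of_real y" "ybot M \<le> y" using z by (auto simp: I_def)
          show ?thesis
            unfolding y(1) using norm_EE_imag_le[OF M1(2)[OF \<open>M \<ge> M1\<close>] y(2)] EE_gap by linarith
        qed
        ultimately show False by simp
      qed
    qed (use u_pos in auto)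
    then have "continuous_on ((\<lambda>y. \<i> * of_real y) ` I M) (Phi d M)"
      by (rule holomorphic_on_imp_continuous_on)
    then have "continuous_on (I M) (\<lambda>y. Phi d M (\<i> * of_real y))"
      by (rule continuous_on_compose2) (auto intro!: continuous_intros)
    then show ?thesis using lead0 by (intro continuous_intros) auto
  qed
  have meas: "F M \<in> borel_measurable borel" if "M \<ge> M1" for M
    unfolding F_def using borel_measurable_continuous_on_indicator[OF _ cont[OF that]] by (simp add: I_def)
  have int_eq: "(LINT t|lborel. F M (yM M t)) =
      of_real (sqrt (real M)) * integral (I M) (\<lambda>y. Phi d M (\<i> * of_real y)) / lead M" if "M \<ge> M1" for M
  proof -
    have sM: "sqrt (real M) > 0" using M1[OF that] by simp
    have "(LINT y|lborel. F M y) = \<bar>1 / sqrt (real M)\<bar> *\<^sub>R (LINT t|lborel. F M (ys + (1 / sqrt (real M)) * t))"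
      by (rule lborel_integral_real_affine) (use sM in simp)
    then have "(LINT t|lborel. F M (yM M t)) = sqrt (real M) *\<^sub>R (LINT y|lborel. F M y)"
      using sM by (simp add: yM_def)
    moreover have "(LINT y|lborel. F M y) = integral (I M) (\<lambda>y. Phi d M (\<i> * of_real y) / lead M)"
    proof -
      have "set_integrable lborel (I M) (\<lambda>y. Phi d M (\<i> * of_real y) / lead M)"
        using borel_integrable_atLeastAtMost'[OF cont[OF that, unfolded I_def]] by (simp add: I_def)
      from set_borel_integral_eq_integral(2)[OF this] show ?thesis
        by (simp only: F_def set_lebesgue_integral_def)
    qed
    moreover have "integral (I M) (\<lambda>y. Phi d M (\<i> * of_real y) / lead M) = integral (I M) (\<lambda>y. Phi d M (\<i> * of_real y)) / lead M"
      by simp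
    ultimately show ?thesis by (simp add: scaleR_conv_of_real)
  qed
  \<comment> \<open>Indices start at M1 because measurability and the majorant have to hold for
    every member of the sequence.\<close>
  have "(\<lambda>n. LINT t|lborel. F (n + M1) (yM (n + M1) t)) \<longlonglongrightarrow> (LINT t|lborel. - A * gauss beta t)"
  proof (rule integral_dominated_convergence[where w = "\<lambda>t. C * exp (- (b * t ^ 2))"])
    show "(\<lambda>t. - A * gauss beta t) \<in> borel_measurable lborel"
      using gaussian_complex(1)[OF Re_beta_pos] by (intro borel_measurable_integrable integrable_mult_right)
    show "(\<lambda>t. F (n + M1) (yM (n + M1) t)) \<in> borel_measurable lborel" for n
    proof -
      have m: "F (n + M1) \<in> borel_measurable borel" by (rule meas) simp
      have "(\<lambda>t. yM (n + M1) t) \<in> borel_measurable borel"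
        unfolding yM_def by measurable
      from measurable_compose[OF this m] show ?thesis by simp
    qed
    show "integrable lborel (\<lambda>t. C * exp (- (b * t ^ 2)))"
      by (intro integrable_mult_right gaussian_real b)
    show "AE t in lborel. norm (F (n + M1) (yM (n + M1) t)) \<le> C * exp (- (b * t ^ 2))" for n
    proof (rule AE_I2)
      fix t :: real
      define M where "M = n + M1"
      have M: "M \<ge> M1" by (simp add: M_def)
      show "norm (F (n + M1) (yM (n + M1) t)) \<le> C * exp (- (b * t ^ 2))"
        unfolding M_def[symmetric]
      proof (cases "yM M t \<in> I M")
        case True
        define y where "y = yM M t"
        have y: "ybot M \<le> y" "y \<le> 2 * pi" "0 \<le> y"
        proof -
          have "0 \<le> ybot M" by (simp add: ybot_def)
          then show "ybot M \<le> y" "y \<le> 2 * pi" "0 \<le> y"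
            using True k1[OF M1(1)[OF M]] by (auto simp: I_def y_def)
        qed
        have "(y - ys) ^ 2 = t ^ 2 / real M" by (simp add: y_def yM_def power_divide)
        then have "Lam y - Lam ys \<le> - (\<kappa> * t ^ 2 / real M)"
          using \<kappa>(2)[of y] y by simp
        then have "real M * (2 * pi / nx) * (Lam y - Lam ys) \<le> real M * (2 * pi / nx) * (- (\<kappa> * t ^ 2 / real M))"
          using less_imp_le[OF nx_pos] by (intro mult_left_mono) auto
        also have "\<dots> = - (b * t ^ 2)"
          using M1[OF M] by (simp add: b_def)
        finally have ex: "real M * (2 * pi / nx) * (Lam y - Lam ys) \<le> - (b * t ^ 2)" .
        have "norm (F M y) = norm (Phi d M (\<i> * of_real y)) / exp (real M * X)"
          using True by (simp add: F_def y_def norm_divide norm_lead)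
        also have "\<dots> \<le> C * exp (real M * (2 * pi * Lam y / nx)) / exp (real M * X)"
          using bound[OF M1(2,3)[OF M] y(1)] by (intro divide_right_mono) auto
        also have "\<dots> = C * exp (real M * (2 * pi * Lam y / nx) - real M * X)"
          by (simp add: exp_diff)
        also have "real M * (2 * pi * Lam y / nx) - real M * X = real M * (2 * pi / nx) * (Lam y - Lam ys)"
          by (simp add: X_def algebra_simps diff_divide_distrib)
        also have "C * exp (real M * (2 * pi / nx) * (Lam y - Lam ys)) \<le> C * exp (- (b * t ^ 2))"
          using ex C by simp
        finally show "norm (F M (yM M t)) \<le> C * exp (- (b * t ^ 2))" by (simp add: y_def)
      next
        case False
        then show "norm (F M (yM M t)) \<le> C * exp (- (b * t ^ 2))" using C by (simp add: F_def)
      qed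
    qed
    show "AE t in lborel. (\<lambda>n. F (n + M1) (yM (n + M1) t)) \<longlonglongrightarrow> - A * gauss beta t"
    proof (rule AE_I2, rule LIMSEQ_ignore_initial_segment)
      fix t :: real
      have y: "(\<lambda>M. yM M t) \<longlonglongrightarrow> ys" unfolding yM_def by real_asymp
      \<comment> \<open>The lower limit tends to 0 and the upper one stays above y1 > ys, so for
        fixed t the point is eventually inside the interval.\<close>
      have "ybot \<longlonglongrightarrow> 0" unfolding ybot_def[abs_def] by real_asymp
      then have "\<forall>\<^sub>F M in sequentially. ybot M < ys / 2" using ys_bounds by (intro order_tendstoD) auto
      moreover have "\<forall>\<^sub>F M in sequentially. yM M t > ys / 2" using y ys_bounds by (intro order_tendstoD(1)[OF y]) auto
      moreover have "\<forall>\<^sub>F M in sequentially. yM M t < y1" using y1 by (intro order_tendstoD(2)[OF y]) auto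
      ultimately have ev: "\<forall>\<^sub>F M in sequentially. (Phi d M (\<i> * of_real (yM M t)) / exp (V (\<i> * of_real (yM M t)) * of_nat M / \<xi>)) *
            exp ((V (\<i> * of_real (yM M t)) - V (\<i> * of_real ys)) * of_nat M / \<xi>) = F M (yM M t)"
        using eventually_ge_at_top[of M0]
      proof eventually_elim
        case (elim M)
        then have "yM M t \<in> I M" using k1[of M] by (auto simp: I_def)
        moreover have "exp ((V (\<i> * of_real (yM M t)) - V (\<i> * of_real ys)) * of_nat M / \<xi>) =
            exp (V (\<i> * of_real (yM M t)) * of_nat M / \<xi>) / lead M"
          by (simp add: lead_def left_diff_distrib diff_divide_distrib exp_diff)
        ultimately show ?case by (simp add: F_def)
      qed
      have "(\<lambda>M. (Phi d M (\<i> * of_real (yM M t)) / exp (V (\<i> * of_real (yM M t)) * of_nat M / \<xi>)) *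
            exp ((V (\<i> * of_real (yM M t)) - V (\<i> * of_real ys)) * of_nat M / \<xi>)) \<longlonglongrightarrow> - A * gauss beta t"
        unfolding A_def by (intro tendsto_mult Phi_imag_limit y tendsto_exp exponent_limit[folded yM_def])
      then show "(\<lambda>M. F M (yM M t)) \<longlonglongrightarrow> - A * gauss beta t"
        using ev by (rule Lim_transform_eventually)
    qed
  qed
  moreover have "(LINT t|lborel. - A * gauss beta t) = - A * (of_real (sqrt pi) / csqrt beta)"
    using gaussian_complex(2)[OF Re_beta_pos] by simp
  ultimately have "(\<lambda>n. of_real (sqrt (real (n + M1))) * integral (I (n + M1)) (\<lambda>y. Phi d (n + M1) (\<i> * of_real y)) / lead (n + M1))
    \<longlonglongrightarrow> - A * (of_real (sqrt pi) / csqrt beta)"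
    by (simp only: int_eq le_add2)
  then show ?thesis
    unfolding A_def I_def by (rule LIMSEQ_offset)
qed

text \<open>On the left side dz = i dy, so up to exponentially small terms h times the sum is -i
  times the integral over y. The second minus sign comes from 1 / (E - 1).\<close>

lemma sum_asymptotics:
  "(\<lambda>M. of_real (sqrt (real M)) * (h M * (\<Sum>k<M. summand d M k)) / lead M)
    \<longlonglongrightarrow> \<i> * rho_lim d * amp (\<i> * of_real ys) * (of_real (sqrt pi) / csqrt beta)"
proof -
  obtain k1 \<delta> C M0 y1 where \<delta>: "\<delta> > 0" and C: "C > 0" and y1: "y1 > ys" and
    *: "\<And>M. M \<ge> M0 \<Longrightarrow> 0 < M \<and> 2 \<le> k1 M \<and> k1 M \<le> M \<and> y1 \<le> ytop (k1 M) M \<and> ytop (k1 M) M < 2 * pi \<and>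
     Phi d M contour_integrable_on linepath (Complex 0 (ybot M)) (Complex 0 (ytop (k1 M) M)) \<and>
     norm (h M * (\<Sum>k<M. summand d M k)
       + line_int d M (Complex 0 (ybot M)) (Complex 0 (ytop (k1 M) M)))
     \<le> C * exp (real M * (X - \<delta>))"
    using sum_approx[of d] by blast
  define S where "S M = h M * (\<Sum>k<M. summand d M k)" for M
  define J where "J M = integral {ybot M..ytop (k1 M) M} (\<lambda>y. Phi d M (\<i> * of_real y))" for M
  define L where "L = - (rho_lim d * amp (\<i> * of_real ys)) * (of_real (sqrt pi) / csqrt beta)"
  have J: "(\<lambda>M. of_real (sqrt (real M)) * J M / lead M) \<longlonglongrightarrow> L"
    unfolding J_def L_def using * y1 by (intro left_side_asymptotics[of M0 y1]) blast+
  have CJ: "line_int d M (Complex 0 (ybot M)) (Complex 0 (ytop (k1 M) M)) = \<i> * J M"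
    if M: "M \<ge> M0" for M
  proof -
    have lt: "ybot M < ytop (k1 M) M"
      using *[OF M] by (auto simp: ybot_def ytop_def xtop_def field_simps)
    have "(Phi d M has_contour_integral line_int d M (Complex 0 (ybot M)) (Complex 0 (ytop (k1 M) M)))
        (linepath (Complex 0 (ybot M)) (Complex 0 (ytop (k1 M) M)))"
      using *[OF M] has_contour_integral_integral by blast
    then have "((\<lambda>y. Phi d M (Complex 0 y)) has_integral
        - \<i> * line_int d M (Complex 0 (ybot M)) (Complex 0 (ytop (k1 M) M))) {ybot M..ytop (k1 M) M}"
      by (subst (asm) has_contour_integral_linepath_same_Re_iff[where c = 0 and a = "ybot M" and b = "ytop (k1 M) M"])
         (use lt in auto)
    then have "J M = - \<i> * line_int d M (Complex 0 (ybot M)) (Complex 0 (ytop (k1 M) M))"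
      unfolding J_def Complex_0_eq by (rule integral_unique)
    then show ?thesis by simp
  qed
  have "(\<lambda>M. of_real (sqrt (real M)) * (S M + \<i> * J M) / lead M) \<longlonglongrightarrow> 0"
  proof (rule tendsto_norm_zero_cancel, rule tendsto_sandwich[OF _ _ tendsto_const])
    show "\<forall>\<^sub>F M in sequentially. norm (of_real (sqrt (real M)) * (S M + \<i> * J M) / lead M) \<le> C * (sqrt (real M) * exp (- \<delta> * real M))"
      using eventually_ge_at_top[of M0]
    proof eventually_elim
      case (elim M)
      have "norm (of_real (sqrt (real M)) * (S M + \<i> * J M) / lead M) = sqrt (real M) * norm (S M + \<i> * J M) / exp (real M * X)"
        by (simp add: norm_divide norm_mult norm_lead)
      also have "\<dots> \<le> sqrt (real M) * (C * exp (real M * (X - \<delta>))) / exp (real M * X)"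
        using *[OF elim] unfolding CJ[OF elim] S_def[symmetric]
        by (intro divide_right_mono mult_left_mono) auto
      also have "\<dots> = C * (sqrt (real M) * exp (real M * (X - \<delta>) - real M * X))"
        by (simp add: exp_diff)
      also have "real M * (X - \<delta>) - real M * X = - \<delta> * real M" by (simp add: algebra_simps)
      finally show ?case .
    qed
    have "(\<lambda>M. sqrt (real M) * exp (- \<delta> * real M)) \<longlonglongrightarrow> 0" using \<delta> by real_asymp
    then show "(\<lambda>M. C * (sqrt (real M) * exp (- \<delta> * real M))) \<longlonglongrightarrow> 0"
      by (rule tendsto_mult_right_zero)
  qed auto
  then have "(\<lambda>M. of_real (sqrt (real M)) * (S M + \<i> * J M) / lead M - \<i> * (of_real (sqrt (real M)) * J M / lead M))
      \<longlonglongrightarrow> 0 - \<i> * L"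
    by (intro tendsto_diff tendsto_mult_left J)
  also have "(\<lambda>M. of_real (sqrt (real M)) * (S M + \<i> * J M) / lead M - \<i> * (of_real (sqrt (real M)) * J M / lead M))
     = (\<lambda>M. of_real (sqrt (real M)) * S M / lead M)"
    by (simp add: fun_eq_iff add_divide_distrib distrib_left)
  also have "0 - \<i> * L = \<i> * rho_lim d * amp (\<i> * of_real ys) * (of_real (sqrt pi) / csqrt beta)"
    by (simp add: L_def)
  finally show ?thesis by (simp only: S_def)
qed

section \<open>The invariant\<close>

lemma phi_eq: "phi u = - (\<i> * of_real \<theta>)"
  by (simp add: phi_def \<theta>_def)

text \<open>The left-hand side is linear in \<open>u\<close>: the sum of \<open>Im (Ln (1 - exp (\<plusminus> u - i \<theta>)))\<close> over both signs is \<open>\<pi> - \<theta>\<close>.\<close>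

lemma Li2_inversion:
  "Li2 (exp (of_real u + \<i> * of_real \<theta>)) - Li2 (exp (of_real u - \<i> * of_real \<theta>))
   - (Li2 (exp (- of_real u + \<i> * of_real \<theta>)) - Li2 (exp (- of_real u - \<i> * of_real \<theta>)))
   = 2 * \<i> * of_real (u * (pi - \<theta>))"
proof -
  define L where "L c s = Li2 (exp (of_real s + \<i> * of_real c))" for c s :: real
  have th: "0 < \<theta>" "\<theta> < pi" using theta_bounds by auto
  have der: "((\<lambda>s. L c (e * s)) has_vector_derivative - of_real e * Ln (1 - exp (of_real (e * s) + \<i> * of_real c))) (at s)"
    if c: "c = \<theta> \<or> c = - \<theta>" for c e s
  proof -
    have "exp (of_real (e * s) + \<i> * of_real c) \<in> cut_plane"
      using th c by (intro exp_cut_plane') auto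
    from has_field_derivative_Li2_exp[OF this]
    have outer: "((\<lambda>w. Li2 (exp w)) has_field_derivative - Ln (1 - exp (of_real (e * s) + \<i> * of_real c))) (at (of_real (e * s) + \<i> * of_real c))" .
    have inner: "((\<lambda>s. of_real (e * s) + \<i> * of_real c) has_vector_derivative of_real e) (at s)"
      by (auto intro!: derivative_eq_intros)
    from field_vector_diff_chain_at[OF inner outer] show ?thesis
      by (simp add: o_def L_def)
  qed
  define D where "D s = L \<theta> (1 * s) - L (- \<theta>) (1 * s) - (L \<theta> (- 1 * s) - L (- \<theta>) (- 1 * s)) - of_real s * (2 * \<i> * of_real (pi - \<theta>))" for s
  have D': "(D has_vector_derivative 0) (at s)" for s
  proof -
    define w where "w = 1 - exp (of_real s + \<i> * of_real (- \<theta>))"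
    define v where "v = 1 - exp (of_real (- s) + \<i> * of_real (- \<theta>))"
    have ne: "Im w \<noteq> 0" "Im v \<noteq> 0" "Im v > 0"
      using sin_theta_pos by (simp_all add: w_def v_def Im_exp)
    then have nn: "w \<notin> \<real>\<^sub>\<le>\<^sub>0" "v \<notin> \<real>\<^sub>\<le>\<^sub>0" "w \<noteq> 0" "v \<noteq> 0"
      by (auto simp: complex_nonpos_Reals_iff)
    have cn: "1 - exp (of_real s + \<i> * of_real \<theta>) = cnj w" "1 - exp (of_real (- s) + \<i> * of_real \<theta>) = cnj v"
      by (simp_all add: w_def v_def exp_cnj)
    have cl: "Ln (cnj w) = cnj (Ln w)" "Ln (cnj v) = cnj (Ln v)"
      using nn by (auto intro: cnj_Ln[symmetric])
    \<comment> \<open>1 - e^(s - i th) = -e^(s - i th) (1 - e^(-s + i th)) with th =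
      \<open>\<theta>\<close>. The principal logarithms add up because the resulting imaginary part
      stays in (-pi, pi).\<close>
    have "w = exp (of_real s + \<i> * of_real (pi - \<theta>)) * cnj v"
    proof -
      have 1: "exp (of_real s + \<i> * of_real (pi - \<theta>)) = - exp (of_real s - \<i> * of_real \<theta>)"
        by (simp add: exp_add exp_diff right_diff_distrib exp_minus)
      have 2: "exp (of_real s - \<i> * of_real \<theta>) * exp (- of_real s + \<i> * of_real \<theta>) = 1"
        by (simp flip: exp_add)
      have "- exp (of_real s - \<i> * of_real \<theta>) * cnj v = - exp (of_real s - \<i> * of_real \<theta>)
          + exp (of_real s - \<i> * of_real \<theta>) * exp (- of_real s + \<i> * of_real \<theta>)"
        unfolding cn(2)[symmetric] by (simp add: algebra_simps)
      then show ?thesis unfolding 1 2 by (simp add: w_def)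
    qed
    then have ew: "exp (of_real s + \<i> * of_real (pi - \<theta>) + cnj (Ln v)) = w"
      using nn by (simp add: exp_add cl(2)[symmetric])
    have "0 < Im (Ln v)" "Im (Ln v) < pi" using Im_Ln_pos_lt_imp[OF ne(3)] by auto
    then have "Ln w = of_real s + \<i> * of_real (pi - \<theta>) + cnj (Ln v)"
      using th by (intro Ln_unique ew) auto
    then have im: "Im (Ln w) + Im (Ln v) = pi - \<theta>" by simp
    have "(D has_vector_derivative
        - of_real 1 * Ln (1 - exp (of_real (1 * s) + \<i> * of_real \<theta>)) - - of_real 1 * Ln (1 - exp (of_real (1 * s) + \<i> * of_real (- \<theta>)))
        - (- of_real (- 1) * Ln (1 - exp (of_real (- 1 * s) + \<i> * of_real \<theta>)) - - of_real (- 1) * Ln (1 - exp (of_real (- 1 * s) + \<i> * of_real (- \<theta>))))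
        - of_real 1 * (2 * \<i> * of_real (pi - \<theta>))) (at s)" (is "(D has_vector_derivative ?E) _")
      unfolding D_def[abs_def]
      by (intro has_vector_derivative_diff der has_vector_derivative_mult_left has_vector_derivative_of_real DERIV_ident) auto
    moreover have "?E = - cnj (Ln w) + Ln w - (cnj (Ln v) - Ln v) - 2 * \<i> * of_real (pi - \<theta>)"
    proof -
      have c1: "of_real (1 * s) + \<i> * of_real c = of_real s + \<i> * of_real c" for c by simp
      have c2: "of_real (- 1 * s) + \<i> * of_real c = of_real (- s) + \<i> * of_real c" for c by simp
      show ?thesis
        unfolding c1 c2 cn cl w_def[symmetric] v_def[symmetric] by simp
    qed
    moreover have "- cnj (Ln w) + Ln w - (cnj (Ln v) - Ln v) - 2 * \<i> * of_real (pi - \<theta>) = 0"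
      unfolding im[symmetric] by (simp add: complex_eq_iff)
    ultimately show ?thesis by (simp only:)
  qed
  have "\<exists>c. \<forall>x\<in>UNIV. D x = c"
    by (rule has_derivative_zero_constant) (use D' in \<open>auto simp: has_vector_derivative_def\<close>)
  then have "D u = D 0" by auto
  also have "D 0 = 0" by (simp add: D_def)
  finally show ?thesis by (simp add: D_def L_def algebra_simps)
qed

text \<open>The dilogarithms in \<open>S\<close> have arguments outside the unit disc. Inversion
  moves them to e^(-u +- i th), th = \<open>\<theta>\<close>, as in \<open>V\<close>, and the linear
  terms i u th + 2 i u (pi - th) add up to i u ys.\<close>

lemma S_eq: "S u = V (\<i> * of_real ys)"
proof -
  have e: "exp (\<i> * of_real ys - of_real u) = exp (- of_real u - \<i> * of_real \<theta>)"
    "exp (- (\<i> * of_real ys) - of_real u) = exp (- of_real u + \<i> * of_real \<theta>)"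
    by (simp_all add: ys_def exp_add exp_diff exp_minus right_diff_distrib field_simps)
  have "S u = Li2 (exp (of_real u + \<i> * of_real \<theta>)) - Li2 (exp (of_real u - \<i> * of_real \<theta>)) + of_real u * \<i> * of_real \<theta>"
    by (simp add: S_def phi_eq)
  also have "Li2 (exp (of_real u + \<i> * of_real \<theta>)) - Li2 (exp (of_real u - \<i> * of_real \<theta>))
     = (Li2 (exp (- of_real u + \<i> * of_real \<theta>)) - Li2 (exp (- of_real u - \<i> * of_real \<theta>))) + 2 * \<i> * of_real (u * (pi - \<theta>))"
    using Li2_inversion by (simp only: diff_eq_eq add.commute)
  finally show ?thesis
    unfolding V_def e by (simp add: ys_def algebra_simps)
qed

lemma rho_lim_eq: "rho_lim d = ((1 - exp (of_real u - phi u)) * (1 - exp (phi u))) ^ d"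
proof -
  have "exp (\<i> * of_real ys) = exp (phi u)" "exp (of_real u - \<i> * of_real ys) = exp (of_real u - phi u)"
    by (simp_all add: ys_def phi_eq exp_diff exp_add exp_minus right_diff_distrib field_simps)
  then show ?thesis by (simp add: rho_lim_def mult.commute)
qed

text \<open>A zero limit would not determine an asymptotic equivalence.\<close>

lemma rho_lim_nonzero: "rho_lim d \<noteq> 0"
proof -
  have "exp (\<i> * of_real ys) \<noteq> 1"
  proof
    assume "exp (\<i> * of_real ys) = 1"
    then have "Im (exp (\<i> * of_real ys)) = 0" by simp
    then show False using sin_theta_pos by (simp add: Im_exp sin_ys)
  qed
  moreover have "norm (exp (of_real u - \<i> * of_real ys)) \<noteq> 1" using u_pos by simp
  then have "exp (of_real u - \<i> * of_real ys) \<noteq> 1" by (metis norm_one)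
  ultimately show ?thesis by (simp add: rho_lim_def)
qed

text \<open>At the saddle f = 1, so the two logarithms sum to -u and the numerator of
  \<open>amp\<close> is e^(-u/2).\<close>

lemma amp_eq: "amp (\<i> * of_real ys) = 1 / (2 * of_real (sinh (u / 2)))"
proof -
  have "of_real u + (Ln (1 - exp (\<i> * of_real ys - of_real u)) + Ln (1 - exp (- (\<i> * of_real ys) - of_real u))) = 0"
    using V'_imag[of ys] by (simp add: V'_def ell_ys add.assoc)
  then have "Ln (1 - exp (\<i> * of_real ys - of_real u)) + Ln (1 - exp (- (\<i> * of_real ys) - of_real u)) = - of_real u"
    by (simp add: add_eq_0_iff)
  then have "amp (\<i> * of_real ys) = exp (- of_real (u / 2)) / (1 - exp (- of_real u))"
    by (simp add: amp_def)
  also have "1 - exp (- of_real u) = exp (- of_real (u / 2)) * (2 * of_real (sinh (u / 2)) :: complex)"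
  proof -
    have "1 - exp (- u) = exp (- (u / 2)) * (2 * sinh (u / 2))"
      by (simp add: sinh_def algebra_simps flip: exp_add)
    then have "of_real (1 - exp (- u)) = (of_real (exp (- (u / 2)) * (2 * sinh (u / 2))) :: complex)"
      by simp
    then show ?thesis by (simp flip: exp_of_real)
  qed
  finally show ?thesis by simp
qed

text \<open>Both sides have the same square; the issue is the sign. T u = 1 / (i sin
  \<open>\<theta>\<close>) has argument -pi/2 and \<open>\<xi>\<close> has argument in (0, pi/2), so
  all sums of principal logarithms that occur are principal again.\<close>

lemma sqrt_constants:
  assumes M: "M > 0"
  shows "of_nat M / \<xi> / of_real (sqrt (real M)) / csqrt beta = T u powr (1 / 2) * (of_nat M / \<xi>) powr (1 / 2)"
proof -
  define s where "s = sin \<theta>"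
  have s: "s > 0" unfolding s_def by (rule sin_theta_pos)
  define w where "w = \<i> * complex_of_real s"
  have T: "T u = inverse w"
  proof -
    have "exp u + exp (- u) = 2 * cosh u" by (simp add: cosh_def)
    then have e: "exp u + exp (- u) = 2 * cos \<theta> + 1" using cos_theta by simp
    have "(exp u + exp (- u) + 1) * (exp u + exp (- u) - 3) = - 4 * (1 - cos \<theta> ^ 2)"
      unfolding e by (simp add: power2_eq_square algebra_simps)
    also have "1 - cos \<theta> ^ 2 = s ^ 2" by (simp add: s_def sin_squared_eq)
    finally have "(exp u + exp (- u) + 1) * (exp u + exp (- u) - 3) = - ((2 * s) ^ 2)" by simp
    then have "T u = 2 / csqrt (of_real (- ((2 * s) ^ 2)))" unfolding T_def by simp
    also have "csqrt (of_real (- ((2 * s) ^ 2))) = \<i> * of_real (2 * s)"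
      using s by (subst csqrt_of_real_nonpos) (auto simp: real_sqrt_mult)
    finally show ?thesis using s by (simp add: w_def field_simps)
  qed
  have w0: "w \<noteq> 0" using s by (simp add: w_def)
  have Lw: "Ln w = of_real (ln s) + \<i> * of_real (pi / 2)"
  proof (rule Ln_unique)
    have "exp (\<i> * of_real (pi / 2)) = \<i>" by (simp only: cis_conv_exp[symmetric] cis_pi_half)
    then show "exp (of_real (ln s) + \<i> * of_real (pi / 2)) = w"
      using s unfolding exp_add by (simp add: w_def exp_of_real)
  qed auto
  have x: "0 < Im (Ln \<xi>)" "Im (Ln \<xi>) < pi" "\<bar>Im (Ln \<xi>)\<bar> < pi / 2"
    using Im_Ln_pos_lt_imp[of \<xi>] Re_Ln_pos_lt_imp[of \<xi>] u_pos by auto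
  have b: "beta = w / \<xi>" by (simp add: beta_def w_def s_def)
  have L1: "Ln (inverse w) = - Ln w"
  proof (rule Ln_unique)
    show "exp (- Ln w) = inverse w" using w0 by (simp add: exp_minus)
    have "Im (Ln w) = pi / 2" by (simp add: Lw)
    then show "- pi < Im (- Ln w)" "Im (- Ln w) \<le> pi"
      using pi_gt_zero unfolding uminus_complex.sel by linarith+
  qed
  have L2: "Ln (of_nat M / \<xi>) = of_real (ln (real M)) - Ln \<xi>"
    by (rule Ln_unique) (use M x in \<open>auto simp: exp_diff exp_of_real\<close>)
  have L3: "Ln beta = Ln w - Ln \<xi>"
    unfolding b
  proof (rule Ln_unique)
    show "exp (Ln w - Ln \<xi>) = w / \<xi>" using w0 by (simp add: exp_diff)
    have "Im (Ln w) = pi / 2" by (simp add: Lw)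
    then show "- pi < Im (Ln w - Ln \<xi>)" "Im (Ln w - Ln \<xi>) \<le> pi"
      using x pi_gt_zero unfolding minus_complex.sel by linarith+
  qed
  have b0: "beta \<noteq> 0" using Re_beta_pos by auto
  have "T u powr (1 / 2) * (of_nat M / \<xi>) powr (1 / 2) * csqrt beta =
      exp (Ln (inverse w) / 2) * exp (Ln (of_nat M / \<xi>) / 2) * exp (Ln beta / 2)"
    using w0 M b0 unfolding T by (simp add: powr_def csqrt_exp_Ln)
  also have "\<dots> = exp (of_real (ln (real M) / 2) - Ln \<xi>)"
  proof -
    have "- Ln w / 2 + (of_real (ln (real M)) - Ln \<xi>) / 2 + (Ln w - Ln \<xi>) / 2 = of_real (ln (real M) / 2) - Ln \<xi>"
      by (simp add: diff_divide_distrib)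
    then show ?thesis unfolding L1 L2 L3 exp_add[symmetric] by (simp only:)
  qed
  also have "\<dots> = of_real (sqrt (real M)) / \<xi>"
  proof -
    have "exp (ln (real M) / 2) = sqrt (real M)"
      using M by (simp add: ln_sqrt[symmetric])
    then have "exp (of_real (ln (real M) / 2)) = (of_real (sqrt (real M)) :: complex)"
      by (simp only: exp_of_real)
    then show ?thesis unfolding exp_diff by (simp only: exp_Ln[OF xi_nonzero])
  qed
  finally have eq: "T u powr (1 / 2) * (of_nat M / \<xi>) powr (1 / 2) * csqrt beta = of_real (sqrt (real M)) / \<xi>" .
  have sM: "of_real (sqrt (real M)) \<noteq> (0 :: complex)" using M by simp
  have "of_nat M = (of_real (sqrt (real M)) * of_real (sqrt (real M)) :: complex)"
    by (simp flip: of_real_mult)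
  then have "of_nat M / \<xi> / of_real (sqrt (real M)) = of_real (sqrt (real M)) / \<xi>"
    using sM by simp
  then show ?thesis unfolding eq[symmetric] using b0 by simp
qed

section \<open>Rewriting the invariant through rho and g\<close>

lemma qint_factor: "qint hh m = - qpow hh (- (real m / 2)) * (1 - exp (of_nat m * hh))"
  by (simp add: qint_def qpow_def algebra_simps flip: exp_add)

lemma exp_xi: "exp \<xi> = exp (of_real u)"
  by (simp add: \<xi>_def exp_add)

lemma exp_grid_ne_1:
  assumes "M > 0" "m > 0" shows "exp (of_nat m * h M) \<noteq> 1"
proof -
  have "0 < real m * (u / real M)" using assms u_pos by simp
  then have "norm (exp (of_nat m * h M)) > 1" by (simp add: Re_h)
  then show ?thesis by (metis norm_one less_irrefl)
qed

lemma qint_nonzero: "M > 0 \<Longrightarrow> m > 0 \<Longrightarrow> qint (h M) m \<noteq> 0"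
  using exp_grid_ne_1[of M m] by (simp add: qint_factor qpow_def)

text \<open>The form in which the factors occur in the invariant, where e^u = q^M.\<close>

lemma f_eq': "f z = exp (- of_real u) * ((1 - exp (of_real u - z)) * (1 - exp (of_real u + z)))"
proof -
  have "exp (- of_real u) * ((1 - exp (of_real u - z)) * (1 - exp (of_real u + z))) =
     exp (- of_real u) - exp (- z) - exp z + exp (of_real u)"
    by (simp add: algebra_simps flip: exp_add)
  moreover have "f z = exp (of_real u) - exp z - exp (- z) + exp (- of_real u)"
    by (simp add: f_def algebra_simps flip: exp_add)
  ultimately show ?thesis by simp
qed

text \<open>The factors 1 - q^(M-l), 1 <= l <= d, which are missing from the invariant: its product
  begins with q^(N-1) = q^(M-d-1).\<close>

definition dfac :: "nat \<Rightarrow> nat \<Rightarrow> complex" where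
  "dfac d M = (\<Prod>l=1..d. 1 - exp (of_real u - of_nat l * h M))"

definition pref :: "nat \<Rightarrow> nat \<Rightarrow> complex" where
  "pref d M = (- 1) ^ d * qpow (h M) (- (real (d * (d + 1)) / 4)) / (dfac d M * qfact (h M) d)"

lemma exp_u_minus: "M > 0 \<Longrightarrow> exp (of_real u - z) = exp (of_nat M * h M - z)"
  by (simp add: of_nat_h exp_diff exp_xi)

lemma exp_u_plus: "M > 0 \<Longrightarrow> exp (of_real u + z) = exp (of_nat M * h M + z)"
  by (simp add: of_nat_h exp_add exp_xi)

lemma dfac_nonzero:
  assumes "d < M" shows "dfac d M \<noteq> 0"
proof -
  have "exp (of_real u - of_nat l * h M) \<noteq> 1" if "l \<in> {1..d}" for l
  proof -
    have "of_nat M * h M - of_nat l * h M = of_nat (M - l) * h M"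
      using that assms by (simp add: of_nat_diff left_diff_distrib)
    then show ?thesis using exp_grid_ne_1[of M "M - l"] that assms exp_u_minus[of M "of_nat l * h M"] by simp
  qed
  then show ?thesis by (simp add: dfac_def)
qed

lemma qfact_ratio:
  assumes M: "M > 0"
  shows "qfact (h M) (d + k) / qfact (h M) k = (\<Prod>i=1..d. qint (h M) (k + i))"
proof -
  have "{1..d + k} = {1..k} \<union> {k+1..k+d}" by auto
  then have "qfact (h M) (d + k) = (\<Prod>i\<in>{1..k} \<union> {k+1..k+d}. qint (h M) i)" by (simp add: qfact_def)
  also have "\<dots> = qfact (h M) k * (\<Prod>i=k+1..k+d. qint (h M) i)"
    unfolding qfact_def by (rule prod.union_disjoint) auto
  also have "(\<Prod>i=k+1..k+d. qint (h M) i) = (\<Prod>i=1..d. qint (h M) (k + i))"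
    by (rule prod.reindex_bij_witness[of _ "\<lambda>i. k + i" "\<lambda>i. i - k"]) auto
  finally show ?thesis
    using qint_nonzero[OF M] by (simp add: qfact_def)
qed

lemma prod_qpow: "finite A \<Longrightarrow> (\<Prod>i\<in>A. qpow hh (a i)) = qpow hh (\<Sum>i\<in>A. a i)"
  by (induction A rule: finite_induct) (auto simp: qpow_def exp_add ring_distribs)

lemma qpow_add: "qpow hh (a + b) = qpow hh a * qpow hh b"
  by (simp add: qpow_def exp_add ring_distribs)

text \<open>From q^M = e^u one gets q^(N-l) = e^(u-(d+l)h) and q^(N+l+d) = e^(u+lh). The shift of l
  by d in the first factors is traded for d factors at the far end, which join \<open>rho\<close>,
  divided by \<open>dfac\<close>.\<close>

lemma J_term:
  assumes N: "N \<ge> 1" and M: "M = N + d" and k: "k < N"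
  shows "qfact (h M) (d + k) / qfact (h M) k * qpow (h M) (- real k * (real N + real d / 2)) *
      (\<Prod>l=1..k. (1 - qpow (h M) (real N - real l)) * (1 - qpow (h M) (real N + real l + real d)))
    = (- 1) ^ d * qpow (h M) (- (real (d * (d + 1)) / 4)) / dfac d M * summand d M k"
proof -
  define H where "H = h M"
  have Mp: "M > 0" using N M by simp
  have dM: "d < M" using N M by simp
  define U where "U l = 1 - exp (of_real u - of_nat l * H)" for l :: nat
  define W where "W l = 1 - exp (of_real u + of_nat l * H)" for l :: nat
  define R where "R i = 1 - exp (of_nat (k + i) * H)" for i :: nat
  have 1: "qfact H (d + k) / qfact H k = (- 1) ^ d * qpow H (- (real (d * k) / 2) - real (d * (d + 1)) / 4) * (\<Prod>i=1..d. R i)"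
  proof -
    have "qfact H (d + k) / qfact H k = (\<Prod>i=1..d. - 1 * qpow H (- (real (k + i) / 2)) * R i)"
      unfolding H_def qfact_ratio[OF Mp] qint_factor R_def by simp
    also have "\<dots> = (- 1) ^ d * qpow H (\<Sum>i=1..d. - (real (k + i) / 2)) * (\<Prod>i=1..d. R i)"
      by (simp only: prod.distrib prod_qpow[OF finite_atLeastAtMost]) simp
    also have "(\<Sum>i=1..d. - (real (k + i) / 2)) = - (real (d * k) / 2) - real (d * (d + 1)) / 4"
      by (induction d) (auto simp: field_simps)
    finally show ?thesis .
  qed
  have 2: "1 - qpow H (real N - real l) = U (d + l)" for l
  proof -
    have "of_real (real N - real l) * H = of_nat M * H - of_nat (d + l) * H"
      by (simp add: M algebra_simps)
    then show ?thesis unfolding qpow_def U_def H_def exp_u_minus[OF Mp] by simp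
  qed
  have 3: "1 - qpow H (real N + real l + real d) = W l" for l
  proof -
    have "of_real (real N + real l + real d) * H = of_nat M * H + of_nat l * H"
      by (simp add: M algebra_simps)
    then show ?thesis unfolding qpow_def W_def H_def exp_u_plus[OF Mp] by simp
  qed
  have 4: "(\<Prod>l=1..k. U (d + l)) = (\<Prod>l=1..k. U l) * (\<Prod>i=1..d. U (k + i)) / dfac d M"
  proof -
    have a: "(\<Prod>l=1..d+k. U l) = (\<Prod>l=1..d. U l) * (\<Prod>l=1..k. U (d + l))" for d k
    proof -
      have "{1..d + k} = {1..d} \<union> {d+1..d+k}" by auto
      then have "(\<Prod>l=1..d+k. U l) = (\<Prod>l=1..d. U l) * (\<Prod>l=d+1..d+k. U l)"
        by (simp only:) (rule prod.union_disjoint, auto)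
      also have "(\<Prod>l=d+1..d+k. U l) = (\<Prod>l=1..k. U (d + l))"
        by (rule prod.reindex_bij_witness[of _ "\<lambda>i. d + i" "\<lambda>i. i - d"]) auto
      finally show ?thesis .
    qed
    have "(\<Prod>l=1..d. U l) * (\<Prod>l=1..k. U (d + l)) = (\<Prod>l=1..k. U l) * (\<Prod>i=1..d. U (k + i))"
      using a[of d k] a[of k d] by (simp add: add.commute)
    moreover have "(\<Prod>l=1..d. U l) = dfac d M" by (simp add: U_def dfac_def H_def)
    ultimately show ?thesis using dfac_nonzero[OF dM] by (simp add: field_simps)
  qed
  have 5: "g M (of_nat k * H) = exp (- (of_nat k * of_real u)) * ((\<Prod>l=1..k. U l) * (\<Prod>l=1..k. W l))"
  proof -
    have "g M (of_nat k * H) = (\<Prod>l=1..k. exp (- of_real u) * (U l * W l))"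
      unfolding H_def using k M by (subst g_grid[OF Mp]) (auto simp: f_eq' U_def W_def H_def)
    also have "\<dots> = exp (- of_real u) ^ k * ((\<Prod>l=1..k. U l) * (\<Prod>l=1..k. W l))"
      by (simp add: prod.distrib)
    also have "exp (- of_real u :: complex) ^ k = exp (- (of_nat k * of_real u))"
      by (simp flip: exp_of_nat_mult)
    finally show ?thesis .
  qed
  have 6: "rho d M (of_nat k * H) = (\<Prod>i=1..d. R i) * (\<Prod>i=1..d. U (k + i))"
    unfolding rho_def prod.distrib[symmetric] R_def U_def H_def
    by (intro prod.cong refl) (simp add: algebra_simps)
  \<comment> \<open>The exponents -d k/2 and -k (N + d/2) add up to -k M, and q^(-k M) = e^(-k u)
    supplies the factors e^-u of \<open>f_eq'\<close>.\<close>
  have 7: "qpow H (- (real (d * k) / 2) - real (d * (d + 1)) / 4) * qpow H (- real k * (real N + real d / 2)) =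
     qpow H (- (real (d * (d + 1)) / 4)) * exp (- (of_nat k * of_real u))"
  proof -
    have "qpow H (- real k * real M) = exp (- (of_nat k * \<xi>))"
      using of_nat_h[OF Mp] by (simp add: qpow_def H_def mult.assoc)
    also have "\<dots> = inverse (exp \<xi> ^ k)"
      by (simp add: exp_minus exp_of_nat_mult)
    also have "\<dots> = exp (- (of_nat k * of_real u))"
      unfolding exp_xi by (simp add: exp_minus exp_of_nat_mult)
    finally have "qpow H (- real k * real M) = exp (- (of_nat k * of_real u))" .
    moreover have e: "(- (real (d * k) / 2) - real (d * (d + 1)) / 4) + - real k * (real N + real d / 2) =
       - (real (d * (d + 1)) / 4) + - real k * real M"
      by (simp add: M algebra_simps)
    have "qpow H (- (real (d * k) / 2) - real (d * (d + 1)) / 4) * qpow H (- real k * (real N + real d / 2))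
       = qpow H (- (real (d * (d + 1)) / 4)) * qpow H (- real k * real M)"
      unfolding qpow_add[symmetric] e ..
    ultimately show ?thesis by (simp only:)
  qed
  have "qfact H (d + k) / qfact H k * qpow H (- real k * (real N + real d / 2)) *
      (\<Prod>l=1..k. (1 - qpow H (real N - real l)) * (1 - qpow H (real N + real l + real d)))
    = (- 1) ^ d * (\<Prod>i=1..d. R i) * (qpow H (- (real (d * k) / 2) - real (d * (d + 1)) / 4) * qpow H (- real k * (real N + real d / 2)))
      * ((\<Prod>l=1..k. U (d + l)) * (\<Prod>l=1..k. W l))"
    unfolding 1 2 3 prod.distrib by (simp add: mult_ac)
  also have "\<dots> = (- 1) ^ d * qpow H (- (real (d * (d + 1)) / 4)) / dfac d M * (rho d M (of_nat k * H) * g M (of_nat k * H))"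
    unfolding 4 5 6 7 by (simp add: mult_ac)
  finally show ?thesis unfolding H_def .
qed

text \<open>The invariant has N terms, the sum on the right M = N + d. The added terms vanish: for N
  <= k < M the factor i = M - k of \<open>rho\<close> contains 1 - e^(u - M h) = 0.\<close>

lemma J_eq:
  assumes n: "n \<ge> 2" and N: "N \<ge> 1"
  defines "d \<equiv> n - 2" and "M \<equiv> N + (n - 2)"
  shows "J_fig8 n N (h M) = pref d M * (\<Sum>k<M. summand d M k)"
proof -
  have Mp: "M > 0" using N by (simp add: M_def)
  have MN: "M = N + d" by (simp add: M_def d_def)
  have rn: "real n = real d + 2" using n by (simp add: d_def)
  define P where "P = (- 1) ^ d * qpow (h M) (- (real (d * (d + 1)) / 4)) / dfac d M"
  have "J_fig8 n N (h M) = 1 / qfact (h M) d * (\<Sum>k=0..N-1. P * summand d M k)"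
    unfolding J_fig8_def d_def[symmetric]
  proof (rule arg_cong2[of _ _ _ _ "(*)"], rule refl, rule sum.cong, rule refl)
    fix k assume "k \<in> {0..N - 1}"
    then have k: "k < N" using N by auto
    have e: "real n - 2 = real d" "real N + real l + real n - 2 = real N + real l + real d" for l
      using rn by simp_all
    show "qfact (h M) (d + k) / qfact (h M) k * qpow (h M) (- real k * (real N + (real n - 2) / 2)) *
      (\<Prod>l=1..k. (1 - qpow (h M) (real N - real l)) * (1 - qpow (h M) (real N + real l + real n - 2)))
      = P * summand d M k"
      unfolding e P_def by (rule J_term[OF N MN k])
  qed
  also have "\<dots> = pref d M * (\<Sum>k=0..N-1. summand d M k)"
    unfolding sum_distrib_left[symmetric] by (simp add: pref_def P_def)
  also have "(\<Sum>k=0..N-1. summand d M k) = (\<Sum>k<M. summand d M k)"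
  proof (rule sum.mono_neutral_left)
    show "\<forall>k\<in>{..<M} - {0..N - 1}. summand d M k = 0"
    proof
      fix k assume "k \<in> {..<M} - {0..N - 1}"
      then have k: "k < M" "N \<le> k" by auto
      have i: "M - k \<in> {1..d}" using k MN by auto
      have "of_real u - of_nat k * h M - of_nat (M - k) * h M = of_real u - \<xi>"
        using k of_nat_h[OF Mp] by (simp add: of_nat_diff algebra_simps)
      then have "exp (of_real u - of_nat k * h M - of_nat (M - k) * h M) = exp (of_real u - \<xi>)"
        by (simp only:)
      also have "\<dots> = 1" by (simp add: exp_diff exp_xi)
      finally have "exp (of_real u - of_nat k * h M - of_nat (M - k) * h M) = 1" .
      then have "rho d M (of_nat k * h M) = 0"
        unfolding rho_def using i by (intro prod_zero) (auto intro!: bexI[of _ "M - k"])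
      then show "summand d M k = 0" by simp
    qed
  qed (use N MN in auto)
  finally show ?thesis .
qed

section \<open>Assembling the asymptotics\<close>

lemma qint_asymptotics: "(\<lambda>M. qint (h M) m / h M) \<longlonglongrightarrow> of_nat m"
proof -
  have "((\<lambda>w. exp (of_real (real m / 2) * w) - exp (- of_real (real m / 2) * w)) has_field_derivative of_nat m) (at 0)"
    by (auto intro!: derivative_eq_intros)
  then have "((\<lambda>w. qint w m / w) \<longlongrightarrow> of_nat m) (at 0)"
    by (simp add: has_field_derivative_iff qint_def qpow_def)
  moreover have "filterlim h (at 0) sequentially"
    unfolding filterlim_at using h_tendsto_0 eventually_gt_at_top[of "0::nat"]
    by (auto simp: h_def elim!: eventually_mono)
  ultimately show ?thesis by (rule filterlim_compose)
qed

text \<open>The q-factorial behaves like d! h^d, and \<open>dfac\<close> tends to (1 - e^u)^d, whose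
  sign cancels (-1)^d.\<close>

lemma pref_asymptotics:
  "(\<lambda>M. pref d M * h M ^ d) \<longlonglongrightarrow> 1 / (fact d * (exp (of_real u) - 1) ^ d)"
proof -
  have q: "(\<lambda>M. \<Prod>i=1..d. qint (h M) i / h M) \<longlonglongrightarrow> (\<Prod>i=1..d. of_nat i)"
    by (intro tendsto_prod qint_asymptotics)
  have D: "dfac d \<longlonglongrightarrow> (\<Prod>l=1..d. 1 - exp (of_real u - of_nat l * 0))"
    unfolding dfac_def[abs_def] by (intro tendsto_intros h_tendsto_0)
  have e: "(\<lambda>M. qpow (h M) (- (real (d * (d + 1)) / 4))) \<longlonglongrightarrow> exp (of_real (- (real (d * (d + 1)) / 4)) * 0)"
    unfolding qpow_def by (intro tendsto_intros h_tendsto_0)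
  have u1: "exp (of_real u) \<noteq> (1 :: complex)" using one_minus_exp_u by (simp add: exp_minus)
  have f: "(\<Prod>i=1..d. of_nat i) = (fact d :: complex)" by (simp add: fact_prod)
  have "(\<lambda>M. (- 1) ^ d * qpow (h M) (- (real (d * (d + 1)) / 4)) / (dfac d M * (\<Prod>i=1..d. qint (h M) i / h M)))
    \<longlonglongrightarrow> (- 1) ^ d * exp (of_real (- (real (d * (d + 1)) / 4)) * 0) / ((\<Prod>l=1..d. 1 - exp (of_real u - of_nat l * 0)) * (\<Prod>i=1..d. of_nat i))"
    by (intro tendsto_intros q D e) (use u1 in \<open>simp add: f\<close>)
  moreover have "(- 1) ^ d * exp (of_real (- (real (d * (d + 1)) / 4)) * 0) / ((\<Prod>l=1..d. 1 - exp (of_real u - of_nat l * 0)) * (\<Prod>i=1..d. of_nat i))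
     = 1 / (fact d * (exp (of_real u) - 1) ^ d :: complex)"
  proof -
    have "(exp (of_real u) - 1 :: complex) ^ d = (- 1) ^ d * (1 - exp (of_real u)) ^ d"
      by (simp flip: power_mult_distrib)
    moreover have "(- 1 :: complex) ^ d * (- 1) ^ d = 1" by (simp flip: power_mult_distrib)
    ultimately show ?thesis using u1 by (simp add: f[unfolded One_nat_def] field_simps)
  qed
  moreover have "\<forall>\<^sub>F M in sequentially. (- 1) ^ d * qpow (h M) (- (real (d * (d + 1)) / 4)) / (dfac d M * (\<Prod>i=1..d. qint (h M) i / h M)) = pref d M * h M ^ d"
    using eventually_gt_at_top[of "0::nat"]
  proof eventually_elim
    case (elim M)
    have "(\<Prod>i=1..d. qint (h M) i / h M) = qfact (h M) d / h M ^ d"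
      by (simp add: prod_dividef qfact_def)
    then show ?case by (simp add: pref_def)
  qed
  ultimately show ?thesis by (simp add: Lim_transform_eventually)
qed

definition target :: "nat \<Rightarrow> nat \<Rightarrow> complex" where
  "target d M = ((1 - exp (of_real u - phi u)) * (1 - exp (phi u))) ^ d
        * (1 / fact d)
        * (1 / (exp (of_real u) - 1) ^ d)
        * (csqrt (- of_real pi) / (2 * of_real (sinh (u / 2))))
        * T u powr (1 / 2)
        * (of_nat M / \<xi>) powr (1 / 2 + of_nat d)
        * exp (of_nat M / \<xi> * S u)"

text \<open>Splits the claimed right-hand side into the limits for prefactor and sum. As M /
  \<open>\<xi>\<close> = 1/h, the integral power gives h^d; the half powers come from
  \<open>sqrt_constants\<close>.\<close>

lemma target_eq:
  assumes M: "M > 0"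
  shows "target d M = (1 / (fact d * (exp (of_real u) - 1) ^ d)) *
    (\<i> * rho_lim d * amp (\<i> * of_real ys) * (of_real (sqrt pi) / csqrt beta)) *
    (lead M / (of_real (sqrt (real M)) * h M * h M ^ d))"
proof -
  have c: "csqrt (- of_real pi) = \<i> * of_real (sqrt pi)"
    by (subst csqrt_of_real_nonpos) auto
  have p: "(of_nat M / \<xi>) powr (1 / 2 + of_nat d) = (of_nat M / \<xi>) powr (1 / 2) * (of_nat M / \<xi>) ^ d"
    using M by (simp add: powr_add powr_nat')
  have hh: "of_nat M / \<xi> = inverse (h M)" by (simp add: h_def)
  have l: "exp (of_nat M / \<xi> * S u) = lead M" by (simp add: lead_def S_eq mult.commute)
  have "target d M = (1 / (fact d * (exp (of_real u) - 1) ^ d)) * rho_lim d * (\<i> * of_real (sqrt pi)) * amp (\<i> * of_real ys)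
     * (T u powr (1 / 2) * (of_nat M / \<xi>) powr (1 / 2)) * (of_nat M / \<xi>) ^ d * lead M"
    unfolding target_def rho_lim_eq[symmetric] c p l amp_eq by simp
  also have "T u powr (1 / 2) * (of_nat M / \<xi>) powr (1 / 2) = inverse (h M) / of_real (sqrt (real M)) / csqrt beta"
    using sqrt_constants[OF M] unfolding hh by simp
  finally show ?thesis unfolding hh by (simp add: divide_inverse power_inverse mult_ac)
qed

lemma J_asymptotics:
  assumes n: "n \<ge> 2"
  shows "(\<lambda>N. J_fig8 n N (\<xi> / of_nat (N + (n - 2)))) \<sim>[sequentially] (\<lambda>N. target (n - 2) (N + (n - 2)))"
proof -
  define d where "d = n - 2"
  define Z where "Z M = (\<Sum>k<M. summand d M k)" for M
  define c where "c = (1 / (fact d * (exp (of_real u) - 1) ^ d) :: complex)"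
  define K where "K = \<i> * rho_lim d * amp (\<i> * of_real ys) * (of_real (sqrt pi) / csqrt beta)"
  have u1: "exp (of_real u) \<noteq> (1 :: complex)" using one_minus_exp_u by (simp add: exp_minus)
  have c0: "c \<noteq> 0" using u1 by (simp add: c_def)
  have K0: "K \<noteq> 0"
    using rho_lim_nonzero Re_beta_pos u_pos by (auto simp: K_def amp_eq)
  have "(\<lambda>M. (pref d M * h M ^ d) * (of_real (sqrt (real M)) * (h M * Z M) / lead M) / (c * K)) \<longlonglongrightarrow> c * K / (c * K)"
    unfolding Z_def using c0 K0
    by (intro tendsto_divide tendsto_mult tendsto_const pref_asymptotics[of d, folded c_def] sum_asymptotics[of d, folded K_def]) auto
  then have "(\<lambda>M. (pref d M * h M ^ d) * (of_real (sqrt (real M)) * (h M * Z M) / lead M) / (c * K)) \<longlonglongrightarrow> 1"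
    using c0 K0 by simp
  then have lim: "(\<lambda>N. (pref d (N + d) * h (N + d) ^ d) * (of_real (sqrt (real (N + d))) * (h (N + d) * Z (N + d)) / lead (N + d)) / (c * K)) \<longlonglongrightarrow> 1"
    by (rule LIMSEQ_ignore_initial_segment)
  have "(\<lambda>N. J_fig8 n N (\<xi> / of_nat (N + d)) / target d (N + d)) \<longlonglongrightarrow> 1"
  proof (rule Lim_transform_eventually[OF lim])
    show "\<forall>\<^sub>F N in sequentially. (pref d (N + d) * h (N + d) ^ d) * (of_real (sqrt (real (N + d))) * (h (N + d) * Z (N + d)) / lead (N + d)) / (c * K)
        = J_fig8 n N (\<xi> / of_nat (N + d)) / target d (N + d)"
      using eventually_ge_at_top[of "1::nat"]
    proof eventually_elim
      case (elim N)
      define M where "M = N + d"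
      have M: "M > 0" using elim by (simp add: M_def)
      have "J_fig8 n N (\<xi> / of_nat M) = pref d M * Z M"
        using J_eq[OF n elim] by (simp add: M_def d_def Z_def h_def)
      moreover have "target d M = c * K * (lead M / (of_real (sqrt (real M)) * h M * h M ^ d))"
        unfolding c_def K_def by (rule target_eq[OF M])
      ultimately show ?case
        unfolding M_def[symmetric] by (simp add: divide_inverse mult_ac)
    qed
  qed
  then show ?thesis
    unfolding d_def by (rule asymp_equivI')
qed

end

theorem theorem3:
  fixes n :: nat and u :: real and \<xi> :: complex
  assumes "n \<ge> 2" and "even n"
    and "0 < u" and "u < ln ((3 + sqrt 5) / 2)"
    and "\<xi> = 2 * of_real pi * \<i> + of_real u"
  shows "(\<lambda>N. J_fig8 n N (\<xi> / of_nat (N + n - 2))) \<sim>[sequentially]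
    (\<lambda>N. ((1 - exp (of_real u - phi u)) * (1 - exp (phi u))) ^ (n - 2)
        * (1 / fact (n - 2))
        * (1 / (exp (of_real u) - 1) ^ (n - 2))
        * (csqrt (- of_real pi) / (2 * of_real (sinh (u / 2))))
        * T u powr (1 / 2)
        * (of_nat (N + n - 2) / \<xi>) powr (1 / 2 + of_nat (n - 2))
        * exp (of_nat (N + n - 2) / \<xi> * S u))"
proof -
  interpret fig8 u
    using assms by unfold_locales
  have xi: "\<xi> = fig8.\<xi> u"
    unfolding assms(5) \<xi>_def by simp
  \<comment> \<open>Natural subtraction is truncated; the two forms agree because n >= 2.\<close>
  have idx: "N + n - 2 = N + (n - 2)" for N
    using assms(1) by simp
  show ?thesis
    using J_asymptotics[OF assms(1)] unfolding target_def xi idx .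
qed

end
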